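(* For $P$-almost all $\omega\in\Omega$ and for $\nu_\omega$-almost all $x\in K_\omega$, we have $$0<\underline\kappa(\nu_\omega,x,\alpha)\le\overline\kappa(\nu_\omega,x,\alpha)<1\quad\text{for all }\alpha\in(0,1),$$ $\kappa(\nu_\omega,x,0)=1$ and $\kappa(\nu_\omega,x,1)=0$.
   Context: Mandelbrot percolation. $\mathbb N=\{1,2,\dots\}$. Fix integers $m\ge 1$, $k\ge 2$ and a probability $p$ with $k^{-m}<p\le 1$ (the range in which the limit set below is non-empty with positive probability). Let $I=\{1,\dots,k^m\}$ and $I^*=\bigcup_{i\ge 0}I^i$ (finite words, $I^0$ consisting of the empty word $\emptyset$), let $|\sigma|$ be the length of a word, $\eta|_i$ the prefix of length $i$ of $\eta\in I^*\cup I^{\mathbb N}$, $\sigma*\tau$ concatenation, and write $\sigma\prec\tau$ (or $\tau\succ\sigma$) if $\tau$ starts with $\sigma$. Let $J_\emptyset=[0,1]^m$; each closed cube $J_\sigma$ of side length $k^{-|\sigma|}$ is divided into $k^m$ closed $k$-adic subcubes $J_{\sigma*1},\dots,J_{\sigma*k^m}$ of side length $k^{-|\sigma|-1}$ (in a fixed enumeration). For $\eta\in I^{\mathbb N}$, $x(\eta)$ is the unique point of $\bigcap_{i\ge0}J_{\eta|_i}$. $\Omega$ is the set of functions $\omega:I^*\to\{c,n\}$ ($c$ = chosen, $n$ = neglected) with the product topology. $P$ is the Borel probability measure on $\Omega$ such that $\omega(\emptyset)=c$ almost surely and, going from each level to the next, if $\omega(\sigma)=c$ then each $\sigma*j$,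 $j\in I$, is chosen independently with probability $p$, while if $\omega(\sigma)=n$ then $\omega(\sigma*j)=n$ for all $j$. The limit set is $K_\omega=\bigcap_{i\ge0}\bigcup_{\sigma\in I^i,\ \omega(\sigma)=c}J_\sigma$. Natural measure. Let $d=\log(k^mp)/\log k$. For $\sigma\in I^*$ let $N_{j,\sigma}=\operatorname{card}\{\tau\in I^*: |\tau|=|\sigma|+j,\ \tau\succ\sigma,\ \omega(\tau)=c\}$ and let $X_\sigma(\omega)=\lim_{j\to\infty}N_{j,\sigma}k^{-jd}$ (a $P$-almost sure finite martingale limit). For $P$-almost every $\omega$, $\mu_\omega$ is the Borel measure on $I^{\mathbb N}$ with $\mu_\omega(\{\eta:\eta|_{|\sigma|}=\sigma\})=(\operatorname{diam}J_\emptyset)^dk^{-|\sigma|d}X_\sigma(\omega)$ for all $\sigma\in I^*$; the natural measure $\nu_\omega$ on $K_\omega$ is the image of $\mu_\omega$ under $\eta\mapsto x(\eta)$. Holes and mean porosity of measures. $B_\varrho(z,r)$ is the open ball of the maximum metric $\varrho(x,y)=\max_i|x_i-y_i|$ in $\mathbb R^m$ (empty if $r=0$). For $j\in\mathbb N$, $Q_j^k(x)$ is the half-open $k$-adic cube $\prod_i[a_ik^{-j},(a_i+1)k^{-j})$, $a_i\in\mathbb Z$, containing $x$. For $\alpha\in[0,1]$ and $\varepsilon>0$, a Radon measure $\mu$ on $\mathbb R^m$ has an $(\alpha,\varepsilon)$-hole at scale $j$ near $x$ if there is $z\in Q_j^k(x)$ with $B_\varrho(z,\tfrac12\alpha k^{-j})\subset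 Q_j^k(x)$ and $\mu(B_\varrho(z,\tfrac12\alpha k^{-j}))\le\varepsilon\mu(Q_j^k(x))$. Let $\widetilde N_i(\mu,x,\alpha,\varepsilon)$ be the number of $j\in\{1,\dots,i\}$ such that $\mu$ has an $(\alpha,\varepsilon)$-hole at scale $j$ near $x$. Set $\underline\kappa(\mu,x,\alpha)=\lim_{\varepsilon\to0}\liminf_{i\to\infty}\widetilde N_i(\mu,x,\alpha,\varepsilon)/i$ and $\overline\kappa(\mu,x,\alpha)=\lim_{\varepsilon\to0}\limsup_{i\to\infty}\widetilde N_i(\mu,x,\alpha,\varepsilon)/i$; when they coincide the common value is $\kappa(\mu,x,\alpha)$.
   Formalization: The inequality 0 < lower κ(ν_ω,x,α) is claimed only for p < 1: for p = 1 the natural measure is a multiple of Lebesgue measure on the cube, so κ = 0 for all α in (0,1); all other conclusions are kept for p = 1. *)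

theory Defs
  imports "HOL-Probability.Probability" "HOL-Library.Sublist"
begin

section \<open>Words and realisations\<close>

datatype status = Chosen | Neglected

definition alphabet :: "nat \<Rightarrow> nat \<Rightarrow> nat set" where
  "alphabet m k = {1..k ^ m}"

abbreviation words :: "nat \<Rightarrow> nat \<Rightarrow> nat list set" where
  "words m k \<equiv> lists (alphabet m k)"

text \<open>The index set is countable and \<open>status\<close> is finite and discrete, so the product sigma-algebra
  is the Borel sigma-algebra of the product topology.\<close>

definition Omega :: "nat \<Rightarrow> nat \<Rightarrow> (nat list \<Rightarrow> status) measure" where
  "Omega m k = (\<Pi>\<^sub>M \<sigma>\<in>words m k. count_space UNIV)"

fun child_prob :: "real \<Rightarrow> status \<Rightarrow> status \<Rightarrow> real" where
  "child_prob p Chosen Chosen = p"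
| "child_prob p Chosen Neglected = 1 - p"
| "child_prob p Neglected Chosen = 0"
| "child_prob p Neglected Neglected = 1"

definition agree_upto ::
  "nat \<Rightarrow> nat \<Rightarrow> (nat list \<Rightarrow> status) \<Rightarrow> nat \<Rightarrow> (nat list \<Rightarrow> status) set" where
  "agree_upto m k \<eta> n =
    {\<omega> \<in> space (Omega m k). \<forall>\<sigma>\<in>words m k. length \<sigma> \<le> n \<longrightarrow> \<omega> \<sigma> = \<eta> \<sigma>}"

text \<open>The last conjunct says that, given the configuration on the levels up to \<open>n\<close>, the statuses of
  the words of level \<open>n + 1\<close> are independent, each with the law \<open>child_prob p\<close> of its parent's
  status. These conditions determine \<open>P\<close>.\<close>

definition percolation_law ::
  "nat \<Rightarrow> nat \<Rightarrow> real \<Rightarrow> (nat list \<Rightarrow> status) measure \<Rightarrow> bool" where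
  "percolation_law m k p P \<longleftrightarrow>
     prob_space P \<and> sets P = sets (Omega m k) \<and>
     (AE \<omega> in P. \<omega> [] = Chosen) \<and>
     (\<forall>n \<eta>. measure P (agree_upto m k \<eta> (Suc n)) =
        measure P (agree_upto m k \<eta> n) *
        (\<Prod>\<sigma>\<in>{\<sigma> \<in> words m k. length \<sigma> = n}. \<Prod>j\<in>alphabet m k.
           child_prob p (\<eta> \<sigma>) (\<eta> (\<sigma> @ [j]))))"

section \<open>Cubes and the limit set\<close>

text \<open>The enumeration \<open>e\<close> of the subcubes sends a letter \<open>j\<close> to the position (with entries in
  \<open>{0..<k}\<close>) of the \<open>j\<close>-th subcube within its parent cube; the lower corner of \<open>cube e k (\<sigma> @ [j])\<close>
  is that of \<open>cube e k \<sigma>\<close> plus \<open>k ^ -(length \<sigma> + 1)\<close> times \<open>e j\<close>.\<close>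

definition enumeration :: "(nat \<Rightarrow> nat ^ 'm) \<Rightarrow> nat \<Rightarrow> bool" where
  "enumeration e k \<longleftrightarrow> bij_betw e (alphabet CARD('m) k) {a. \<forall>l. a $ l < k}"

definition corner :: "(nat \<Rightarrow> nat ^ 'm) \<Rightarrow> nat \<Rightarrow> nat list \<Rightarrow> real ^ 'm" where
  "corner e k \<sigma> = (\<chi> l. \<Sum>i<length \<sigma>. real (e (\<sigma> ! i) $ l) / real k ^ Suc i)"

definition cube :: "(nat \<Rightarrow> nat ^ 'm) \<Rightarrow> nat \<Rightarrow> nat list \<Rightarrow> (real ^ 'm) set" where
  "cube e k \<sigma> =
    {x. \<forall>l. corner e k \<sigma> $ l \<le> x $ l \<and> x $ l \<le> corner e k \<sigma> $ l + 1 / real k ^ length \<sigma>}"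

definition limit_set ::
  "(nat \<Rightarrow> nat ^ 'm) \<Rightarrow> nat \<Rightarrow> (nat list \<Rightarrow> status) \<Rightarrow> (real ^ 'm) set" where
  "limit_set e k \<omega> =
    (\<Inter>i. \<Union>\<sigma>\<in>{\<sigma> \<in> words CARD('m) k. length \<sigma> = i \<and> \<omega> \<sigma> = Chosen}. cube e k \<sigma>)"

section \<open>The natural measure\<close>

definition limit_dim :: "nat \<Rightarrow> nat \<Rightarrow> real \<Rightarrow> real" where
  "limit_dim m k p = ln (real k ^ m * p) / ln (real k)"

definition num_chosen ::
  "nat \<Rightarrow> nat \<Rightarrow> (nat list \<Rightarrow> status) \<Rightarrow> nat list \<Rightarrow> nat \<Rightarrow> nat" where
  "num_chosen m k \<omega> \<sigma> j =
    card {\<tau> \<in> words m k. length \<tau> = length \<sigma> + j \<and> prefix \<sigma> \<tau> \<and> \<omega> \<tau> = Chosen}"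

definition mart_limit ::
  "nat \<Rightarrow> nat \<Rightarrow> real \<Rightarrow> (nat list \<Rightarrow> status) \<Rightarrow> nat list \<Rightarrow> real" where
  "mart_limit m k p \<omega> \<sigma> =
    lim (\<lambda>j. real (num_chosen m k \<omega> \<sigma> j) * real k powr (- (real j * limit_dim m k p)))"

abbreviation seq_prefix :: "(nat \<Rightarrow> nat) \<Rightarrow> nat \<Rightarrow> nat list" where
  "seq_prefix \<eta> i \<equiv> map \<eta> [0..<i]"

definition seq_space :: "nat \<Rightarrow> nat \<Rightarrow> (nat \<Rightarrow> nat) measure" where
  "seq_space m k = (\<Pi>\<^sub>M i\<in>UNIV. count_space (alphabet m k))"

definition code_point :: "(nat \<Rightarrow> nat ^ 'm) \<Rightarrow> nat \<Rightarrow> (nat \<Rightarrow> nat) \<Rightarrow> real ^ 'm" where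
  "code_point e k \<eta> = (THE x. \<forall>i. x \<in> cube e k (seq_prefix \<eta> i))"

text \<open>The measure below exists for almost every \<open>\<omega>\<close> only, and is then unique, as cylinders form a
  generating semiring; on the exceptional null set its value is irrelevant.\<close>

definition branching_measure ::
  "(nat \<Rightarrow> nat ^ 'm) \<Rightarrow> nat \<Rightarrow> real \<Rightarrow> (nat list \<Rightarrow> status) \<Rightarrow> (nat \<Rightarrow> nat) measure" where
  "branching_measure e k p \<omega> =
    (THE \<mu>. sets \<mu> = sets (seq_space CARD('m) k) \<and>
       (\<forall>\<sigma>\<in>words CARD('m) k.
          emeasure \<mu> {\<eta> \<in> space (seq_space CARD('m) k). seq_prefix \<eta> (length \<sigma>) = \<sigma>} =
          ennreal (diameter (cube e k []) powr limit_dim CARD('m) k p *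
                   real k powr (- (real (length \<sigma>) * limit_dim CARD('m) k p)) *
                   mart_limit CARD('m) k p \<omega> \<sigma>)))"

definition natural_measure ::
  "(nat \<Rightarrow> nat ^ 'm) \<Rightarrow> nat \<Rightarrow> real \<Rightarrow> (nat list \<Rightarrow> status) \<Rightarrow> (real ^ 'm) measure" where
  "natural_measure e k p \<omega> = distr (branching_measure e k p \<omega>) borel (code_point e k)"

section \<open>Holes and mean porosity of measures\<close>

definition max_ball :: "real ^ 'm \<Rightarrow> real \<Rightarrow> (real ^ 'm) set" where
  "max_ball z r = {y. infnorm (z - y) < r}"

text \<open>The half-open \<open>k\<close>-adic cube of level \<open>j\<close> containing \<open>x\<close> is the one with
  \<open>a l = \<lfloor>k ^ j * x $ l\<rfloor>\<close>.\<close>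

definition kadic_cube :: "nat \<Rightarrow> nat \<Rightarrow> real ^ 'm \<Rightarrow> (real ^ 'm) set" where
  "kadic_cube k j x =
    {y. \<forall>l. of_int \<lfloor>real k ^ j * x $ l\<rfloor> / real k ^ j \<le> y $ l \<and>
            y $ l < (of_int \<lfloor>real k ^ j * x $ l\<rfloor> + 1) / real k ^ j}"

definition has_hole ::
  "nat \<Rightarrow> (real ^ 'm) measure \<Rightarrow> real ^ 'm \<Rightarrow> real \<Rightarrow> real \<Rightarrow> nat \<Rightarrow> bool" where
  "has_hole k \<mu> x \<alpha> \<epsilon> j \<longleftrightarrow>
    (\<exists>z\<in>kadic_cube k j x.
       max_ball z (\<alpha> / 2 / real k ^ j) \<subseteq> kadic_cube k j x \<and>
       emeasure \<mu> (max_ball z (\<alpha> / 2 / real k ^ j)) \<le> ennreal \<epsilon> * emeasure \<mu> (kadic_cube k j x))"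

definition num_holes ::
  "nat \<Rightarrow> (real ^ 'm) measure \<Rightarrow> real ^ 'm \<Rightarrow> real \<Rightarrow> real \<Rightarrow> nat \<Rightarrow> nat" where
  "num_holes k \<mu> x \<alpha> \<epsilon> i = card {j \<in> {1..i}. has_hole k \<mu> x \<alpha> \<epsilon> j}"

text \<open>Both limits exist, since \<open>num_holes\<close> is monotone in \<open>\<epsilon>\<close>.\<close>

definition lower_mean_porosity ::
  "nat \<Rightarrow> (real ^ 'm) measure \<Rightarrow> real ^ 'm \<Rightarrow> real \<Rightarrow> ereal" where
  "lower_mean_porosity k \<mu> x \<alpha> =
    Lim (at_right 0) (\<lambda>\<epsilon>. liminf (\<lambda>i. ereal (real (num_holes k \<mu> x \<alpha> \<epsilon> i) / real i)))"

definition upper_mean_porosity ::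
  "nat \<Rightarrow> (real ^ 'm) measure \<Rightarrow> real ^ 'm \<Rightarrow> real \<Rightarrow> ereal" where
  "upper_mean_porosity k \<mu> x \<alpha> =
    Lim (at_right 0) (\<lambda>\<epsilon>. limsup (\<lambda>i. ereal (real (num_holes k \<mu> x \<alpha> \<epsilon> i) / real i)))"

definition mean_porosity_eq ::
  "nat \<Rightarrow> (real ^ 'm) measure \<Rightarrow> real ^ 'm \<Rightarrow> real \<Rightarrow> ereal \<Rightarrow> bool" where
  "mean_porosity_eq k \<mu> x \<alpha> v \<longleftrightarrow>
    lower_mean_porosity k \<mu> x \<alpha> = v \<and> upper_mean_porosity k \<mu> x \<alpha> = v"

end

theory Submission
  imports Defs
begin

text \<open>The pair of a realisation \<open>\<omega>\<close> and a ray \<open>\<eta>\<close> drawn from its branching measure has a simple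
  structure: the part of the tree that leaves the ray at different heights is independent, and
  apart from the ray being chosen it has the unconditioned law. In particular, if a weight
  \<open>h\<close> of a block of \<open>n\<close> letters looks only at the part of the tree that is not strictly below the
  block, then the mean of the product of the weights of the first \<open>N\<close> blocks is the \<open>N\<close>-th power of the
  mean weight of one block (\<open>nn_integral_spine_functional\<close>). With the Borel-Cantelli lemma this yields an
  exponential bound for such products along almost every ray (\<open>AE_spine_product_bound\<close>), and this
  bound replaces the ergodic theorem throughout. Giving weight \<open>1/2\<close> to the blocks in
  which a local event occurs shows that every local event of positive probability occurs with
  positive lower density along almost every ray (\<open>AE_spine_frequency\<close>). Three events are used.

  First, every letter occurs infinitely often, so almost no ray codes a point on the boundary of
  a k-adic cube. Hence the natural measure of a half-open cube is the mass of its cylinder, open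
  and closed cubes have the same mass, and the only ball of full size in a cube, its interior, is
  not a hole: the mean porosity at \<open>\<alpha> = 1\<close> vanishes.

  Secondly, if \<open>p < 1\<close>, it happens with positive probability that all descendants of a
  word after \<open>n\<close> generations die except the one in a corner, which lies on the ray. For large \<open>n\<close> the
  centred ball of relative size \<open>\<alpha> < 1\<close> is then disjoint from the surviving subcube and is a hole of
  measure 0, whatever \<open>\<epsilon>\<close> is. This bounds the lower mean porosity away from 0.

  Thirdly, all subcubes off the ray may carry a mass of at least \<open>\<delta>\<close>, relative to their size.
  Every ball of relative size \<open>\<alpha>\<close> contains such a subcube if \<open>n\<close> is large. There is no
  hole if, in addition, the relative mass \<open>X\<close> of the cube itself is at most \<open>M\<close>. This last condition
  is not local. However, the masses along the ray satisfy \<open>A * X b = X (Suc b) + S b\<close>, where \<open>A > 1\<close>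
  and \<open>S b\<close> is the mass off the ray: a large mass keeps growing geometrically unless \<open>S b\<close>
  is large as well. The bound for the weights \<open>1 + S b / M0\<close> therefore shows that
  large masses are rare (\<open>AE_spine_mass_mostly_bounded\<close>), and the upper mean porosity is less than 1.

  The masses are limits of martingales. Their means and second moments come from a recursion for
  the correlations of the generation sizes, which contracts in the supercritical range. At \<open>\<alpha> = 0\<close> the
  ball is empty and every scale has a hole.\<close>

section \<open>Independence of disjoint parts of the tree\<close>

text \<open>A pointwise form of measurability with respect to the coordinates in \<open>J\<close>: a measurable function
  with this property factors through the restriction to \<open>J\<close>.\<close>

definition determined_by :: "('i \<Rightarrow> 'a) measure \<Rightarrow> 'i set \<Rightarrow> (('i \<Rightarrow> 'a) \<Rightarrow> 'b) \<Rightarrow> bool" where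
  "determined_by M J f \<longleftrightarrow>
    (\<forall>x\<in>space M. \<forall>y\<in>space M. (\<forall>i\<in>J. x i = y i) \<longrightarrow> f x = f y)"

lemma determined_byD:
  "determined_by M J f \<Longrightarrow> x \<in> space M \<Longrightarrow> y \<in> space M \<Longrightarrow> (\<And>i. i \<in> J \<Longrightarrow> x i = y i) \<Longrightarrow> f x = f y"
  unfolding determined_by_def by blast

lemma determined_byI:
  "(\<And>x y. x \<in> space M \<Longrightarrow> y \<in> space M \<Longrightarrow> (\<And>i. i \<in> J \<Longrightarrow> x i = y i) \<Longrightarrow> f x = f y) \<Longrightarrow> determined_by M J f"
  unfolding determined_by_def by blast

text \<open>The factor evaluates \<open>f\<close> after filling up the missing coordinates from a fixed configuration.\<close>

lemma determined_by_factor: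
  fixes f :: "('i \<Rightarrow> 'a) \<Rightarrow> ennreal"
  assumes [measurable]: "f \<in> borel_measurable (PiM I M)"
    and ne: "space (PiM I M) \<noteq> {}" and J: "J \<subseteq> I"
    and f: "determined_by (PiM I M) J f"
  obtains f' where "f' \<in> borel_measurable (PiM J M)"
    "\<And>x. x \<in> space (PiM I M) \<Longrightarrow> f x = f' (restrict x J)"
proof -
  obtain x0 where x0: "x0 \<in> space (PiM I M)" using ne by (metis ex_in_conv)
  define h where "h = (\<lambda>z. \<lambda>i\<in>I. if i \<in> J then z i else x0 i)"
  have h: "h \<in> PiM J M \<rightarrow>\<^sub>M PiM I M"
    unfolding h_def
  proof (rule measurable_restrict)
    fix i assume "i \<in> I"
    then show "(\<lambda>z. if i \<in> J then z i else x0 i) \<in> PiM J M \<rightarrow>\<^sub>M M i"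
      using x0 by (cases "i \<in> J") (simp_all add: space_PiM PiE_iff)
  qed
  show thesis
  proof (rule that[of "f \<circ> h"])
    show "f \<circ> h \<in> borel_measurable (PiM J M)" using h assms(1) by (rule measurable_comp)
    fix x assume x: "x \<in> space (PiM I M)"
    have "restrict x J \<in> space (PiM J M)" using x J by (auto simp: space_PiM PiE_iff)
    then have "h (restrict x J) \<in> space (PiM I M)" by (rule measurable_space[OF h])
    then show "f x = (f \<circ> h) (restrict x J)"
      unfolding o_def using J by (intro determined_byD[OF f x]) (auto simp: h_def)
  qed
qed

text \<open>The restrictions of a product measure to disjoint sets of coordinates are independent.\<close>

lemma nn_integral_PiM_mult_disjoint:
  fixes f g :: "('i \<Rightarrow> 'a) \<Rightarrow> ennreal"
  assumes prob: "\<And>i. prob_space (M i)"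
    and f[measurable]: "f \<in> borel_measurable (PiM I M)" and g[measurable]: "g \<in> borel_measurable (PiM I M)"
    and J: "J \<subseteq> I" "J' \<subseteq> I" "J \<inter> J' = {}"
    and df: "determined_by (PiM I M) J f" and dg: "determined_by (PiM I M) J' g"
  shows "(\<integral>\<^sup>+x. f x * g x \<partial>PiM I M) = (\<integral>\<^sup>+x. f x \<partial>PiM I M) * (\<integral>\<^sup>+x. g x \<partial>PiM I M)"
proof -
  interpret product_prob_space M I
    using prob by (simp add: product_prob_space_def product_sigma_finite_def product_prob_space_axioms_def prob_space_imp_sigma_finite)
  show ?thesis
  proof (cases "I = {}")
    case True
    then show ?thesis by (simp add: PiM_empty nn_integral_count_space_finite)
  next
    case False
    have ne: "space (PiM I M) \<noteq> {}" by (rule P.not_empty)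
    have iv: "P.indep_vars M (\<lambda>i x. x i) I"
    proof (subst P.indep_vars_iff_distr_eq_PiM'[OF False])
      show "distr (PiM I M) (PiM I M) (\<lambda>x. \<lambda>i\<in>I. x i) = (\<Pi>\<^sub>M i\<in>I. distr (PiM I M) (M i) (\<lambda>x. x i))"
      proof -
        have "distr (PiM I M) (PiM I M) (\<lambda>x. \<lambda>i\<in>I. x i) = distr (PiM I M) (PiM I M) (\<lambda>x. x)"
          by (intro distr_cong) (auto simp: space_PiM PiE_iff extensional_def)
        also have "\<dots> = (\<Pi>\<^sub>M i\<in>I. distr (PiM I M) (M i) (\<lambda>x. x i))"
          by (auto simp: PiM_component intro!: PiM_cong)
        finally show ?thesis .
      qed
    qed simp
    obtain f' where f': "f' \<in> borel_measurable (PiM J M)" "\<And>x. x \<in> space (PiM I M) \<Longrightarrow> f x = f' (restrict x J)"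
      using determined_by_factor[OF f ne J(1) df] by blast
    obtain g' where g': "g' \<in> borel_measurable (PiM J' M)" "\<And>x. x \<in> space (PiM I M) \<Longrightarrow> g x = g' (restrict x J')"
      using determined_by_factor[OF g ne J(2) dg] by blast
    have "P.indep_var borel (f' \<circ> (\<lambda>x. restrict x J)) borel (g' \<circ> (\<lambda>x. restrict x J'))"
      using P.indep_var_restrict[OF iv J(3,1,2)] f'(1) g'(1) by (rule P.indep_var_compose)
    then have "P.indep_vars (\<lambda>_. borel) (case_bool (f' \<circ> (\<lambda>x. restrict x J)) (g' \<circ> (\<lambda>x. restrict x J'))) UNIV"
      unfolding P.indep_var_def by (rule back_subst[of "\<lambda>B. P.indep_vars B _ _"]) (auto split: bool.split)
    from P.indep_vars_nn_integral[OF _ this]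
    have "(\<integral>\<^sup>+x. f' (restrict x J) * g' (restrict x J') \<partial>PiM I M)
       = (\<integral>\<^sup>+x. f' (restrict x J) \<partial>PiM I M) * (\<integral>\<^sup>+x. g' (restrict x J') \<partial>PiM I M)"
      by (simp add: UNIV_bool mult.commute comp_def)
    moreover have "(\<integral>\<^sup>+x. f x * g x \<partial>PiM I M) = (\<integral>\<^sup>+x. f' (restrict x J) * g' (restrict x J') \<partial>PiM I M)"
      by (intro nn_integral_cong) (simp add: f' g')
    moreover have "(\<integral>\<^sup>+x. f x \<partial>PiM I M) = (\<integral>\<^sup>+x. f' (restrict x J) \<partial>PiM I M)"
      by (intro nn_integral_cong) (simp add: f')
    moreover have "(\<integral>\<^sup>+x. g x \<partial>PiM I M) = (\<integral>\<^sup>+x. g' (restrict x J') \<partial>PiM I M)"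
      by (intro nn_integral_cong) (simp add: g')
    ultimately show ?thesis by simp
  qed
qed

definition subtree :: "nat \<Rightarrow> nat \<Rightarrow> nat list \<Rightarrow> (nat list \<Rightarrow> 'b) \<Rightarrow> nat list \<Rightarrow> 'b" where
  "subtree m k \<sigma> \<omega> = (\<lambda>\<tau>\<in>words m k. \<omega> (\<sigma> @ \<tau>))"

definition site_measure :: "nat \<Rightarrow> nat \<Rightarrow> real \<Rightarrow> (nat list \<Rightarrow> bool) measure" where
  "site_measure m k p = (\<Pi>\<^sub>M \<sigma>\<in>words m k. measure_pmf (bernoulli_pmf p))"

definition realise :: "nat \<Rightarrow> nat \<Rightarrow> (nat list \<Rightarrow> bool) \<Rightarrow> nat list \<Rightarrow> status" where
  "realise m k \<xi> = (\<lambda>\<sigma>\<in>words m k. if \<forall>i\<in>{1..length \<sigma>}. \<xi> (take i \<sigma>) then Chosen else Neglected)"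

abbreviation level_words :: "nat \<Rightarrow> nat \<Rightarrow> nat \<Rightarrow> nat list set" where
  "level_words m k n \<equiv> {\<sigma> \<in> words m k. length \<sigma> = n}"

abbreviation alive :: "nat list \<Rightarrow> (nat list \<Rightarrow> status) \<Rightarrow> ennreal" where
  "alive \<sigma> \<omega> \<equiv> (if \<omega> \<sigma> = Chosen then 1 else 0)"

lemma finite_alphabet [simp]: "finite (alphabet m k)"
  by (simp add: alphabet_def)

lemma card_alphabet [simp]: "card (alphabet m k) = k ^ m"
  by (simp add: alphabet_def)

lemma finite_level_words [simp]: "finite (level_words m k n)"
  using finite_lists_length_eq[OF finite_alphabet, of m k n] by (simp add: lists_eq_set Collect_conj_eq)

lemma card_level_words [simp]: "card (level_words m k n) = (k ^ m) ^ n"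
  using card_lists_length_eq[OF finite_alphabet, of m k n] by (simp add: lists_eq_set Collect_conj_eq)

lemma take_in_words: "\<sigma> \<in> words m k \<Longrightarrow> take i \<sigma> \<in> words m k"
  by (auto simp: lists_eq_set dest: in_set_takeD)

lemma UNIV_status: "(UNIV :: status set) = {Chosen, Neglected}"
  by (auto intro: status.exhaust)

lemma finite_status [simp]: "finite (UNIV :: status set)"
  by (simp add: UNIV_status)

lemma space_Omega: "space (Omega m k) = words m k \<rightarrow>\<^sub>E UNIV"
  by (simp add: Omega_def space_PiM)

lemma measurable_status_component [measurable]:
  "\<sigma> \<in> words m k \<Longrightarrow> (\<lambda>\<omega>. \<omega> \<sigma>) \<in> Omega m k \<rightarrow>\<^sub>M count_space UNIV"
  unfolding Omega_def by measurable

lemma measurable_site_component [measurable]: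
  "\<sigma> \<in> words m k \<Longrightarrow> (\<lambda>\<xi>. \<xi> \<sigma>) \<in> site_measure m k p \<rightarrow>\<^sub>M count_space UNIV"
  using measurable_component_singleton[of \<sigma> "words m k" "\<lambda>_. measure_pmf (bernoulli_pmf p)"]
  unfolding site_measure_def by simp

lemma subtree_in_space: "\<sigma> \<in> words m k \<Longrightarrow> subtree m k \<sigma> \<omega> \<in> words m k \<rightarrow>\<^sub>E UNIV"
  by (auto simp: subtree_def)

lemma measurable_subtree [measurable]:
  "\<sigma> \<in> words m k \<Longrightarrow> subtree m k \<sigma> \<in> Omega m k \<rightarrow>\<^sub>M Omega m k"
  unfolding Omega_def subtree_def[abs_def] by (intro measurable_restrict measurable_component_singleton) auto

lemma measurable_subtree_site [measurable]:
  "\<sigma> \<in> words m k \<Longrightarrow> subtree m k \<sigma> \<in> site_measure m k p \<rightarrow>\<^sub>M site_measure m k p"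
  unfolding site_measure_def subtree_def[abs_def] by (intro measurable_restrict measurable_component_singleton) auto

lemma subtree_subtree:
  "\<tau> \<in> words m k \<Longrightarrow> subtree m k \<tau> (subtree m k \<sigma> \<omega>) = subtree m k (\<sigma> @ \<tau>) \<omega>"
  by (auto simp: subtree_def fun_eq_iff restrict_def)

lemma subtree_apply: "\<tau> \<in> words m k \<Longrightarrow> subtree m k \<sigma> \<omega> \<tau> = \<omega> (\<sigma> @ \<tau>)"
  by (simp add: subtree_def)

lemma measurable_realise [measurable]: "realise m k \<in> site_measure m k p \<rightarrow>\<^sub>M Omega m k"
  unfolding Omega_def realise_def[abs_def]
proof (rule measurable_restrict)
  fix \<sigma> assume "\<sigma> \<in> words m k"
  then have [simp]: "take i \<sigma> \<in> words m k" for i by (rule take_in_words)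
  show "(\<lambda>\<xi>. if \<forall>i\<in>{1..length \<sigma>}. \<xi> (take i \<sigma>) then Chosen else Neglected) \<in> site_measure m k p \<rightarrow>\<^sub>M count_space UNIV"
    by measurable
qed

lemma prob_space_site_measure: "prob_space (site_measure m k p)"
  unfolding site_measure_def by (intro prob_space_PiM measure_pmf.prob_space_axioms)

lemma realise_snoc:
  assumes "\<sigma> @ [j] \<in> words m k"
  shows "realise m k \<xi> (\<sigma> @ [j]) = (if realise m k \<xi> \<sigma> = Chosen \<and> \<xi> (\<sigma> @ [j]) then Chosen else Neglected)"
proof -
  have "{1..Suc (length \<sigma>)} = insert (Suc (length \<sigma>)) {1..length \<sigma>}" by auto
  then show ?thesis using assms by (auto simp: realise_def)
qed

lemma realise_subtree:
  assumes s: "\<sigma> \<in> words m k" and c: "realise m k \<xi> \<sigma> = Chosen"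
  shows "subtree m k \<sigma> (realise m k \<xi>) = realise m k (subtree m k \<sigma> \<xi>)"
proof
  fix \<tau>
  show "subtree m k \<sigma> (realise m k \<xi>) \<tau> = realise m k (subtree m k \<sigma> \<xi>) \<tau>"
  proof (cases "\<tau> \<in> words m k")
    case True
    have "(\<forall>i\<in>{1..length (\<sigma> @ \<tau>)}. \<xi> (take i (\<sigma> @ \<tau>))) \<longleftrightarrow> (\<forall>i\<in>{1..length \<tau>}. \<xi> (\<sigma> @ take i \<tau>))"
    proof safe
      fix i assume *: "\<forall>i\<in>{1..length (\<sigma> @ \<tau>)}. \<xi> (take i (\<sigma> @ \<tau>))" "i \<in> {1..length \<tau>}"
      then show "\<xi> (\<sigma> @ take i \<tau>)" by (auto dest!: bspec[of _ _ "length \<sigma> + i"])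
    next
      fix i assume *: "\<forall>i\<in>{1..length \<tau>}. \<xi> (\<sigma> @ take i \<tau>)" and i: "i \<in> {1..length (\<sigma> @ \<tau>)}"
      show "\<xi> (take i (\<sigma> @ \<tau>))"
      proof (cases "i \<le> length \<sigma>")
        case True
        then show ?thesis using c i s by (auto simp: realise_def split: if_splits)
      next
        case False
        then show ?thesis using * i by (auto dest!: bspec[of _ _ "i - length \<sigma>"])
      qed
    qed
    then show ?thesis using True s by (auto simp: subtree_def realise_def take_in_words)
  qed (simp add: subtree_def realise_def)
qed

lemma distr_subtree_site:
  assumes "\<sigma> \<in> words m k"
  shows "distr (site_measure m k p) (site_measure m k p) (subtree m k \<sigma>) = site_measure m k p"
proof -
  have "distr (Pi\<^sub>M (words m k) (\<lambda>_. measure_pmf (bernoulli_pmf p)))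
      (Pi\<^sub>M (words m k) (\<lambda>_. measure_pmf (bernoulli_pmf p))) (\<lambda>\<omega>. \<lambda>n\<in>words m k. \<omega> (\<sigma> @ n))
      = Pi\<^sub>M (words m k) (\<lambda>_. measure_pmf (bernoulli_pmf p))"
    by (rule distr_PiM_reindex) (use assms in \<open>auto simp: measure_pmf.prob_space_axioms inj_on_def\<close>)
  then show ?thesis by (simp add: site_measure_def subtree_def[abs_def])
qed

lemma finite_words_upto [simp]: "finite {\<sigma> \<in> words m k. length \<sigma> \<le> n}"
  using finite_lists_length_le[OF finite_alphabet, of m k n] by (simp add: lists_eq_set Collect_conj_eq)

lemma sets_agree_upto [measurable]: "agree_upto m k \<eta> n \<in> sets (Omega m k)"
proof -
  let ?W = "{\<sigma> \<in> words m k. length \<sigma> \<le> n}"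
  have "{\<omega> \<in> space (Omega m k). \<forall>\<sigma>\<in>?W. \<omega> \<sigma> = \<eta> \<sigma>} \<in> sets (Omega m k)"
  proof (rule sets.sets_Collect_finite_All'[OF _ finite_words_upto])
    fix \<sigma> assume "\<sigma> \<in> ?W"
    then have [measurable]: "(\<lambda>\<omega>. \<omega> \<sigma>) \<in> Omega m k \<rightarrow>\<^sub>M count_space UNIV"
      by (intro measurable_status_component) auto
    show "{\<omega> \<in> space (Omega m k). \<omega> \<sigma> = \<eta> \<sigma>} \<in> sets (Omega m k)" by measurable
  next
    have "[] \<in> ?W" by simp
    then show "?W \<noteq> {}" by blast
  qed
  moreover have "agree_upto m k \<eta> n = {\<omega> \<in> space (Omega m k). \<forall>\<sigma>\<in>?W. \<omega> \<sigma> = \<eta> \<sigma>}"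
    by (auto simp: agree_upto_def)
  ultimately show ?thesis by simp
qed

text \<open>The percolation law is determined by its one-step transition probabilities, because every
  finite-dimensional cylinder is a finite disjoint union of sets \<open>agree_upto\<close>.\<close>

lemma percolation_law_unique:
  assumes P: "prob_space P" "sets P = sets (Omega m k)" and Q: "prob_space Q" "sets Q = sets (Omega m k)"
    and eq: "\<And>\<eta> n. measure P (agree_upto m k \<eta> n) = measure Q (agree_upto m k \<eta> n)"
  shows "P = Q"
proof (rule measure_eqI_PiM_infinite)
  interpret P: prob_space P by fact
  interpret Q: prob_space Q by fact
  let ?M = "\<lambda>_::nat list. count_space (UNIV :: status set)"
  show "sets P = sets (PiM (words m k) ?M)" "sets Q = sets (PiM (words m k) ?M)"
    using P Q by (simp_all add: Omega_def)
  show "finite_measure P" by unfold_locales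
  fix A :: "nat list \<Rightarrow> status set" and J assume J: "finite J" "J \<subseteq> words m k"
  define n where "n = (\<Sum>\<sigma>\<in>J. length \<sigma>)"
  have n: "length \<sigma> \<le> n" if "\<sigma> \<in> J" for \<sigma>
    unfolding n_def using that J by (intro member_le_sum) auto
  define W where "W = {\<sigma> \<in> words m k. length \<sigma> \<le> n}"
  have finW: "finite W" using finite_lists_length_le[OF finite_alphabet, of m k n] by (simp add: W_def lists_eq_set Collect_conj_eq)
  define T where "T = {\<eta> \<in> W \<rightarrow>\<^sub>E UNIV. \<forall>\<sigma>\<in>J. \<eta> \<sigma> \<in> A \<sigma>}"
  have finT: "finite T" unfolding T_def using finite_PiE[OF finW, of "\<lambda>_. UNIV :: status set"] by simp
  have agree: "agree_upto m k \<eta> n \<in> sets (Omega m k)" for \<eta> by (rule sets_agree_upto)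
  have U: "prod_emb (words m k) ?M J (Pi\<^sub>E J A) = (\<Union>\<eta>\<in>T. agree_upto m k \<eta> n)"
  proof safe
    fix \<omega> assume o: "\<omega> \<in> prod_emb (words m k) ?M J (Pi\<^sub>E J A)"
    have "restrict \<omega> W \<in> T" using o n J by (auto simp: prod_emb_def T_def W_def PiE_iff)
    moreover have "\<omega> \<in> agree_upto m k (restrict \<omega> W) n"
      using o by (auto simp: prod_emb_def agree_upto_def W_def Omega_def space_PiM)
    ultimately show "\<omega> \<in> (\<Union>\<eta>\<in>T. agree_upto m k \<eta> n)" by blast
  next
    fix \<omega> \<eta> assume "\<eta> \<in> T" "\<omega> \<in> agree_upto m k \<eta> n"
    then show "\<omega> \<in> prod_emb (words m k) ?M J (Pi\<^sub>E J A)"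
      using J n by (auto simp: prod_emb_def agree_upto_def T_def Omega_def space_PiM PiE_iff subset_eq)
  qed
  have D: "disjoint_family_on (\<lambda>\<eta>. agree_upto m k \<eta> n) T"
  proof (auto simp: disjoint_family_on_def)
    fix \<eta> \<eta>' \<omega> assume *: "\<eta> \<in> T" "\<eta>' \<in> T" "\<eta> \<noteq> \<eta>'" "\<omega> \<in> agree_upto m k \<eta> n" "\<omega> \<in> agree_upto m k \<eta>' n"
    have "\<eta> = \<eta>'"
    proof (rule PiE_ext[of _ W "\<lambda>_. UNIV"])
      show "\<eta> \<in> W \<rightarrow>\<^sub>E UNIV" "\<eta>' \<in> W \<rightarrow>\<^sub>E UNIV" using * by (simp_all add: T_def)
      fix \<sigma> assume "\<sigma> \<in> W"
      then show "\<eta> \<sigma> = \<eta>' \<sigma>" using *(4,5) by (simp add: agree_upto_def W_def)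
    qed
    with *(3) show False by (rule notE)
  qed
  have "measure P (\<Union>\<eta>\<in>T. agree_upto m k \<eta> n) = (\<Sum>\<eta>\<in>T. measure P (agree_upto m k \<eta> n))"
  proof (rule P.finite_measure_finite_Union[OF finT _ D])
    show "(\<lambda>\<eta>. agree_upto m k \<eta> n) ` T \<subseteq> P.events" using agree P(2) by blast
  qed
  also have "\<dots> = (\<Sum>\<eta>\<in>T. measure Q (agree_upto m k \<eta> n))" by (simp add: eq)
  also have "\<dots> = measure Q (\<Union>\<eta>\<in>T. agree_upto m k \<eta> n)"
  proof (rule Q.finite_measure_finite_Union[OF finT _ D, symmetric])
    show "(\<lambda>\<eta>. agree_upto m k \<eta> n) ` T \<subseteq> Q.events" using agree Q(2) by blast
  qed
  finally show "P (prod_emb (words m k) ?M J (Pi\<^sub>E J A)) = Q (prod_emb (words m k) ?M J (Pi\<^sub>E J A))"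
    by (simp add: U P.emeasure_eq_measure Q.emeasure_eq_measure)
qed

lemma agree_upto_Suc_realise:
  assumes "\<xi> \<in> space (site_measure m k p)"
  shows "realise m k \<xi> \<in> agree_upto m k \<eta> (Suc n) \<longleftrightarrow>
    realise m k \<xi> \<in> agree_upto m k \<eta> n \<and>
    (\<forall>\<rho>\<in>level_words m k (Suc n). \<xi> \<rho> \<in>
      (if \<eta> (butlast \<rho>) = Chosen then {\<eta> \<rho> = Chosen} else if \<eta> \<rho> = Neglected then UNIV else {}))"
    (is "?L \<longleftrightarrow> ?R \<and> (\<forall>\<rho>\<in>_. \<xi> \<rho> \<in> ?B \<rho>)")
proof -
  have sp: "realise m k \<xi> \<in> space (Omega m k)" by (rule measurable_space[OF measurable_realise assms])
  have *: "realise m k \<xi> \<rho> = \<eta> \<rho> \<longleftrightarrow> \<xi> \<rho> \<in> ?B \<rho>" if \<rho>: "\<rho> \<in> level_words m k (Suc n)" and R: ?R for \<rho>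
  proof -
    obtain \<sigma> j where sj: "\<rho> = \<sigma> @ [j]" using \<rho> by (cases \<rho> rule: rev_cases) auto
    have "realise m k \<xi> \<sigma> = \<eta> \<sigma>" using R \<rho> by (auto simp: agree_upto_def sj)
    moreover have "realise m k \<xi> \<rho> = (if realise m k \<xi> \<sigma> = Chosen \<and> \<xi> \<rho> then Chosen else Neglected)"
      using \<rho> unfolding sj by (intro realise_snoc) auto
    ultimately show ?thesis by (cases "\<eta> \<rho>") (auto simp: sj)
  qed
  have "?L \<longleftrightarrow> ?R \<and> (\<forall>\<rho>\<in>level_words m k (Suc n). realise m k \<xi> \<rho> = \<eta> \<rho>)"
    using sp by (auto simp: agree_upto_def le_Suc_eq)
  with * show ?thesis by blast
qed

locale percolation =
  fixes m k :: nat and p :: real and P :: "(nat list \<Rightarrow> status) measure"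
  assumes k2: "k \<ge> 2" and supercritical: "1 / real k ^ m < p" and p1: "p \<le> 1"
    and law: "percolation_law m k p P"
begin

lemma p0: "0 < p"
  using supercritical by (rule order.strict_trans1[rotated]) simp

lemma sets_P [measurable_cong, simp]: "sets P = sets (Omega m k)"
  using law by (simp add: percolation_law_def)

lemma space_P: "space P = words m k \<rightarrow>\<^sub>E UNIV"
  using sets_eq_imp_space_eq[OF sets_P] by (simp add: space_Omega)

sublocale prob_space P
  using law by (simp add: percolation_law_def)

lemma root_chosen: "AE \<omega> in P. \<omega> [] = Chosen"
  using law by (simp add: percolation_law_def)

lemma measure_agree_upto_Suc:
  "measure P (agree_upto m k \<eta> (Suc n)) = measure P (agree_upto m k \<eta> n) *
        (\<Prod>\<sigma>\<in>level_words m k n. \<Prod>j\<in>alphabet m k. child_prob p (\<eta> \<sigma>) (\<eta> (\<sigma> @ [j])))"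
  using law by (simp add: percolation_law_def)

lemma agree_upto_0: "agree_upto m k \<eta> 0 = {\<omega> \<in> space (Omega m k). \<omega> [] = \<eta> []}"
  by (auto simp: agree_upto_def)

lemma measure_agree_upto_0: "measure P (agree_upto m k \<eta> 0) = (if \<eta> [] = Chosen then 1 else 0)"
proof -
  have sp: "space (Omega m k) = space P" by (rule sets_eq_imp_space_eq[symmetric, OF sets_P])
  have "measure P (agree_upto m k \<eta> 0) = measure P {\<omega> \<in> space P. Chosen = \<eta> []}"
    unfolding agree_upto_0 sp
    by (intro finite_measure_eq_AE) (use root_chosen in \<open>auto simp: sp[symmetric]\<close>)
  then show ?thesis by (auto simp: prob_space)
qed

text \<open>Declaring every site open independently with probability \<open>p\<close> and calling a word chosen if all
  its non-empty prefixes are open realises the law; hence disjoint parts of the tree are independent.\<close>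

lemma P_eq_distr: "P = distr (site_measure m k p) (Omega m k) (realise m k)"
proof (rule percolation_law_unique[OF prob_space_axioms sets_P])
  let ?X = "site_measure m k p" and ?Q = "distr (site_measure m k p) (Omega m k) (realise m k)"
  interpret X: prob_space ?X by (rule prob_space_site_measure)
  interpret pps: product_prob_space "\<lambda>_. measure_pmf (bernoulli_pmf p)" "words m k"
    by (unfold_locales)
  show "prob_space ?Q" by (intro X.prob_space_distr) simp
  show "sets ?Q = sets (Omega m k)" by simp
  fix \<eta> n
  show "measure P (agree_upto m k \<eta> n) = measure ?Q (agree_upto m k \<eta> n)"
  proof (induction n)
    case 0
    have "realise m k \<xi> [] = Chosen" for \<xi> by (simp add: realise_def)
    then have "realise m k -` agree_upto m k \<eta> 0 \<inter> space ?X = (if \<eta> [] = Chosen then space ?X else {})"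
      using measurable_space[OF measurable_realise] by (auto simp: agree_upto_0 split: if_splits)
    then show ?case by (simp add: measure_agree_upto_0 measure_distr X.prob_space)
  next
    case (Suc n)
    define B where "B \<rho> = (if \<eta> (butlast \<rho>) = Chosen then {\<eta> \<rho> = Chosen} else if \<eta> \<rho> = Neglected then UNIV else {})" for \<rho>
    define f :: "_ \<Rightarrow> ennreal" where "f = indicator {\<xi> \<in> space ?X. realise m k \<xi> \<in> agree_upto m k \<eta> n}"
    define g :: "_ \<Rightarrow> ennreal" where "g = indicator {\<xi> \<in> space ?X. \<forall>\<rho>\<in>level_words m k (Suc n). \<xi> \<rho> \<in> B \<rho>}"
    have gset: "{\<xi> \<in> space ?X. \<forall>\<rho>\<in>level_words m k (Suc n). \<xi> \<rho> \<in> B \<rho>} \<in> sets ?X"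
    proof (cases "level_words m k (Suc n) = {}")
      case False
      show ?thesis
      proof (rule sets.sets_Collect_finite_All'[OF _ finite_level_words False])
        fix \<rho> assume "\<rho> \<in> level_words m k (Suc n)"
        then have [measurable]: "(\<lambda>\<omega>. \<omega> \<rho>) \<in> ?X \<rightarrow>\<^sub>M count_space UNIV"
          by (intro measurable_site_component) auto
        have "(\<lambda>\<omega>. \<omega> \<rho>) -` B \<rho> \<inter> space ?X \<in> sets ?X" by measurable
        then show "{\<omega> \<in> space ?X. \<omega> \<rho> \<in> B \<rho>} \<in> sets ?X" by (simp add: vimage_def Int_def conj_commute)
      qed
    next
      case True
      show ?thesis unfolding True by simp
    qed
    have [measurable]: "f \<in> borel_measurable ?X" unfolding f_def by measurable
    have [measurable]: "g \<in> borel_measurable ?X" unfolding g_def using gset by measurable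
    have ind: "(\<integral>\<^sup>+\<xi>. f \<xi> * g \<xi> \<partial>?X) = (\<integral>\<^sup>+\<xi>. f \<xi> \<partial>?X) * (\<integral>\<^sup>+\<xi>. g \<xi> \<partial>?X)"
      unfolding site_measure_def
    proof (rule nn_integral_PiM_mult_disjoint)
      show "{\<sigma> \<in> words m k. length \<sigma> \<le> n} \<inter> level_words m k (Suc n) = {}" by auto
      show "determined_by (Pi\<^sub>M (words m k) (\<lambda>_. measure_pmf (bernoulli_pmf p))) {\<sigma> \<in> words m k. length \<sigma> \<le> n} f"
      proof (rule determined_byI, fold site_measure_def)
        fix x y assume xy: "x \<in> space ?X" "y \<in> space ?X" and e: "\<And>\<sigma>. \<sigma> \<in> {\<sigma> \<in> words m k. length \<sigma> \<le> n} \<Longrightarrow> x \<sigma> = y \<sigma>"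
        have "realise m k x \<sigma> = realise m k y \<sigma>" if "\<sigma> \<in> words m k" "length \<sigma> \<le> n" for \<sigma>
        proof -
          have "x (take i \<sigma>) = y (take i \<sigma>)" for i using that by (intro e) (auto simp: take_in_words)
          then show ?thesis by (simp add: realise_def)
        qed
        then show "f x = f y" using xy measurable_space[OF measurable_realise]
          by (auto simp: f_def agree_upto_def indicator_def)
      qed
      show "determined_by (Pi\<^sub>M (words m k) (\<lambda>_. measure_pmf (bernoulli_pmf p))) (level_words m k (Suc n)) g"
        by (rule determined_byI, fold site_measure_def) (auto simp: g_def indicator_def)
    qed (auto simp: site_measure_def[symmetric] measure_pmf.prob_space_axioms)
    have "realise m k -` agree_upto m k \<eta> (Suc n) \<inter> space ?X =
       {\<xi> \<in> space ?X. realise m k \<xi> \<in> agree_upto m k \<eta> n} \<inter> {\<xi> \<in> space ?X. \<forall>\<rho>\<in>level_words m k (Suc n). \<xi> \<rho> \<in> B \<rho>}"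
      (is "?L = ?R")
    proof (rule set_eqI)
      fix \<xi>
      show "\<xi> \<in> ?L \<longleftrightarrow> \<xi> \<in> ?R"
        using agree_upto_Suc_realise[of \<xi> m k p \<eta> n, folded B_def]
        unfolding Int_iff vimage_eq mem_Collect_eq by argo
    qed
    then have "emeasure ?Q (agree_upto m k \<eta> (Suc n)) = emeasure ?X
        ({\<xi> \<in> space ?X. realise m k \<xi> \<in> agree_upto m k \<eta> n} \<inter> {\<xi> \<in> space ?X. \<forall>\<rho>\<in>level_words m k (Suc n). \<xi> \<rho> \<in> B \<rho>})"
      by (subst emeasure_distr) auto
    also have "\<dots> = (\<integral>\<^sup>+\<xi>. f \<xi> * g \<xi> \<partial>?X)"
      unfolding f_def g_def indicator_inter_arith[symmetric]
    proof (rule nn_integral_indicator[symmetric])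
      have "{\<xi> \<in> space ?X. realise m k \<xi> \<in> agree_upto m k \<eta> n} \<in> sets ?X" by measurable
      then show "{\<xi> \<in> space ?X. realise m k \<xi> \<in> agree_upto m k \<eta> n} \<inter>
          {\<xi> \<in> space ?X. \<forall>\<rho>\<in>level_words m k (Suc n). \<xi> \<rho> \<in> B \<rho>} \<in> sets ?X"
        using gset by (rule sets.Int)
    qed
    also have "\<dots> = emeasure ?Q (agree_upto m k \<eta> n) * emeasure ?X {\<xi> \<in> space ?X. \<forall>\<rho>\<in>level_words m k (Suc n). \<xi> \<rho> \<in> B \<rho>}"
    proof -
      have "emeasure ?Q (agree_upto m k \<eta> n) = emeasure ?X (realise m k -` agree_upto m k \<eta> n \<inter> space ?X)"
        by (rule emeasure_distr) auto
      also have "realise m k -` agree_upto m k \<eta> n \<inter> space ?X = {\<xi> \<in> space ?X. realise m k \<xi> \<in> agree_upto m k \<eta> n}"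
        by blast
      also have "emeasure ?X \<dots> = (\<integral>\<^sup>+\<xi>. f \<xi> \<partial>?X)"
        unfolding f_def by (rule nn_integral_indicator[symmetric]) measurable
      finally have "emeasure ?Q (agree_upto m k \<eta> n) = (\<integral>\<^sup>+\<xi>. f \<xi> \<partial>?X)" .
      moreover have "(\<integral>\<^sup>+\<xi>. g \<xi> \<partial>?X) = emeasure ?X {\<xi> \<in> space ?X. \<forall>\<rho>\<in>level_words m k (Suc n). \<xi> \<rho> \<in> B \<rho>}"
        unfolding g_def using gset by (rule nn_integral_indicator)
      ultimately show ?thesis unfolding ind by simp
    qed
    also have "emeasure ?X {\<xi> \<in> space ?X. \<forall>\<rho>\<in>level_words m k (Suc n). \<xi> \<rho> \<in> B \<rho>}
        = (\<Prod>\<rho>\<in>level_words m k (Suc n). emeasure (measure_pmf (bernoulli_pmf p)) (B \<rho>))"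
      unfolding site_measure_def by (intro pps.emeasure_PiM_Collect) auto
    also have "\<dots> = (\<Prod>\<rho>\<in>level_words m k (Suc n). ennreal (child_prob p (\<eta> (butlast \<rho>)) (\<eta> \<rho>)))"
    proof (intro prod.cong refl)
      fix \<rho>
      show "emeasure (measure_pmf (bernoulli_pmf p)) (B \<rho>) = ennreal (child_prob p (\<eta> (butlast \<rho>)) (\<eta> \<rho>))"
        using p0 p1 by (cases "\<eta> (butlast \<rho>)"; cases "\<eta> \<rho>") (auto simp: B_def emeasure_pmf_single)
    qed
    also have "\<dots> = ennreal (\<Prod>\<rho>\<in>level_words m k (Suc n). child_prob p (\<eta> (butlast \<rho>)) (\<eta> \<rho>))"
    proof (rule prod_ennreal)
      show "0 \<le> child_prob p a b" for a b using p0 p1 by (cases a; cases b) auto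
    qed
    also have "(\<Prod>\<rho>\<in>level_words m k (Suc n). child_prob p (\<eta> (butlast \<rho>)) (\<eta> \<rho>))
       = (\<Prod>\<sigma>\<in>level_words m k n. \<Prod>j\<in>alphabet m k. child_prob p (\<eta> \<sigma>) (\<eta> (\<sigma> @ [j])))"
      unfolding prod.cartesian_product
      by (rule prod.reindex_bij_witness[of _ "\<lambda>(\<sigma>, j). \<sigma> @ [j]" "\<lambda>\<rho>. (butlast \<rho>, last \<rho>)"])
         (auto simp: lists_eq_set dest: in_set_butlastD simp flip: append_butlast_last_id, metis append_butlast_last_id length_0_conv nat.distinct(1), metis last_in_set length_0_conv nat.distinct(1) subsetD,
           metis append_butlast_last_id length_0_conv nat.distinct(1))
    finally have "emeasure ?Q (agree_upto m k \<eta> (Suc n)) = emeasure ?Q (agree_upto m k \<eta> n) *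
        ennreal (\<Prod>\<sigma>\<in>level_words m k n. \<Prod>j\<in>alphabet m k. child_prob p (\<eta> \<sigma>) (\<eta> (\<sigma> @ [j])))" .
    moreover have "0 \<le> (\<Prod>\<sigma>\<in>level_words m k n. \<Prod>j\<in>alphabet m k. child_prob p (\<eta> \<sigma>) (\<eta> (\<sigma> @ [j])))"
    proof (intro prod_nonneg ballI)
      show "0 \<le> child_prob p a b" for a b using p0 p1 by (cases a; cases b) auto
    qed
    ultimately show ?case
      unfolding measure_agree_upto_Suc Suc.IH by (simp add: measure_def enn2real_mult)
  qed
qed

abbreviation outside :: "nat list \<Rightarrow> nat list set" where
  "outside \<sigma> \<equiv> {\<tau> \<in> words m k. \<not> strict_prefix \<sigma> \<tau>}"

text \<open>Below a chosen word grows a fresh copy of the tree, independent of all that is not strictly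
  below the word: in terms of the open sites, the two factors depend on disjoint sets of sites.\<close>

theorem branching:
  fixes g F :: "(nat list \<Rightarrow> status) \<Rightarrow> ennreal"
  assumes s: "\<sigma> \<in> words m k"
    and g[measurable]: "g \<in> borel_measurable (Omega m k)" and F[measurable]: "F \<in> borel_measurable (Omega m k)"
    and dg: "determined_by (Omega m k) (outside \<sigma>) g"
  shows "(\<integral>\<^sup>+\<omega>. alive \<sigma> \<omega> * g \<omega> * F (subtree m k \<sigma> \<omega>) \<partial>P) = (\<integral>\<^sup>+\<omega>. alive \<sigma> \<omega> * g \<omega> \<partial>P) * (\<integral>\<^sup>+\<omega>. F \<omega> \<partial>P)"
proof -
  let ?X = "site_measure m k p" and ?r = "realise m k" and ?T = "subtree m k \<sigma>"
  define G where "G = (\<lambda>\<xi>. alive \<sigma> (?r \<xi>) * g (?r \<xi>))"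
  define H where "H = (\<lambda>\<xi>. F (?r (?T \<xi>)))"
  note [measurable] = s
  have [measurable]: "G \<in> borel_measurable ?X" unfolding G_def by measurable
  have [measurable]: "H \<in> borel_measurable ?X" unfolding H_def by measurable
  have rs: "?r \<xi> \<in> space (Omega m k)" for \<xi> by (auto simp: space_Omega realise_def)
  have "(\<integral>\<^sup>+\<omega>. alive \<sigma> \<omega> * g \<omega> * F (?T \<omega>) \<partial>P) = (\<integral>\<^sup>+\<xi>. alive \<sigma> (?r \<xi>) * g (?r \<xi>) * F (?T (?r \<xi>)) \<partial>?X)"
    by (subst P_eq_distr, subst nn_integral_distr) auto
  also have "\<dots> = (\<integral>\<^sup>+\<xi>. G \<xi> * H \<xi> \<partial>?X)"
    using s by (intro nn_integral_cong) (simp add: G_def H_def realise_subtree)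
  also have "\<dots> = (\<integral>\<^sup>+\<xi>. G \<xi> \<partial>?X) * (\<integral>\<^sup>+\<xi>. H \<xi> \<partial>?X)"
    unfolding site_measure_def
  proof (rule nn_integral_PiM_mult_disjoint)
    let ?M = "Pi\<^sub>M (words m k) (\<lambda>_. measure_pmf (bernoulli_pmf p))"
    show "determined_by ?M (outside \<sigma>) G"
    proof (rule determined_byI)
      fix x y :: "nat list \<Rightarrow> bool" assume e: "\<And>\<tau>. \<tau> \<in> outside \<sigma> \<Longrightarrow> x \<tau> = y \<tau>"
      have r: "?r x \<tau> = ?r y \<tau>" if "\<tau> \<in> words m k" "\<not> strict_prefix \<sigma> \<tau>" for \<tau>
      proof -
        have "\<not> strict_prefix \<sigma> (take i \<tau>)" for i
          using that(2) take_is_prefix[of i \<tau>] by (meson prefix_order.less_le_trans)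
        then have "x (take i \<tau>) = y (take i \<tau>)" for i
          using that by (intro e) (auto simp: take_in_words)
        then show ?thesis by (simp add: realise_def)
      qed
      have "g (?r x) = g (?r y)"
        by (rule determined_byD[OF dg]) (auto simp: rs r)
      then show "G x = G y" using r[OF s] by (simp add: G_def)
    qed
    show "determined_by ?M {\<tau> \<in> words m k. strict_prefix \<sigma> \<tau>} H"
    proof (rule determined_byI)
      fix x y :: "nat list \<Rightarrow> bool" assume e: "\<And>\<tau>. \<tau> \<in> {\<tau> \<in> words m k. strict_prefix \<sigma> \<tau>} \<Longrightarrow> x \<tau> = y \<tau>"
      have "?r (?T x) = ?r (?T y)"
      proof
        fix \<tau>
        have "?T x (take i \<tau>) = ?T y (take i \<tau>)" if "\<tau> \<in> words m k" "i \<in> {1..length \<tau>}" for i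
        proof -
          have "take i \<tau> \<in> words m k" using that(1) by (rule take_in_words)
          moreover have "take i \<tau> \<noteq> []" using that(2) by auto
          ultimately show ?thesis using s
            by (simp only: subtree_apply) (intro e, auto simp: strict_prefix_def simp del: in_lists_conv_set)
        qed
        then show "?r (?T x) \<tau> = ?r (?T y) \<tau>" by (simp add: realise_def)
      qed
      then show "H x = H y" by (simp add: H_def)
    qed
  qed (auto simp: site_measure_def[symmetric] measure_pmf.prob_space_axioms)
  also have "(\<integral>\<^sup>+\<xi>. G \<xi> \<partial>?X) = (\<integral>\<^sup>+\<omega>. alive \<sigma> \<omega> * g \<omega> \<partial>P)"
    unfolding G_def by (subst P_eq_distr, subst nn_integral_distr) auto
  also have "(\<integral>\<^sup>+\<xi>. H \<xi> \<partial>?X) = (\<integral>\<^sup>+\<xi>. F (?r \<xi>) \<partial>distr ?X ?X ?T)"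
    unfolding H_def by (subst nn_integral_distr) auto
  also have "\<dots> = (\<integral>\<^sup>+\<xi>. F (?r \<xi>) \<partial>?X)" by (simp only: distr_subtree_site[OF s])
  also have "\<dots> = (\<integral>\<^sup>+\<omega>. F \<omega> \<partial>P)"
    by (subst P_eq_distr, subst nn_integral_distr) auto
  finally show ?thesis .
qed

lemma emeasure_all_open:
  assumes "finite J" "J \<subseteq> words m k"
  shows "emeasure (site_measure m k p) {\<xi> \<in> space (site_measure m k p). \<forall>\<tau>\<in>J. \<xi> \<tau>} = ennreal (p ^ card J)"
proof -
  interpret pps: product_prob_space "\<lambda>_. measure_pmf (bernoulli_pmf p)" "words m k"
    by (unfold_locales)
  have "emeasure (site_measure m k p) {\<xi> \<in> space (site_measure m k p). \<forall>\<tau>\<in>J. \<xi> \<tau> \<in> {True}} =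
      (\<Prod>\<tau>\<in>J. emeasure (measure_pmf (bernoulli_pmf p)) {True})"
    unfolding site_measure_def using assms by (intro pps.emeasure_PiM_Collect) auto
  also have "\<dots> = ennreal (p ^ card J)"
    using p0 p1 by (simp add: emeasure_pmf_single ennreal_power)
  finally show ?thesis by simp
qed

lemma nn_integral_alive:
  assumes s: "\<sigma> \<in> words m k"
  shows "(\<integral>\<^sup>+\<omega>. alive \<sigma> \<omega> \<partial>P) = ennreal (p ^ length \<sigma>)"
proof -
  let ?X = "site_measure m k p" and ?J = "(\<lambda>i. take i \<sigma>) ` {1..length \<sigma>}"
  note [measurable] = s
  have inj: "inj_on (\<lambda>i. take i \<sigma>) {1..length \<sigma>}"
    by (auto simp: inj_on_def dest: arg_cong[of _ _ length])
  have "(\<integral>\<^sup>+\<omega>. alive \<sigma> \<omega> \<partial>P) = (\<integral>\<^sup>+\<xi>. alive \<sigma> (realise m k \<xi>) \<partial>?X)"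
    by (subst P_eq_distr, subst nn_integral_distr) auto
  also have "\<dots> = (\<integral>\<^sup>+\<xi>. indicator {\<xi> \<in> space ?X. \<forall>\<tau>\<in>?J. \<xi> \<tau>} \<xi> \<partial>?X)"
    using s by (intro nn_integral_cong) (auto simp: realise_def indicator_def)
  also have "\<dots> = emeasure ?X {\<xi> \<in> space ?X. \<forall>\<tau>\<in>?J. \<xi> \<tau>}"
  proof (rule nn_integral_indicator)
    have [measurable]: "take i \<sigma> \<in> words m k" for i using s by (rule take_in_words)
    have "{\<xi> \<in> space ?X. \<forall>i\<in>{1..length \<sigma>}. \<xi> (take i \<sigma>)} \<in> sets ?X" by measurable
    then show "{\<xi> \<in> space ?X. \<forall>\<tau>\<in>?J. \<xi> \<tau>} \<in> sets ?X" by simp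
  qed
  also have "\<dots> = ennreal (p ^ length \<sigma>)"
    using s card_image[OF inj] by (subst emeasure_all_open) (auto dest: in_set_takeD)
  finally show ?thesis .
qed

lemma nn_integral_alive_siblings:
  assumes "i \<in> alphabet m k" "j \<in> alphabet m k" "i \<noteq> j"
  shows "(\<integral>\<^sup>+\<omega>. alive [i] \<omega> * alive [j] \<omega> \<partial>P) = ennreal (p\<^sup>2)"
proof -
  let ?X = "site_measure m k p"
  have [measurable]: "[i] \<in> words m k" "[j] \<in> words m k" using assms by auto
  have "(\<integral>\<^sup>+\<omega>. alive [i] \<omega> * alive [j] \<omega> \<partial>P) = (\<integral>\<^sup>+\<xi>. alive [i] (realise m k \<xi>) * alive [j] (realise m k \<xi>) \<partial>?X)"
    by (subst P_eq_distr, subst nn_integral_distr) auto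
  also have "\<dots> = (\<integral>\<^sup>+\<xi>. indicator {\<xi> \<in> space ?X. \<forall>\<tau>\<in>{[i],[j]}. \<xi> \<tau>} \<xi> \<partial>?X)"
    using assms by (intro nn_integral_cong) (auto simp: realise_def indicator_def)
  also have "\<dots> = emeasure ?X {\<xi> \<in> space ?X. \<forall>\<tau>\<in>{[i],[j]}. \<xi> \<tau>}"
  proof (rule nn_integral_indicator)
    have "{\<xi> \<in> space ?X. \<xi> [i] \<and> \<xi> [j]} \<in> sets ?X" by measurable
    then show "{\<xi> \<in> space ?X. \<forall>\<tau>\<in>{[i],[j]}. \<xi> \<tau>} \<in> sets ?X" by simp
  qed
  also have "\<dots> = ennreal (p\<^sup>2)"
    using assms by (subst emeasure_all_open) (auto simp: power2_eq_square)
  finally show ?thesis .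
qed

text \<open>The law excludes a chosen word below a neglected one only up to a null set, so pointwise
  statements carry this as a hypothesis.\<close>

definition hereditary :: "(nat list \<Rightarrow> status) \<Rightarrow> bool" where
  "hereditary \<omega> \<longleftrightarrow> (\<forall>\<sigma>\<in>words m k. \<forall>\<tau>\<in>words m k. \<omega> (\<sigma> @ \<tau>) = Chosen \<longrightarrow> \<omega> \<sigma> = Chosen)"

lemma AE_hereditary: "AE \<omega> in P. hereditary \<omega>"
  unfolding hereditary_def
proof (subst P_eq_distr, subst AE_distr_iff)
  have [measurable]: "\<sigma> @ \<tau> \<in> words m k \<longleftrightarrow> \<sigma> \<in> words m k \<and> \<tau> \<in> words m k" for \<sigma> \<tau> by auto
  have "Measurable.pred (Omega m k) (\<lambda>\<omega>. \<forall>\<sigma>\<in>words m k. \<forall>\<tau>\<in>words m k. \<omega> (\<sigma> @ \<tau>) = Chosen \<longrightarrow> \<omega> \<sigma> = Chosen)"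
    by measurable
  then show "{\<omega> \<in> space (Omega m k). \<forall>\<sigma>\<in>words m k. \<forall>\<tau>\<in>words m k. \<omega> (\<sigma> @ \<tau>) = Chosen \<longrightarrow> \<omega> \<sigma> = Chosen} \<in> sets (Omega m k)"
    by (simp add: pred_def)
  have "realise m k \<xi> \<sigma> = Chosen" if "\<sigma> \<in> words m k" "\<tau> \<in> words m k" "realise m k \<xi> (\<sigma> @ \<tau>) = Chosen" for \<xi> \<sigma> \<tau>
  proof -
    have "\<xi> (take i \<sigma>)" if "i \<in> {1..length \<sigma>}" for i
    proof -
      have "\<forall>i\<in>{1..length (\<sigma> @ \<tau>)}. \<xi> (take i (\<sigma> @ \<tau>))"
        using \<open>realise m k \<xi> (\<sigma> @ \<tau>) = Chosen\<close> \<open>\<sigma> \<in> words m k\<close> \<open>\<tau> \<in> words m k\<close>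
        by (simp add: realise_def split: if_splits)
      from bspec[OF this, of i] that show ?thesis by simp
    qed
    then show ?thesis using \<open>\<sigma> \<in> words m k\<close> by (simp add: realise_def)
  qed
  then show "AE \<xi> in site_measure m k p. \<forall>\<sigma>\<in>words m k. \<forall>\<tau>\<in>words m k. realise m k \<xi> (\<sigma> @ \<tau>) = Chosen \<longrightarrow> realise m k \<xi> \<sigma> = Chosen"
    by (intro AE_I2) blast
qed simp


section \<open>Second moments and the martingale limit\<close>

text \<open>The mean number of chosen children of a chosen word. It is the power \<open>k powr d\<close> for the dimension
  \<open>d\<close> of the limit set, by \<open>powr_limit_dim\<close>.\<close>

definition growth :: real where "growth = real k ^ m * p"

definition normalised_size :: "nat \<Rightarrow> (nat list \<Rightarrow> status) \<Rightarrow> real" where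
  "normalised_size j \<omega> = real (num_chosen m k \<omega> [] j) / growth ^ j"

definition limit_size :: "(nat list \<Rightarrow> status) \<Rightarrow> real" where
  "limit_size \<omega> = lim (\<lambda>j. normalised_size j \<omega>)"

abbreviation sub :: "nat list \<Rightarrow> (nat list \<Rightarrow> status) \<Rightarrow> nat list \<Rightarrow> status" where
  "sub \<equiv> subtree m k"

lemma growth_gt_1: "1 < growth"
proof -
  have "0 < real k ^ m" using k2 by simp
  then show ?thesis using supercritical by (simp add: growth_def divide_less_eq mult.commute)
qed

lemma growth_pos [simp]: "0 < growth" using growth_gt_1 by simp

lemma growth_nonneg [simp]: "0 \<le> growth" using growth_pos by (rule less_imp_le)

lemma growth_nonzero [simp]: "growth \<noteq> 0" using growth_gt_1 by simp

lemma powr_limit_dim: "real k powr (- (real j * limit_dim m k p)) = 1 / growth ^ j"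
proof -
  have "ln (real k) \<noteq> 0" "real k > 0" using k2 by auto
  then have "real k powr (- (real j * limit_dim m k p)) = exp (- (real j * ln growth))"
    by (simp add: powr_def limit_dim_def growth_def)
  also have "\<dots> = 1 / growth ^ j"
    using growth_pos by (simp add: exp_minus exp_of_nat_mult divide_inverse)
  finally show ?thesis .
qed

lemma inj_on_append_left: "inj_on ((@) \<sigma>) A"
  by (simp add: inj_on_def)

lemma determined_by_comp: "determined_by M J f \<Longrightarrow> determined_by M J (\<lambda>x. h (f x))"
  unfolding determined_by_def by metis

lemma num_chosen_subtree:
  assumes "\<sigma> \<in> words m k"
  shows "num_chosen m k \<omega> \<sigma> j = num_chosen m k (sub \<sigma> \<omega>) [] j"
proof -
  have "{\<tau> \<in> words m k. length \<tau> = length \<sigma> + j \<and> prefix \<sigma> \<tau> \<and> \<omega> \<tau> = Chosen}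
      = (@) \<sigma> ` {\<tau> \<in> words m k. length \<tau> = j \<and> sub \<sigma> \<omega> \<tau> = Chosen}"
    (is "?L = (@) \<sigma> ` ?R")
  proof (rule set_eqI)
    fix \<tau>
    show "\<tau> \<in> ?L \<longleftrightarrow> \<tau> \<in> (@) \<sigma> ` ?R"
    proof
      assume t: "\<tau> \<in> ?L"
      then obtain \<rho> where r: "\<tau> = \<sigma> @ \<rho>" by (auto simp: prefix_def)
      with t have "\<rho> \<in> ?R" by (simp add: subtree_def)
      with r show "\<tau> \<in> (@) \<sigma> ` ?R" by (rule image_eqI)
    next
      assume "\<tau> \<in> (@) \<sigma> ` ?R"
      then obtain \<rho> where r: "\<tau> = \<sigma> @ \<rho>" "\<rho> \<in> ?R" by (rule imageE)
      then show "\<tau> \<in> ?L" using assms subtree_apply[of \<rho> m k \<sigma> \<omega>] by auto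
    qed
  qed
  then have "card ?L = card ?R" by (metis (lifting) card_image inj_on_append_left)
  then show ?thesis by (simp only: num_chosen_def list.size(3) add_0 Nil_prefix simp_thms)
qed

lemma mart_limit_eq: "\<sigma> \<in> words m k \<Longrightarrow> mart_limit m k p \<omega> \<sigma> = limit_size (sub \<sigma> \<omega>)"
  unfolding mart_limit_def limit_size_def normalised_size_def powr_limit_dim by (subst num_chosen_subtree) auto

lemma num_chosen_root: "num_chosen m k \<omega> [] j = (\<Sum>\<tau>\<in>level_words m k j. if \<omega> \<tau> = Chosen then 1 else 0)"
proof -
  have "{\<tau> \<in> words m k. length \<tau> = j \<and> \<omega> \<tau> = Chosen} = {\<tau> \<in> level_words m k j. \<omega> \<tau> = Chosen}" by auto
  then show ?thesis by (simp add: num_chosen_def sum.If_cases Int_def)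
qed

lemma normalised_size_eq_sum:
  "normalised_size j \<omega> = (\<Sum>\<tau>\<in>level_words m k j. (if \<omega> \<tau> = Chosen then 1 else 0)) / growth ^ j"
  by (simp add: normalised_size_def num_chosen_root of_nat_sum if_distrib cong: if_cong)

lemma sum_level_words_Suc:
  "(\<Sum>\<tau>\<in>level_words m k (Suc n). f \<tau>) = (\<Sum>i\<in>alphabet m k. \<Sum>\<tau>\<in>level_words m k n. f (i # \<tau>))"
  unfolding sum.cartesian_product
  by (rule sum.reindex_bij_witness[of _ "\<lambda>(i, \<tau>). i # \<tau>" "\<lambda>\<tau>. (hd \<tau>, tl \<tau>)"])
     (auto simp: length_Suc_conv)

lemma sum_level_words_add:
  "(\<Sum>\<tau>\<in>level_words m k (n + n'). f \<tau>) = (\<Sum>\<sigma>\<in>level_words m k n. \<Sum>\<tau>\<in>level_words m k n'. f (\<sigma> @ \<tau>))"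
  unfolding sum.cartesian_product
  by (rule sum.reindex_bij_witness[of _ "\<lambda>(\<sigma>, \<tau>). \<sigma> @ \<tau>" "\<lambda>\<tau>. (take n \<tau>, drop n \<tau>)"])
     (auto simp: lists_eq_set dest: in_set_takeD in_set_dropD)

lemma normalised_size_Suc:
  "normalised_size (Suc j) \<omega> = (\<Sum>i\<in>alphabet m k. normalised_size j (sub [i] \<omega>)) / growth"
proof -
  have "(\<Sum>\<tau>\<in>level_words m k (Suc j). (if \<omega> \<tau> = Chosen then 1 else 0 :: real))
    = (\<Sum>i\<in>alphabet m k. \<Sum>\<tau>\<in>level_words m k j. if sub [i] \<omega> \<tau> = Chosen then 1 else 0)"
    unfolding sum_level_words_Suc by (intro sum.cong refl) (simp add: subtree_def)
  then show ?thesis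
    by (simp add: normalised_size_eq_sum sum_divide_distrib mult.commute)
qed

lemma measurable_normalised_size [measurable]: "normalised_size j \<in> borel_measurable (Omega m k)"
proof -
  have "(\<lambda>\<omega>. (\<Sum>\<tau>\<in>level_words m k j. (if \<omega> \<tau> = Chosen then 1 else 0 :: real)) / growth ^ j) \<in> borel_measurable (Omega m k)"
  proof (intro borel_measurable_divide borel_measurable_sum borel_measurable_const)
    fix \<tau> assume "\<tau> \<in> level_words m k j"
    then have [measurable]: "\<tau> \<in> words m k" by simp
    show "(\<lambda>\<omega>. if \<omega> \<tau> = Chosen then 1 else 0 :: real) \<in> borel_measurable (Omega m k)" by measurable
  qed
  then show ?thesis by (simp add: normalised_size_eq_sum[abs_def])
qed

lemma measurable_limit_size [measurable]: "limit_size \<in> borel_measurable (Omega m k)"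
  unfolding limit_size_def[abs_def] by measurable

lemma normalised_size_nonneg [simp]: "0 \<le> normalised_size j \<omega>"
  by (simp add: normalised_size_def)

lemma normalised_size_bound: "normalised_size j \<omega> \<le> (real k ^ m) ^ j"
proof -
  have "num_chosen m k \<omega> [] j \<le> card (level_words m k j)"
    unfolding num_chosen_def by (intro card_mono) auto
  then have "num_chosen m k \<omega> [] j \<le> (k ^ m) ^ j" by simp
  then have "real (num_chosen m k \<omega> [] j) \<le> (real k ^ m) ^ j"
    unfolding of_nat_power[symmetric] by (rule of_nat_mono)
  moreover have "1 \<le> growth ^ j" using growth_gt_1 by simp
  then have "real (num_chosen m k \<omega> [] j) / growth ^ j \<le> real (num_chosen m k \<omega> [] j)"
    by (simp add: divide_le_eq mult_le_cancel_left1)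
  ultimately show ?thesis unfolding normalised_size_def by linarith
qed

abbreviation alive_real :: "nat list \<Rightarrow> (nat list \<Rightarrow> status) \<Rightarrow> real" where
  "alive_real \<sigma> \<omega> \<equiv> (if \<omega> \<sigma> = Chosen then 1 else 0)"

lemma integrable_bounded:
  fixes f :: "(nat list \<Rightarrow> status) \<Rightarrow> real"
  assumes "f \<in> borel_measurable (Omega m k)" "\<And>\<omega>. 0 \<le> f \<omega>" "\<And>\<omega>. f \<omega> \<le> B"
  shows "integrable P f"
  using assms by (intro integrable_const_bound[where B=B]) (auto simp: measurable_cong_sets[OF sets_P refl])

lemma branching_real:
  fixes g F :: "(nat list \<Rightarrow> status) \<Rightarrow> real"
  assumes s: "\<sigma> \<in> words m k"
    and g[measurable]: "g \<in> borel_measurable (Omega m k)" and F[measurable]: "F \<in> borel_measurable (Omega m k)"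
    and gb: "\<And>\<omega>. 0 \<le> g \<omega>" "\<And>\<omega>. g \<omega> \<le> B" and Fb: "\<And>\<omega>. 0 \<le> F \<omega>" "\<And>\<omega>. F \<omega> \<le> C"
    and dg: "determined_by (Omega m k) (outside \<sigma>) g"
  shows "(\<integral>\<omega>. alive_real \<sigma> \<omega> * g \<omega> * F (sub \<sigma> \<omega>) \<partial>P) = (\<integral>\<omega>. alive_real \<sigma> \<omega> * g \<omega> \<partial>P) * (\<integral>\<omega>. F \<omega> \<partial>P)"
proof -
  note [measurable] = s
  have BC: "0 \<le> B" "0 \<le> C" using gb[of undefined] Fb[of undefined] by linarith+
  have i1: "integrable P (\<lambda>\<omega>. alive_real \<sigma> \<omega> * g \<omega> * F (sub \<sigma> \<omega>))"
    using gb Fb BC by (intro integrable_bounded[of _ "B * C"]) (auto intro!: mult_mono)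
  have i2: "integrable P (\<lambda>\<omega>. alive_real \<sigma> \<omega> * g \<omega>)"
    using gb BC by (intro integrable_bounded[of _ B]) auto
  have i3: "integrable P F"
    using Fb by (intro integrable_bounded[of _ C]) auto
  have "ennreal (\<integral>\<omega>. alive_real \<sigma> \<omega> * g \<omega> * F (sub \<sigma> \<omega>) \<partial>P)
      = (\<integral>\<^sup>+\<omega>. ennreal (alive_real \<sigma> \<omega> * g \<omega> * F (sub \<sigma> \<omega>)) \<partial>P)"
    using gb Fb by (intro nn_integral_eq_integral[symmetric] i1) auto
  also have "\<dots> = (\<integral>\<^sup>+\<omega>. alive \<sigma> \<omega> * ennreal (g \<omega>) * ennreal (F (sub \<sigma> \<omega>)) \<partial>P)"
    using gb Fb by (intro nn_integral_cong) (auto simp: ennreal_mult)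
  also have "\<dots> = (\<integral>\<^sup>+\<omega>. alive \<sigma> \<omega> * ennreal (g \<omega>) \<partial>P) * (\<integral>\<^sup>+\<omega>. ennreal (F \<omega>) \<partial>P)"
    by (intro branching[OF s] determined_by_comp[OF dg]) measurable
  also have "(\<integral>\<^sup>+\<omega>. alive \<sigma> \<omega> * ennreal (g \<omega>) \<partial>P) = (\<integral>\<^sup>+\<omega>. ennreal (alive_real \<sigma> \<omega> * g \<omega>) \<partial>P)"
    by (intro nn_integral_cong) auto
  also have "\<dots> = ennreal (\<integral>\<omega>. alive_real \<sigma> \<omega> * g \<omega> \<partial>P)"
    using gb by (intro nn_integral_eq_integral i2) auto
  also have "(\<integral>\<^sup>+\<omega>. ennreal (F \<omega>) \<partial>P) = ennreal (\<integral>\<omega>. F \<omega> \<partial>P)"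
    using Fb by (intro nn_integral_eq_integral i3) auto
  also have "ennreal (\<integral>\<omega>. alive_real \<sigma> \<omega> * g \<omega> \<partial>P) * ennreal (\<integral>\<omega>. F \<omega> \<partial>P)
     = ennreal ((\<integral>\<omega>. alive_real \<sigma> \<omega> * g \<omega> \<partial>P) * (\<integral>\<omega>. F \<omega> \<partial>P))"
    using gb Fb by (intro ennreal_mult[symmetric] integral_nonneg_AE) auto
  finally show ?thesis
    using gb Fb by (subst (asm) ennreal_inj) (auto intro!: mult_nonneg_nonneg integral_nonneg_AE)
qed

lemma integral_alive: 
  assumes s: "\<sigma> \<in> words m k" shows "(\<integral>\<omega>. alive_real \<sigma> \<omega> \<partial>P) = p ^ length \<sigma>"
proof -
  note [measurable] = s
  have "ennreal (\<integral>\<omega>. alive_real \<sigma> \<omega> \<partial>P) = (\<integral>\<^sup>+\<omega>. ennreal (alive_real \<sigma> \<omega>) \<partial>P)"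
    by (intro nn_integral_eq_integral[symmetric] integrable_bounded[of _ 1]) auto
  also have "\<dots> = (\<integral>\<^sup>+\<omega>. alive \<sigma> \<omega> \<partial>P)" by (intro nn_integral_cong) auto
  finally show ?thesis using p0 by (simp add: nn_integral_alive[OF s] ennreal_inj integral_nonneg_AE)
qed

lemma integral_alive_siblings:
  assumes "i \<in> alphabet m k" "j \<in> alphabet m k" "i \<noteq> j"
  shows "(\<integral>\<omega>. alive_real [i] \<omega> * alive_real [j] \<omega> \<partial>P) = p\<^sup>2"
proof -
  have [measurable]: "[i] \<in> words m k" "[j] \<in> words m k" using assms by auto
  have "ennreal (\<integral>\<omega>. alive_real [i] \<omega> * alive_real [j] \<omega> \<partial>P) = (\<integral>\<^sup>+\<omega>. ennreal (alive_real [i] \<omega> * alive_real [j] \<omega>) \<partial>P)"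
    by (intro nn_integral_eq_integral[symmetric] integrable_bounded[of _ 1]) auto
  also have "\<dots> = (\<integral>\<^sup>+\<omega>. alive [i] \<omega> * alive [j] \<omega> \<partial>P)" by (intro nn_integral_cong) auto
  finally show ?thesis using p0 by (simp add: nn_integral_alive_siblings[OF assms] ennreal_inj integral_nonneg_AE)
qed

lemma integrable_normalised_size: "integrable P (normalised_size j)"
  by (intro integrable_bounded[of _ "(real k ^ m) ^ j"]) (auto simp: normalised_size_bound)

lemma integrable_normalised_size_mult: "integrable P (\<lambda>\<omega>. normalised_size j \<omega> * normalised_size l \<omega>)"
  by (intro integrable_bounded[of _ "(real k ^ m) ^ j * (real k ^ m) ^ l"])
     (auto intro!: mult_mono normalised_size_bound)

lemma expectation_normalised_size: "(\<integral>\<omega>. normalised_size j \<omega> \<partial>P) = 1"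
proof -
  have "(\<integral>\<omega>. normalised_size j \<omega> \<partial>P) = (\<Sum>\<tau>\<in>level_words m k j. \<integral>\<omega>. alive_real \<tau> \<omega> \<partial>P) / growth ^ j"
    unfolding normalised_size_eq_sum
  proof (subst integral_divide_zero, subst Bochner_Integration.integral_sum)
    fix \<tau> assume "\<tau> \<in> level_words m k j"
    then have [measurable]: "\<tau> \<in> words m k" by simp
    show "integrable P (alive_real \<tau>)" by (intro integrable_bounded[of _ 1]) auto
  qed simp
  also have "(\<Sum>\<tau>\<in>level_words m k j. \<integral>\<omega>. alive_real \<tau> \<omega> \<partial>P) = (\<Sum>\<tau>\<in>level_words m k j. p ^ j)"
    by (intro sum.cong refl) (auto simp: integral_alive)
  finally show ?thesis using growth_pos p0 k2 by (simp add: growth_def power_mult_distrib)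
qed

lemma normalised_size_neglected:
  assumes "hereditary \<omega>" "\<sigma> \<in> words m k" "\<omega> \<sigma> \<noteq> Chosen"
  shows "normalised_size j (sub \<sigma> \<omega>) = 0"
proof -
  have "\<omega> (\<sigma> @ \<tau>) \<noteq> Chosen" if "\<tau> \<in> words m k" for \<tau>
    using assms that by (auto simp: hereditary_def)
  then have "(\<Sum>\<tau>\<in>level_words m k j. alive_real \<tau> (sub \<sigma> \<omega>)) = 0"
    by (intro sum.neutral) (auto simp: subtree_def)
  then show ?thesis by (simp only: normalised_size_eq_sum div_0)
qed

text \<open>Both sizes split according to the first letter. Equal first letters reproduce the correlation
  one generation lower, different ones contribute independent factors of mean 1. The contraction
  factor \<open>1 / growth\<close> is less than 1 since the percolation is supercritical.\<close>

lemma second_moment_Suc: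
  "(\<integral>\<omega>. normalised_size (Suc u) \<omega> * normalised_size (Suc v) \<omega> \<partial>P) =
    (\<integral>\<omega>. normalised_size u \<omega> * normalised_size v \<omega> \<partial>P) / growth + (1 - 1 / real k ^ m)"
proof -
  let ?A = "alphabet m k" and ?Z = normalised_size
  let ?f = "\<lambda>i j \<omega>. alive_real [i] \<omega> * (alive_real [j] \<omega> * ?Z v (sub [j] \<omega>)) * ?Z u (sub [i] \<omega>)"
  have wA: "[i] \<in> words m k" if "i \<in> ?A" for i using that by simp
  have f_int: "integrable P (?f i j)" if "i \<in> ?A" "j \<in> ?A" for i j
  proof (rule integrable_bounded[of _ "(real k ^ m) ^ v * (real k ^ m) ^ u"])
    note [measurable] = wA[OF that(1)] wA[OF that(2)]
    show "?f i j \<in> borel_measurable (Omega m k)" by measurable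
  qed (auto intro!: mult_mono normalised_size_bound)
  have "(\<integral>\<omega>. ?Z (Suc u) \<omega> * ?Z (Suc v) \<omega> \<partial>P) = (\<integral>\<omega>. (\<Sum>i\<in>?A. \<Sum>j\<in>?A. ?f i j \<omega>) / growth\<^sup>2 \<partial>P)"
  proof (intro integral_cong_AE)
    show "(\<lambda>\<omega>. (\<Sum>i\<in>?A. \<Sum>j\<in>?A. ?f i j \<omega>) / growth\<^sup>2) \<in> borel_measurable P"
      using f_int by (intro borel_measurable_divide borel_measurable_sum) (auto simp: integrable_iff_bounded)
    show "AE \<omega> in P. ?Z (Suc u) \<omega> * ?Z (Suc v) \<omega> = (\<Sum>i\<in>?A. \<Sum>j\<in>?A. ?f i j \<omega>) / growth\<^sup>2"
      using AE_hereditary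
    proof eventually_elim
      fix \<omega> assume h: "hereditary \<omega>"
      have *: "?Z u (sub [i] \<omega>) = alive_real [i] \<omega> * ?Z u (sub [i] \<omega>)" if "i \<in> ?A" for i u
        using normalised_size_neglected[OF h wA[OF that]] by auto
      have "?Z (Suc u) \<omega> = (\<Sum>i\<in>?A. alive_real [i] \<omega> * ?Z u (sub [i] \<omega>)) / growth" for u
        unfolding normalised_size_Suc by (intro arg_cong2[where f="(/)"] sum.cong refl *)
      then show "?Z (Suc u) \<omega> * ?Z (Suc v) \<omega> = (\<Sum>i\<in>?A. \<Sum>j\<in>?A. ?f i j \<omega>) / growth\<^sup>2"
        by (simp only: times_divide_times_eq sum_product power2_eq_square) (simp only: mult_ac)
    qed
  qed simp
  also have "\<dots> = (\<Sum>i\<in>?A. \<Sum>j\<in>?A. \<integral>\<omega>. ?f i j \<omega> \<partial>P) / growth\<^sup>2"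
    by (subst integral_divide_zero, subst Bochner_Integration.integral_sum, (intro Bochner_Integration.integrable_sum f_int; assumption),
        intro arg_cong2[where f="(/)"] sum.cong refl Bochner_Integration.integral_sum f_int)
  also have "(\<Sum>i\<in>?A. \<Sum>j\<in>?A. \<integral>\<omega>. ?f i j \<omega> \<partial>P)
      = (\<Sum>i\<in>?A. \<Sum>j\<in>?A. if j = i then p * (\<integral>\<omega>. ?Z u \<omega> * ?Z v \<omega> \<partial>P) else p\<^sup>2)"
  proof (intro sum.cong refl)
    fix i j assume ij: "i \<in> ?A" "j \<in> ?A"
    note [measurable] = wA[OF ij(1)] wA[OF ij(2)]
    show "(\<integral>\<omega>. ?f i j \<omega> \<partial>P) = (if j = i then p * (\<integral>\<omega>. ?Z u \<omega> * ?Z v \<omega> \<partial>P) else p\<^sup>2)"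
    proof (cases "j = i")
      case True
      have "(\<integral>\<omega>. ?f i i \<omega> \<partial>P) = (\<integral>\<omega>. alive_real [i] \<omega> * 1 * (?Z u (sub [i] \<omega>) * ?Z v (sub [i] \<omega>)) \<partial>P)"
        by (intro Bochner_Integration.integral_cong) auto
      also have "\<dots> = (\<integral>\<omega>. alive_real [i] \<omega> * 1 \<partial>P) * (\<integral>\<omega>. ?Z u \<omega> * ?Z v \<omega> \<partial>P)"
        by (rule branching_real[where B=1 and C="(real k ^ m) ^ u * (real k ^ m) ^ v"])
           (use ij in \<open>auto intro!: mult_mono normalised_size_bound determined_byI\<close>)
      also have "(\<integral>\<omega>. alive_real [i] \<omega> * 1 \<partial>P) = p" using integral_alive[OF wA[OF ij(1)]] by simp
      finally show ?thesis using True by simp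
    next
      case False
      have "(\<integral>\<omega>. ?f i j \<omega> \<partial>P) = (\<integral>\<omega>. alive_real [i] \<omega> * (alive_real [j] \<omega> * ?Z v (sub [j] \<omega>)) \<partial>P) * (\<integral>\<omega>. ?Z u \<omega> \<partial>P)"
      proof (rule branching_real[OF wA[OF ij(1)], where B="(real k ^ m) ^ v" and C="(real k ^ m) ^ u"])
        show "determined_by (Omega m k) (outside [i]) (\<lambda>\<omega>. alive_real [j] \<omega> * ?Z v (sub [j] \<omega>))"
        proof (rule determined_byI)
          fix x y :: "nat list \<Rightarrow> status"
          assume e: "\<And>\<tau>. \<tau> \<in> outside [i] \<Longrightarrow> x \<tau> = y \<tau>"
          have e': "x (j # \<tau>) = y (j # \<tau>)" if "\<tau> \<in> words m k" for \<tau>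
            using False that ij by (intro e) (auto simp: strict_prefix_def prefix_Cons)
          then have "sub [j] x = sub [j] y" by (auto simp: subtree_def)
          then show "alive_real [j] x * ?Z v (sub [j] x) = alive_real [j] y * ?Z v (sub [j] y)"
            using e'[of "[]"] by simp
        qed
      qed (auto simp: normalised_size_bound)
      also have "(\<integral>\<omega>. alive_real [i] \<omega> * (alive_real [j] \<omega> * ?Z v (sub [j] \<omega>)) \<partial>P)
          = (\<integral>\<omega>. alive_real [j] \<omega> * alive_real [i] \<omega> * ?Z v (sub [j] \<omega>) \<partial>P)"
        by (intro Bochner_Integration.integral_cong) auto
      also have "\<dots> = (\<integral>\<omega>. alive_real [j] \<omega> * alive_real [i] \<omega> \<partial>P) * (\<integral>\<omega>. ?Z v \<omega> \<partial>P)"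
      proof (rule branching_real[OF wA[OF ij(2)], where B="1" and C="(real k ^ m) ^ v"])
        show "determined_by (Omega m k) (outside [j]) (alive_real [i])"
          by (rule determined_byI) (use ij False in auto)
      qed (auto simp: normalised_size_bound)
      also have "(\<integral>\<omega>. alive_real [j] \<omega> * alive_real [i] \<omega> \<partial>P) = p\<^sup>2"
        using ij False by (intro integral_alive_siblings) auto
      finally show ?thesis using False by (simp add: expectation_normalised_size)
    qed
  qed
  also have "\<dots> = real k ^ m * (p * (\<integral>\<omega>. ?Z u \<omega> * ?Z v \<omega> \<partial>P) + (real k ^ m - 1) * p\<^sup>2)"
  proof -
    have "(\<Sum>j\<in>?A. if j = i then c else p\<^sup>2) = c + (real k ^ m - 1) * p\<^sup>2" if "i \<in> ?A" for i and c :: real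
    proof -
      have "(\<Sum>j\<in>?A. if j = i then c else p\<^sup>2) = c + (\<Sum>j\<in>?A - {i}. p\<^sup>2)"
        using that by (simp add: sum.remove[of ?A i] cong: if_cong)
      then show ?thesis using that k2 by (simp add: card_Diff_singleton of_nat_diff)
    qed
    then show ?thesis by simp
  qed
  also have "\<dots> / growth\<^sup>2 = (\<integral>\<omega>. ?Z u \<omega> * ?Z v \<omega> \<partial>P) / growth + (1 - 1 / real k ^ m)"
    using k2 p0 by (simp add: growth_def power2_eq_square divide_simps) (simp add: algebra_simps)
  finally show ?thesis .
qed

text \<open>The bound is the fixed point of the recursion \<open>c \<mapsto> c / growth + 1\<close>.\<close>

lemma second_moment_bounded: "(\<integral>\<omega>. normalised_size j \<omega> * normalised_size j \<omega> \<partial>P) \<le> growth / (growth - 1)"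
proof (induction j)
  case 0
  have "AE \<omega> in P. normalised_size 0 \<omega> * normalised_size 0 \<omega> = 1"
    using root_chosen
  proof eventually_elim
    fix \<omega> :: "nat list \<Rightarrow> status" assume "\<omega> [] = Chosen"
    moreover have "level_words m k 0 = {[]}" by auto
    ultimately show "normalised_size 0 \<omega> * normalised_size 0 \<omega> = 1" by (simp add: normalised_size_eq_sum)
  qed
  then have "(\<integral>\<omega>. normalised_size 0 \<omega> * normalised_size 0 \<omega> \<partial>P) = (\<integral>\<omega>. 1 \<partial>P)"
    by (intro integral_cong_AE) auto
  then show ?case using growth_gt_1 by (simp add: prob_space)
next
  case (Suc j)
  have "(\<integral>\<omega>. normalised_size (Suc j) \<omega> * normalised_size (Suc j) \<omega> \<partial>P) \<le> growth / (growth - 1) / growth + 1"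
    unfolding second_moment_Suc using Suc growth_gt_1 by (intro add_mono divide_right_mono) auto
  also have "\<dots> = growth / (growth - 1)" using growth_gt_1 by (simp add: divide_simps) 
  finally show ?case .
qed

definition increment :: "nat \<Rightarrow> (nat list \<Rightarrow> status) \<Rightarrow> real" where
  "increment j \<omega> = normalised_size (Suc j) \<omega> - normalised_size j \<omega>"

lemma measurable_increment [measurable]: "increment j \<in> borel_measurable (Omega m k)"
  unfolding increment_def[abs_def] by measurable

lemma increment_square: "(increment j \<omega>)\<^sup>2 = normalised_size (Suc j) \<omega> * normalised_size (Suc j) \<omega>
   - 2 * (normalised_size j \<omega> * normalised_size (Suc j) \<omega>) + normalised_size j \<omega> * normalised_size j \<omega>"
  by (simp add: increment_def power2_eq_square algebra_simps)

lemma integrable_increment_square: "integrable P (\<lambda>\<omega>. (increment j \<omega>)\<^sup>2)"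
  unfolding increment_square
  by (intro Bochner_Integration.integrable_add Bochner_Integration.integrable_diff integrable_mult_right integrable_normalised_size_mult)

text \<open>The constant term of the recursion cancels in the mean square of an increment, which is a
  combination of three correlations with coefficients of sum 0.\<close>

lemma expectation_increment_square:
  "(\<integral>\<omega>. (increment j \<omega>)\<^sup>2 \<partial>P) = (\<integral>\<omega>. (increment 0 \<omega>)\<^sup>2 \<partial>P) / growth ^ j"
proof (induction j)
  case (Suc j)
  let ?c = "\<lambda>u v. \<integral>\<omega>. normalised_size u \<omega> * normalised_size v \<omega> \<partial>P"
  have *: "(\<integral>\<omega>. (increment j \<omega>)\<^sup>2 \<partial>P) = ?c (Suc j) (Suc j) - 2 * ?c j (Suc j) + ?c j j" for j
    unfolding increment_square by (simp add: integrable_normalised_size_mult)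
  have "(\<integral>\<omega>. (increment (Suc j) \<omega>)\<^sup>2 \<partial>P) = (\<integral>\<omega>. (increment j \<omega>)\<^sup>2 \<partial>P) / growth"
    unfolding * by (simp only: second_moment_Suc) (simp add: diff_divide_distrib add_divide_distrib)
  then show ?case by (simp add: Suc)
qed simp

lemma integrable_increment: "integrable P (increment j)"
  unfolding increment_def[abs_def] by (intro Bochner_Integration.integrable_diff integrable_normalised_size)

lemma expectation_abs_increment:
  "(\<integral>\<omega>. \<bar>increment j \<omega>\<bar> \<partial>P) \<le> (1 + (\<integral>\<omega>. (increment 0 \<omega>)\<^sup>2 \<partial>P)) * (1 / sqrt growth) ^ j"
proof -
  \<comment> \<open>The choice of \<open>r\<close> balances the two terms of \<open>r * x\<^sup>2 + 1 / r\<close>, as the mean square decays like \<open>1 / r\<^sup>2\<close>.\<close>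
  define r where "r = sqrt growth ^ j"
  have r: "r > 0" "r * r = growth ^ j" unfolding r_def by (simp_all flip: power_mult_distrib)
  have ab: "\<bar>x\<bar> \<le> (r * x\<^sup>2 + 1 / r)" for x :: real
  proof -
    have "0 \<le> (r * \<bar>x\<bar> - 1)\<^sup>2" by simp
    then have "r * (2 * \<bar>x\<bar>) \<le> r * (r * x\<^sup>2 + 1 / r)"
      using r by (simp add: power2_eq_square algebra_simps)
    then have "2 * \<bar>x\<bar> \<le> r * x\<^sup>2 + 1 / r" using r by (simp only: mult_le_cancel_left_pos)
    then show ?thesis by simp
  qed
  have "(\<integral>\<omega>. \<bar>increment j \<omega>\<bar> \<partial>P) \<le> (\<integral>\<omega>. r * (increment j \<omega>)\<^sup>2 + 1 / r \<partial>P)"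
    by (intro integral_mono integrable_abs integrable_increment Bochner_Integration.integrable_add integrable_mult_right integrable_increment_square ab) simp
  also have "\<dots> = r * (\<integral>\<omega>. (increment j \<omega>)\<^sup>2 \<partial>P) + 1 / r"
    by (simp add: integrable_increment_square prob_space)
  also have "\<dots> = (1 + (\<integral>\<omega>. (increment 0 \<omega>)\<^sup>2 \<partial>P)) * (1 / r)"
    unfolding expectation_increment_square[of j] r(2)[symmetric] using r(1) by (simp add: field_simps)
  finally show ?thesis by (simp add: r_def power_one_over)
qed

lemma summable_expectation_increment: "summable (\<lambda>j. \<integral>\<omega>. \<bar>increment j \<omega>\<bar> \<partial>P)"
proof (rule summable_comparison_test'[where N=0])
  show "summable (\<lambda>j. (1 + (\<integral>\<omega>. (increment 0 \<omega>)\<^sup>2 \<partial>P)) * (1 / sqrt growth) ^ j)"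
    using growth_gt_1 by (intro summable_mult summable_geometric) simp
  show "norm (\<integral>\<omega>. \<bar>increment j \<omega>\<bar> \<partial>P) \<le> (1 + (\<integral>\<omega>. (increment 0 \<omega>)\<^sup>2 \<partial>P)) * (1 / sqrt growth) ^ j" for j
    using expectation_abs_increment[of j] by (simp add: integral_nonneg_AE)
qed

lemma AE_summable_increment: "AE \<omega> in P. summable (\<lambda>j. \<bar>increment j \<omega>\<bar>)"
proof -
  have nn: "(\<integral>\<^sup>+\<omega>. ennreal \<bar>increment j \<omega>\<bar> \<partial>P) = ennreal (\<integral>\<omega>. \<bar>increment j \<omega>\<bar> \<partial>P)" for j
    by (intro nn_integral_eq_integral integrable_abs integrable_increment) simp
  have "(\<integral>\<^sup>+\<omega>. (\<Sum>j. ennreal \<bar>increment j \<omega>\<bar>) \<partial>P) = (\<Sum>j. \<integral>\<^sup>+\<omega>. ennreal \<bar>increment j \<omega>\<bar> \<partial>P)"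
    by (rule nn_integral_suminf) measurable
  also have "\<dots> < \<infinity>"
    unfolding nn using summable_expectation_increment by (simp add: suminf_ennreal2 integral_nonneg_AE)
  finally have "AE \<omega> in P. (\<Sum>j. ennreal \<bar>increment j \<omega>\<bar>) \<noteq> \<infinity>"
    by (intro nn_integral_PInf_AE) auto
  then show ?thesis
    by eventually_elim (rule summable_suminf_not_top, auto)
qed

lemma normalised_size_telescope: "normalised_size n \<omega> = normalised_size 0 \<omega> + (\<Sum>j<n. increment j \<omega>)"
  by (induction n) (auto simp: increment_def)

lemma normalised_size_convergent:
  assumes "summable (\<lambda>j. \<bar>increment j \<omega>\<bar>)"
  shows "(\<lambda>n. normalised_size n \<omega>) \<longlonglongrightarrow> normalised_size 0 \<omega> + (\<Sum>j. increment j \<omega>)"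
proof -
  have "summable (\<lambda>j. increment j \<omega>)" using assms by (rule summable_rabs_cancel)
  then have "(\<lambda>n. normalised_size 0 \<omega> + (\<Sum>j<n. increment j \<omega>)) \<longlonglongrightarrow> normalised_size 0 \<omega> + (\<Sum>j. increment j \<omega>)"
    by (intro tendsto_intros summable_LIMSEQ)
  then show ?thesis by (subst normalised_size_telescope)
qed

lemma AE_limit_size: "AE \<omega> in P. (\<lambda>n. normalised_size n \<omega>) \<longlonglongrightarrow> limit_size \<omega>"
  using AE_summable_increment
  by eventually_elim (auto simp: limit_size_def convergent_LIMSEQ_iff[symmetric] convergent_def intro: normalised_size_convergent)

text \<open>The increments have mean 0 and are absolutely summable in mean, so no mass is lost in the limit.\<close>

lemma expectation_limit_size: "integrable P limit_size" "(\<integral>\<omega>. limit_size \<omega> \<partial>P) = 1"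
proof -
  have AEeq: "AE \<omega> in P. limit_size \<omega> = normalised_size 0 \<omega> + (\<Sum>j. increment j \<omega>)"
    using AE_summable_increment
    by eventually_elim (auto simp: limit_size_def intro!: limI normalised_size_convergent)
  have i: "integrable P (\<lambda>\<omega>. \<Sum>j. increment j \<omega>)"
    by (rule integrable_suminf) (use AE_summable_increment summable_expectation_increment in \<open>auto intro: integrable_increment\<close>)
  have "(\<integral>\<omega>. (\<Sum>j. increment j \<omega>) \<partial>P) = (\<Sum>j. \<integral>\<omega>. increment j \<omega> \<partial>P)"
    by (rule integral_suminf) (use AE_summable_increment summable_expectation_increment in \<open>auto intro: integrable_increment\<close>)
  also have "\<dots> = 0"
    by (simp add: increment_def integrable_normalised_size expectation_normalised_size)
  finally have 0: "(\<integral>\<omega>. (\<Sum>j. increment j \<omega>) \<partial>P) = 0" .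
  have "integrable P limit_size \<longleftrightarrow> integrable P (\<lambda>\<omega>. normalised_size 0 \<omega> + (\<Sum>j. increment j \<omega>))"
    using AEeq by (intro integrable_cong_AE) auto
  then show "integrable P limit_size" using i integrable_normalised_size by simp
  have "(\<integral>\<omega>. limit_size \<omega> \<partial>P) = (\<integral>\<omega>. normalised_size 0 \<omega> + (\<Sum>j. increment j \<omega>) \<partial>P)"
    using AEeq by (intro integral_cong_AE) auto
  also have "\<dots> = 1" using i integrable_normalised_size 0 by (simp add: expectation_normalised_size)
  finally show "(\<integral>\<omega>. limit_size \<omega> \<partial>P) = 1" .
qed

lemma AE_limit_size_nonneg: "AE \<omega> in P. 0 \<le> limit_size \<omega>"
  using AE_limit_size by eventually_elim (rule LIMSEQ_le_const, auto)

lemma nn_integral_limit_size: "(\<integral>\<^sup>+\<omega>. ennreal (limit_size \<omega>) \<partial>P) = 1"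
  using nn_integral_eq_integral[OF expectation_limit_size(1) AE_limit_size_nonneg] expectation_limit_size(2) by simp

lemma nn_integral_limit_size_square: "(\<integral>\<^sup>+\<omega>. ennreal ((limit_size \<omega>)\<^sup>2) \<partial>P) < \<infinity>"
proof -
  have "(\<integral>\<^sup>+\<omega>. ennreal ((limit_size \<omega>)\<^sup>2) \<partial>P) = (\<integral>\<^sup>+\<omega>. liminf (\<lambda>n. ennreal ((normalised_size n \<omega>)\<^sup>2)) \<partial>P)"
  proof (rule nn_integral_cong_AE)
    show "AE \<omega> in P. ennreal ((limit_size \<omega>)\<^sup>2) = liminf (\<lambda>n. ennreal ((normalised_size n \<omega>)\<^sup>2))"
      using AE_limit_size
    proof eventually_elim
      fix \<omega> assume "(\<lambda>n. normalised_size n \<omega>) \<longlonglongrightarrow> limit_size \<omega>"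
      then have "(\<lambda>n. ennreal ((normalised_size n \<omega>)\<^sup>2)) \<longlonglongrightarrow> ennreal ((limit_size \<omega>)\<^sup>2)"
        by (intro tendsto_ennrealI tendsto_power)
      then show "ennreal ((limit_size \<omega>)\<^sup>2) = liminf (\<lambda>n. ennreal ((normalised_size n \<omega>)\<^sup>2))"
        by (intro lim_imp_Liminf[symmetric]) auto
    qed
  qed
  also have "\<dots> \<le> liminf (\<lambda>n. \<integral>\<^sup>+\<omega>. ennreal ((normalised_size n \<omega>)\<^sup>2) \<partial>P)"
    by (rule nn_integral_liminf) measurable
  also have "\<dots> \<le> liminf (\<lambda>n. ennreal (growth / (growth - 1)))"
  proof (intro Liminf_mono always_eventually allI)
    fix n
    have "(\<integral>\<^sup>+\<omega>. ennreal ((normalised_size n \<omega>)\<^sup>2) \<partial>P) = ennreal (\<integral>\<omega>. (normalised_size n \<omega>)\<^sup>2 \<partial>P)"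
      by (intro nn_integral_eq_integral) (auto simp: power2_eq_square intro: integrable_normalised_size_mult)
    also have "\<dots> \<le> ennreal (growth / (growth - 1))"
      using second_moment_bounded[of n] by (intro ennreal_leI) (simp add: power2_eq_square)
    finally show "(\<integral>\<^sup>+\<omega>. ennreal ((normalised_size n \<omega>)\<^sup>2) \<partial>P) \<le> ennreal (growth / (growth - 1))" .
  qed
  also have "\<dots> < \<infinity>" by (simp add: Liminf_const)
  finally show ?thesis .
qed

text \<open>The branching property for the indicator function of an exceptional null set.\<close>

lemma AE_subtree:
  assumes R: "AE \<omega> in P. R \<omega>" and s: "\<sigma> \<in> words m k"
  shows "AE \<omega> in P. \<omega> \<sigma> = Chosen \<longrightarrow> R (sub \<sigma> \<omega>)"
proof -
  obtain N where N: "{\<omega> \<in> space P. \<not> R \<omega>} \<subseteq> N" "emeasure P N = 0" "N \<in> sets P"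
    using R by (rule AE_E)
  note [measurable] = s N(3)[simplified]
  have "(\<integral>\<^sup>+\<omega>. alive \<sigma> \<omega> * 1 * indicator N (sub \<sigma> \<omega>) \<partial>P) = (\<integral>\<^sup>+\<omega>. alive \<sigma> \<omega> * 1 \<partial>P) * (\<integral>\<^sup>+\<omega>. indicator N \<omega> \<partial>P)"
    by (rule branching[OF s]) (auto intro!: determined_byI)
  also have "(\<integral>\<^sup>+\<omega>. indicator N \<omega> \<partial>P) = 0" using N by simp
  finally have "(\<integral>\<^sup>+\<omega>. alive \<sigma> \<omega> * 1 * indicator N (sub \<sigma> \<omega>) \<partial>P) = 0" by simp
  then have "AE \<omega> in P. alive \<sigma> \<omega> * 1 * indicator N (sub \<sigma> \<omega>) = (0::ennreal)"
    by (subst (asm) nn_integral_0_iff_AE) auto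
  moreover have "AE \<omega> in P. \<omega> \<in> space P" by (rule AE_space)
  ultimately show ?thesis
  proof eventually_elim
    case (elim \<omega>)
    have "sub \<sigma> \<omega> \<in> space P" unfolding space_P by (rule subtree_in_space[OF s])
    then show ?case using elim N(1) by (auto simp: indicator_def split: if_splits)
  qed
qed

text \<open>The almost sure properties under which the branching measure exists.\<close>

definition regular :: "(nat list \<Rightarrow> status) \<Rightarrow> bool" where
  "regular \<omega> \<longleftrightarrow> hereditary \<omega> \<and> (\<forall>\<sigma>\<in>words m k. convergent (\<lambda>j. normalised_size j (sub \<sigma> \<omega>)))"

lemma countable_words: "countable (words m k)"
  by (rule countableI_type)

lemma AE_regular: "AE \<omega> in P. regular \<omega>"
proof -
  have "AE \<omega> in P. \<forall>\<sigma>\<in>words m k. \<omega> \<sigma> = Chosen \<longrightarrow> convergent (\<lambda>j. normalised_size j (sub \<sigma> \<omega>))"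
  proof (subst AE_ball_countable[OF countable_words], rule ballI)
    fix \<sigma> assume s: "\<sigma> \<in> words m k"
    have "AE \<omega> in P. convergent (\<lambda>j. normalised_size j \<omega>)"
      using AE_limit_size by eventually_elim (auto simp: convergent_def)
    from AE_subtree[OF this s] show "AE \<omega> in P. \<omega> \<sigma> = Chosen \<longrightarrow> convergent (\<lambda>j. normalised_size j (sub \<sigma> \<omega>))" .
  qed
  then show ?thesis using AE_hereditary
  proof eventually_elim
    case (elim \<omega>)
    have "convergent (\<lambda>j. normalised_size j (sub \<sigma> \<omega>))" if "\<sigma> \<in> words m k" for \<sigma>
    proof (cases "\<omega> \<sigma> = Chosen")
      case False
      then show ?thesis using normalised_size_neglected[OF elim(2) that False] by (simp add: convergent_const)
    qed (use elim that in auto)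
    then show ?case using elim by (simp add: regular_def)
  qed
qed

context
  fixes \<omega> assumes reg: "regular \<omega>"
begin

lemma regular_LIMSEQ: "\<sigma> \<in> words m k \<Longrightarrow> (\<lambda>j. normalised_size j (sub \<sigma> \<omega>)) \<longlonglongrightarrow> limit_size (sub \<sigma> \<omega>)"
  using reg by (auto simp: regular_def limit_size_def convergent_LIMSEQ_iff)

lemma regular_nonneg: "\<sigma> \<in> words m k \<Longrightarrow> 0 \<le> limit_size (sub \<sigma> \<omega>)"
  using regular_LIMSEQ by (rule LIMSEQ_le_const) auto

lemma regular_neglected: "\<sigma> \<in> words m k \<Longrightarrow> \<omega> \<sigma> \<noteq> Chosen \<Longrightarrow> limit_size (sub \<sigma> \<omega>) = 0"
  using reg normalised_size_neglected[of \<omega> \<sigma>] by (simp add: limit_size_def regular_def)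

lemma regular_sum:
  assumes "\<sigma> \<in> words m k"
  shows "growth * limit_size (sub \<sigma> \<omega>) = (\<Sum>i\<in>alphabet m k. limit_size (sub (\<sigma> @ [i]) \<omega>))"
proof -
  have "(\<lambda>j. normalised_size (Suc j) (sub \<sigma> \<omega>)) \<longlonglongrightarrow> limit_size (sub \<sigma> \<omega>)"
    using regular_LIMSEQ[OF assms] by (rule LIMSEQ_Suc)
  moreover have "(\<lambda>j. normalised_size (Suc j) (sub \<sigma> \<omega>)) \<longlonglongrightarrow> (\<Sum>i\<in>alphabet m k. limit_size (sub (\<sigma> @ [i]) \<omega>)) / growth"
    unfolding normalised_size_Suc
  proof (intro tendsto_divide tendsto_sum tendsto_const)
    fix i assume i: "i \<in> alphabet m k"
    then have "(\<lambda>j. normalised_size j (sub (\<sigma> @ [i]) \<omega>)) \<longlonglongrightarrow> limit_size (sub (\<sigma> @ [i]) \<omega>)"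
      using assms by (intro regular_LIMSEQ) simp
    then show "(\<lambda>j. normalised_size j (sub [i] (sub \<sigma> \<omega>))) \<longlonglongrightarrow> limit_size (sub (\<sigma> @ [i]) \<omega>)"
      using i by (simp add: subtree_subtree)
  qed (use growth_pos in simp)
  ultimately have "limit_size (sub \<sigma> \<omega>) = (\<Sum>i\<in>alphabet m k. limit_size (sub (\<sigma> @ [i]) \<omega>)) / growth"
    by (rule LIMSEQ_unique)
  then show ?thesis using growth_pos by simp
qed

end


section \<open>Multiplicative functionals along the spine\<close>

text \<open>Each step averages over the chosen words of the next block, with the normalisation of the mean
  number of such words. If the terminal weight \<open>F\<close> contains the limit size as a factor, the result
  is the integral of a product along the ray with respect to the branching measure.\<close>

fun spine_functional where
  "spine_functional n h F 0 \<omega> = (F \<omega> :: ennreal)"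
| "spine_functional n h F (Suc N) \<omega> =
    ennreal (1 / growth ^ n) * (\<Sum>\<sigma>\<in>level_words m k n. alive \<sigma> \<omega> * h \<sigma> \<omega> * spine_functional n h F N (sub \<sigma> \<omega>))"

definition step_mean :: "nat \<Rightarrow> (nat list \<Rightarrow> (nat list \<Rightarrow> status) \<Rightarrow> ennreal) \<Rightarrow> ennreal" where
  "step_mean n h = ennreal (1 / growth ^ n) * (\<Sum>\<sigma>\<in>level_words m k n. \<integral>\<^sup>+\<omega>. alive \<sigma> \<omega> * h \<sigma> \<omega> \<partial>P)"

text \<open>A block weight must ignore the tree strictly below its block, since that part is
  used for the weights of the later blocks.\<close>

definition block_weight :: "nat \<Rightarrow> (nat list \<Rightarrow> (nat list \<Rightarrow> status) \<Rightarrow> ennreal) \<Rightarrow> bool" where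
  "block_weight n h \<longleftrightarrow> (\<forall>\<sigma>\<in>level_words m k n. h \<sigma> \<in> borel_measurable (Omega m k) \<and>
     determined_by (Omega m k) (outside \<sigma>) (h \<sigma>))"

lemma measurable_spine_functional:
  assumes h: "block_weight n h" and F: "F \<in> borel_measurable (Omega m k)"
  shows "spine_functional n h F N \<in> borel_measurable (Omega m k)"
proof (induction N)
  case 0
  then show ?case using F by (simp cong: measurable_cong)
next
  case (Suc N)
  note [measurable] = Suc
  have "(\<lambda>\<omega>. ennreal (1 / growth ^ n) * (\<Sum>\<sigma>\<in>level_words m k n. alive \<sigma> \<omega> * h \<sigma> \<omega> * spine_functional n h F N (sub \<sigma> \<omega>))) \<in> borel_measurable (Omega m k)"
  proof (intro borel_measurable_times_ennreal borel_measurable_const borel_measurable_sum)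
    fix \<sigma> assume s: "\<sigma> \<in> level_words m k n"
    then have [measurable]: "\<sigma> \<in> words m k" by simp
    show "(\<lambda>\<omega>. alive \<sigma> \<omega>) \<in> borel_measurable (Omega m k)" by measurable
    show "h \<sigma> \<in> borel_measurable (Omega m k)" using h s by (simp add: block_weight_def)
    show "(\<lambda>\<omega>. spine_functional n h F N (sub \<sigma> \<omega>)) \<in> borel_measurable (Omega m k)" by measurable
  qed
  then show ?case by simp
qed

text \<open>The branching property splits off one block at a time.\<close>

lemma nn_integral_spine_functional:
  assumes h: "block_weight n h" and F: "F \<in> borel_measurable (Omega m k)"
  shows "(\<integral>\<^sup>+\<omega>. spine_functional n h F N \<omega> \<partial>P) = step_mean n h ^ N * (\<integral>\<^sup>+\<omega>. F \<omega> \<partial>P)"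
proof (induction N)
  case (Suc N)
  note meas [measurable] = measurable_spine_functional[OF h F, of N]
  have sm: "(\<lambda>\<omega>. alive \<sigma> \<omega> * h \<sigma> \<omega> * spine_functional n h F N (sub \<sigma> \<omega>)) \<in> borel_measurable P"
    if s: "\<sigma> \<in> level_words m k n" for \<sigma>
  proof -
    have [measurable]: "\<sigma> \<in> words m k" "h \<sigma> \<in> borel_measurable (Omega m k)"
      using s h by (simp_all add: block_weight_def)
    show ?thesis by measurable
  qed
  have "(\<integral>\<^sup>+\<omega>. spine_functional n h F (Suc N) \<omega> \<partial>P)
     = ennreal (1 / growth ^ n) * (\<Sum>\<sigma>\<in>level_words m k n. \<integral>\<^sup>+\<omega>. alive \<sigma> \<omega> * h \<sigma> \<omega> * spine_functional n h F N (sub \<sigma> \<omega>) \<partial>P)"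
    using sm by (simp only: spine_functional.simps nn_integral_cmult nn_integral_sum borel_measurable_sum)
  also have "\<dots> = ennreal (1 / growth ^ n) * (\<Sum>\<sigma>\<in>level_words m k n. (\<integral>\<^sup>+\<omega>. alive \<sigma> \<omega> * h \<sigma> \<omega> \<partial>P) * (\<integral>\<^sup>+\<omega>. spine_functional n h F N \<omega> \<partial>P))"
    using h by (intro arg_cong2[where f="(*)"] refl sum.cong branching meas) (auto simp: block_weight_def)
  also have "\<dots> = step_mean n h ^ Suc N * (\<integral>\<^sup>+\<omega>. F \<omega> \<partial>P)"
    unfolding Suc sum_distrib_right[symmetric] by (simp only: step_mean_def power_Suc mult.assoc)
  finally show ?case .
qed simp

lemma hereditary_sub: "hereditary \<omega> \<Longrightarrow> \<sigma> \<in> words m k \<Longrightarrow> hereditary (sub \<sigma> \<omega>)"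
  unfolding hereditary_def
proof (intro ballI impI)
  fix \<rho> \<tau> assume h: "\<forall>\<sigma>\<in>words m k. \<forall>\<tau>\<in>words m k. \<omega> (\<sigma> @ \<tau>) = Chosen \<longrightarrow> \<omega> \<sigma> = Chosen"
    and s: "\<sigma> \<in> words m k" "\<rho> \<in> words m k" "\<tau> \<in> words m k" and c: "sub \<sigma> \<omega> (\<rho> @ \<tau>) = Chosen"
  have "\<omega> ((\<sigma> @ \<rho>) @ \<tau>) = Chosen" using c s by (simp add: subtree_apply)
  moreover have "\<sigma> @ \<rho> \<in> words m k" using s by simp
  ultimately have "\<omega> (\<sigma> @ \<rho>) = Chosen" using h s(3) by blast
  then show "sub \<sigma> \<omega> \<rho> = Chosen" using s by (simp add: subtree_apply)
qed

abbreviation word_block :: "nat \<Rightarrow> nat \<Rightarrow> nat list \<Rightarrow> nat list" where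
  "word_block n b \<tau> \<equiv> take n (drop (b * n) \<tau>)"

lemma spine_functional_eq_sum:
  assumes "hereditary \<omega>" and "\<And>\<tau>. \<tau> \<in> words m k \<Longrightarrow> \<omega> \<tau> \<noteq> Chosen \<Longrightarrow> F (sub \<tau> \<omega>) = 0"
    and "\<omega> \<in> space P"
  shows "spine_functional n h F N \<omega> = ennreal (1 / growth ^ (N * n)) *
    (\<Sum>\<tau>\<in>level_words m k (N * n).
      (\<Prod>b<N. h (word_block n b \<tau>) (sub (take (b * n) \<tau>) \<omega>)) * F (sub \<tau> \<omega>))"
  using assms
proof (induction N arbitrary: \<omega>)
  case 0
  have "level_words m k (0 * n) = {[]}" by auto
  moreover have "sub [] \<omega> = \<omega>" using 0 by (auto simp: subtree_def space_P fun_eq_iff)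
  ultimately show ?case by simp
next
  case (Suc N)
  define G where "G \<tau> = (\<Prod>b<Suc N. h (word_block n b \<tau>) (sub (take (b * n) \<tau>) \<omega>)) * F (sub \<tau> \<omega>)" for \<tau>
  have sub0: "sub [] \<omega> = \<omega>" using Suc.prems by (auto simp: subtree_def space_P fun_eq_iff)
  have *: "alive \<sigma> \<omega> * h \<sigma> \<omega> * spine_functional n h F N (sub \<sigma> \<omega>)
     = ennreal (1 / growth ^ (N * n)) * (\<Sum>\<tau>\<in>level_words m k (N * n). G (\<sigma> @ \<tau>))"
    if s: "\<sigma> \<in> level_words m k n" for \<sigma>
  proof -
    have sw: "\<sigma> \<in> words m k" "length \<sigma> = n" using s by simp_all
    have e1: "spine_functional n h F N (sub \<sigma> \<omega>) = ennreal (1 / growth ^ (N * n)) *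
      (\<Sum>\<tau>\<in>level_words m k (N * n).
        (\<Prod>b<N. h (word_block n b \<tau>) (sub (take (b * n) \<tau>) (sub \<sigma> \<omega>))) * F (sub \<tau> (sub \<sigma> \<omega>)))"
    proof (rule Suc.IH)
      show "hereditary (sub \<sigma> \<omega>)" using Suc.prems(1) sw(1) by (rule hereditary_sub)
      show "sub \<sigma> \<omega> \<in> space P" unfolding space_P using sw(1) by (rule subtree_in_space)
      fix \<tau> assume t: "\<tau> \<in> words m k" "sub \<sigma> \<omega> \<tau> \<noteq> Chosen"
      then show "F (sub \<tau> (sub \<sigma> \<omega>)) = 0"
        using sw(1) by (simp add: subtree_subtree subtree_apply Suc.prems(2))
    qed
    have "alive \<sigma> \<omega> * h \<sigma> \<omega> * spine_functional n h F N (sub \<sigma> \<omega>) = ennreal (1 / growth ^ (N * n)) *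
      (\<Sum>\<tau>\<in>level_words m k (N * n). alive \<sigma> \<omega> * (h \<sigma> \<omega> *
        ((\<Prod>b<N. h (word_block n b \<tau>) (sub (take (b * n) \<tau>) (sub \<sigma> \<omega>))) * F (sub \<tau> (sub \<sigma> \<omega>)))))"
      unfolding e1 by (simp only: sum_distrib_left mult_ac)
    also have "(\<Sum>\<tau>\<in>level_words m k (N * n). alive \<sigma> \<omega> * (h \<sigma> \<omega> *
        ((\<Prod>b<N. h (word_block n b \<tau>) (sub (take (b * n) \<tau>) (sub \<sigma> \<omega>))) * F (sub \<tau> (sub \<sigma> \<omega>)))))
        = (\<Sum>\<tau>\<in>level_words m k (N * n). G (\<sigma> @ \<tau>))"
    proof (intro sum.cong refl)
      fix \<tau> assume t: "\<tau> \<in> level_words m k (N * n)"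
      then have tw: "\<tau> \<in> words m k" by simp
      have "G (\<sigma> @ \<tau>) = h \<sigma> \<omega> * ((\<Prod>b<N. h (word_block n b \<tau>) (sub (take (b * n) \<tau>) (sub \<sigma> \<omega>))) * F (sub \<tau> (sub \<sigma> \<omega>)))"
        unfolding G_def prod.lessThan_Suc_shift
        using sw tw by (simp add: sub0 subtree_subtree take_in_words mult.assoc del: in_lists_conv_set)
      moreover have "G (\<sigma> @ \<tau>) = 0" if "\<omega> \<sigma> \<noteq> Chosen"
      proof -
        have "\<omega> (\<sigma> @ \<tau>) \<noteq> Chosen" using Suc.prems(1) that sw(1) tw by (auto simp: hereditary_def)
        then have "F (sub (\<sigma> @ \<tau>) \<omega>) = 0" using sw(1) tw by (intro Suc.prems(2)) auto
        then show ?thesis by (simp add: G_def)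
      qed
      ultimately show "alive \<sigma> \<omega> * (h \<sigma> \<omega> *
        ((\<Prod>b<N. h (word_block n b \<tau>) (sub (take (b * n) \<tau>) (sub \<sigma> \<omega>))) * F (sub \<tau> (sub \<sigma> \<omega>)))) = G (\<sigma> @ \<tau>)"
        by auto
    qed
    finally show ?thesis .
  qed
  have c: "ennreal (1 / growth ^ n) * ennreal (1 / growth ^ (N * n)) = ennreal (1 / growth ^ (Suc N * n))"
    by (simp add: ennreal_mult[symmetric] power_add)
  have "spine_functional n h F (Suc N) \<omega> = ennreal (1 / growth ^ n) *
     (\<Sum>\<sigma>\<in>level_words m k n. ennreal (1 / growth ^ (N * n)) * (\<Sum>\<tau>\<in>level_words m k (N * n). G (\<sigma> @ \<tau>)))"
    unfolding spine_functional.simps by (intro arg_cong2[where f="(*)"] refl sum.cong *)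
  also have "\<dots> = ennreal (1 / growth ^ (Suc N * n)) * (\<Sum>\<sigma>\<in>level_words m k n. \<Sum>\<tau>\<in>level_words m k (N * n). G (\<sigma> @ \<tau>))"
    by (simp only: sum_distrib_left[symmetric] c[symmetric] mult.assoc)
  also have "(\<Sum>\<sigma>\<in>level_words m k n. \<Sum>\<tau>\<in>level_words m k (N * n). G (\<sigma> @ \<tau>)) = (\<Sum>\<tau>\<in>level_words m k (Suc N * n). G \<tau>)"
    by (simp only: sum_level_words_add[symmetric] mult_Suc)
  finally show ?case unfolding G_def .
qed

section \<open>Branching measures on sequences\<close>

abbreviation cylinder :: "nat list \<Rightarrow> (nat \<Rightarrow> nat) set" where
  "cylinder \<sigma> \<equiv> {\<eta> \<in> space (seq_space m k). seq_prefix \<eta> (length \<sigma>) = \<sigma>}"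

definition is_branching :: "real \<Rightarrow> (nat list \<Rightarrow> status) \<Rightarrow> (nat \<Rightarrow> nat) measure \<Rightarrow> bool" where
  "is_branching C \<omega> \<mu> \<longleftrightarrow> sets \<mu> = sets (seq_space m k) \<and>
    (\<forall>\<sigma>\<in>words m k. emeasure \<mu> (cylinder \<sigma>) = ennreal (C / growth ^ length \<sigma> * limit_size (sub \<sigma> \<omega>)))"

lemma space_seq_space: "space (seq_space m k) = UNIV \<rightarrow> alphabet m k"
  by (simp add: seq_space_def space_PiM PiE_UNIV_domain Pi_def)

lemma seq_prefix_in_words: "\<eta> \<in> space (seq_space m k) \<Longrightarrow> seq_prefix \<eta> n \<in> level_words m k n"
  by (auto simp: space_seq_space Pi_iff)

lemma measurable_seq_component [measurable]: "(\<lambda>\<eta>. \<eta> i) \<in> seq_space m k \<rightarrow>\<^sub>M count_space UNIV"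
proof -
  have "(\<lambda>\<eta>. \<eta> i) \<in> seq_space m k \<rightarrow>\<^sub>M count_space (alphabet m k)"
    unfolding seq_space_def by (rule measurable_component_singleton) simp
  moreover have "(\<lambda>x. x) \<in> count_space (alphabet m k) \<rightarrow>\<^sub>M count_space (UNIV :: nat set)" by simp
  ultimately show ?thesis by (rule measurable_compose)
qed

lemma measurable_seq_prefix [measurable]: "(\<lambda>\<eta>. seq_prefix \<eta> n) \<in> seq_space m k \<rightarrow>\<^sub>M count_space UNIV"
proof (induction n)
  case (Suc n)
  note [measurable] = Suc
  have "(\<lambda>\<eta>. seq_prefix \<eta> n @ [\<eta> n]) \<in> seq_space m k \<rightarrow>\<^sub>M count_space UNIV" by measurable
  then show ?case by simp
qed simp

lemma sets_cylinder [measurable]: "cylinder \<sigma> \<in> sets (seq_space m k)"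
  by measurable

lemma nn_integral_seq_prefix:
  assumes "sets \<mu> = sets (seq_space m k)"
  shows "(\<integral>\<^sup>+\<eta>. \<phi> (seq_prefix \<eta> n) \<partial>\<mu>) = (\<Sum>\<sigma>\<in>level_words m k n. \<phi> \<sigma> * emeasure \<mu> (cylinder \<sigma>))"
proof -
  note [measurable_cong] = assms
  have sp: "space \<mu> = space (seq_space m k)" by (rule sets_eq_imp_space_eq[OF assms])
  have "(\<integral>\<^sup>+\<eta>. \<phi> (seq_prefix \<eta> n) \<partial>\<mu>) = (\<integral>\<^sup>+\<eta>. (\<Sum>\<sigma>\<in>level_words m k n. \<phi> \<sigma> * indicator (cylinder \<sigma>) \<eta>) \<partial>\<mu>)"
  proof (rule nn_integral_cong)
    fix \<eta> assume e: "\<eta> \<in> space \<mu>"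
    have "(\<Sum>\<sigma>\<in>level_words m k n. \<phi> \<sigma> * indicator (cylinder \<sigma>) \<eta>) = (\<Sum>\<sigma>\<in>level_words m k n. if \<sigma> = seq_prefix \<eta> n then \<phi> \<sigma> else 0)"
      using e by (intro sum.cong refl) (auto simp: indicator_def sp)
    also have "\<dots> = \<phi> (seq_prefix \<eta> n)"
      using e seq_prefix_in_words[of \<eta> n] by (subst sum.delta) (auto simp: sp)
    finally show "\<phi> (seq_prefix \<eta> n) = (\<Sum>\<sigma>\<in>level_words m k n. \<phi> \<sigma> * indicator (cylinder \<sigma>) \<eta>)" ..
  qed
  also have "\<dots> = (\<Sum>\<sigma>\<in>level_words m k n. \<integral>\<^sup>+\<eta>. \<phi> \<sigma> * indicator (cylinder \<sigma>) \<eta> \<partial>\<mu>)"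
    by (rule nn_integral_sum) measurable
  also have "\<dots> = (\<Sum>\<sigma>\<in>level_words m k n. \<phi> \<sigma> * emeasure \<mu> (cylinder \<sigma>))"
    by (intro sum.cong refl nn_integral_cmult_indicator) (simp add: assms)
  finally show ?thesis .
qed

abbreviation seq_block :: "nat \<Rightarrow> nat \<Rightarrow> (nat \<Rightarrow> nat) \<Rightarrow> nat list" where
  "seq_block n b \<eta> \<equiv> map \<eta> [b * n..<b * n + n]"

lemma word_block_seq_prefix: "b < N \<Longrightarrow> word_block n b (seq_prefix \<eta> (N * n)) = seq_block n b \<eta>"
proof -
  assume "b < N"
  then have "Suc b * n \<le> N * n" by (intro mult_le_mono1) simp
  then have "n + b * n \<le> N * n" by simp
  then show ?thesis by (simp add: drop_map take_map drop_upt take_upt add.commute)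
qed

lemma take_seq_prefix: "j \<le> n \<Longrightarrow> take j (seq_prefix \<eta> n) = seq_prefix \<eta> j"
  by (simp add: take_map)

lemma ennreal_terms_eventually_le_1:
  fixes f :: "nat \<Rightarrow> ennreal"
  assumes "(\<Sum>n. f n) \<noteq> \<infinity>"
  shows "\<forall>\<^sub>F n in sequentially. f n \<le> 1"
proof -
  have fin: "f n \<noteq> \<infinity>" for n
  proof
    assume "f n = \<infinity>"
    moreover have "f n \<le> (\<Sum>n. f n)" using sum_le_suminf[of f "{n}"] by simp
    ultimately show False using assms by (simp add: top_unique)
  qed
  define r where "r n = enn2real (f n)" for n
  have f: "f = (\<lambda>n. ennreal (r n))" using fin by (auto simp: r_def fun_eq_iff less_top)
  have r0: "0 \<le> r n" for n by (simp add: r_def)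
  have "summable r" using assms unfolding f by (intro summable_suminf_not_top r0) simp
  then have "r \<longlonglongrightarrow> 0" by (rule summable_LIMSEQ_zero)
  then have "\<forall>\<^sub>F n in sequentially. r n < 1" by (rule order_tendstoD) simp
  then show ?thesis by eventually_elim (simp add: f)
qed

text \<open>Under the measure that first picks \<open>\<omega>\<close> and then a ray by its branching measure, block weights
  along the ray multiply in mean; the Borel-Cantelli lemma turns this into an almost sure bound.\<close>

theorem AE_spine_product_bound:
  fixes f :: "(nat list \<Rightarrow> status) \<Rightarrow> ennreal"
  assumes h: "block_weight n h" and f [measurable]: "f \<in> borel_measurable (Omega m k)"
    and fint: "(\<integral>\<^sup>+\<omega>. ennreal (limit_size \<omega>) * f \<omega> \<partial>P) < \<infinity>"
    and \<theta>: "0 < \<theta>" "step_mean n h < ennreal \<theta>"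
  shows "AE \<omega> in P. \<forall>\<mu>. is_branching C \<omega> \<mu> \<longrightarrow>
    (AE \<eta> in \<mu>. \<forall>\<^sub>F N in sequentially.
      (\<Prod>b<N. h (seq_block n b \<eta>) (sub (seq_prefix \<eta> (b * n)) \<omega>)) * f (sub (seq_prefix \<eta> (N * n)) \<omega>) \<le> ennreal (\<theta> ^ N))"
proof -
  define F where "F = (\<lambda>\<omega>. ennreal (limit_size \<omega>) * f \<omega>)"
  have F[measurable]: "F \<in> borel_measurable (Omega m k)" unfolding F_def by measurable
  note [measurable] = measurable_spine_functional[OF h F]
  define c where "c = ennreal (1 / \<theta>)"
  have c\<theta>: "c * ennreal \<theta> = 1" unfolding c_def using \<theta>(1) by (simp add: ennreal_mult[symmetric])
  obtain H where H: "0 \<le> H" "step_mean n h = ennreal H" "H < \<theta>"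
    using \<theta> by (cases "step_mean n h") (auto simp: ennreal_less_iff)
  obtain EF where EF: "0 \<le> EF" "(\<integral>\<^sup>+\<omega>. F \<omega> \<partial>P) = ennreal EF"
    using fint unfolding F_def[symmetric] by (cases "\<integral>\<^sup>+\<omega>. F \<omega> \<partial>P") auto
  have termN: "(\<integral>\<^sup>+\<omega>. spine_functional n h F N \<omega> * c ^ N \<partial>P) = ennreal (EF * (H / \<theta>) ^ N)" for N
    using H EF \<theta>(1) by (simp add: nn_integral_multc nn_integral_spine_functional[OF h F] c_def
        ennreal_power ennreal_mult[symmetric] power_divide)
  have "(\<integral>\<^sup>+\<omega>. (\<Sum>N. spine_functional n h F N \<omega> * c ^ N) \<partial>P) = (\<Sum>N. ennreal (EF * (H / \<theta>) ^ N))"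
    unfolding termN[symmetric] by (rule nn_integral_suminf) measurable
  also have "\<dots> < \<infinity>"
  proof -
    have "summable (\<lambda>N. EF * (H / \<theta>) ^ N)" using H \<theta>(1) by (intro summable_mult summable_geometric) simp
    then show ?thesis using H EF \<theta>(1) by (simp add: suminf_ennreal2)
  qed
  finally have "AE \<omega> in P. (\<Sum>N. spine_functional n h F N \<omega> * c ^ N) \<noteq> \<infinity>"
    by (intro nn_integral_PInf_AE) auto
  then show ?thesis using AE_regular AE_space
  proof eventually_elim
    case (elim \<omega>)
    note reg = elim(2)
    have h': "hereditary \<omega>" using reg by (simp add: regular_def)
    show ?case
    proof (intro allI impI)
      fix \<mu> assume \<mu>: "is_branching C \<omega> \<mu>"
      then have sets\<mu>[measurable_cong]: "sets \<mu> = sets (seq_space m k)" by (simp add: is_branching_def)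
      define W where "W N \<tau> = (\<Prod>b<N. h (word_block n b \<tau>) (sub (take (b * n) \<tau>) \<omega>)) * f (sub \<tau> \<omega>)" for N \<tau>
      have int: "(\<integral>\<^sup>+\<eta>. W N (seq_prefix \<eta> (N * n)) * c ^ N \<partial>\<mu>) = ennreal C * (spine_functional n h F N \<omega> * c ^ N)" for N
      proof -
        have "(\<integral>\<^sup>+\<eta>. W N (seq_prefix \<eta> (N * n)) * c ^ N \<partial>\<mu>)
          = (\<Sum>\<tau>\<in>level_words m k (N * n). W N \<tau> * c ^ N * emeasure \<mu> (cylinder \<tau>))"
          by (rule nn_integral_seq_prefix[OF sets\<mu>])
        also have "\<dots> = (\<Sum>\<tau>\<in>level_words m k (N * n). ennreal C * (c ^ N * (ennreal (1 / growth ^ (N * n)) *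
             ((\<Prod>b<N. h (word_block n b \<tau>) (sub (take (b * n) \<tau>) \<omega>)) * F (sub \<tau> \<omega>)))))"
        proof (intro sum.cong refl)
          fix \<tau> assume t: "\<tau> \<in> level_words m k (N * n)"
          then have "emeasure \<mu> (cylinder \<tau>) = ennreal (C / growth ^ length \<tau> * limit_size (sub \<tau> \<omega>))"
            using \<mu> unfolding is_branching_def by blast
          also have "\<dots> = ennreal C * ennreal (1 / growth ^ (N * n)) * ennreal (limit_size (sub \<tau> \<omega>))"
          proof -
            have "0 \<le> limit_size (sub \<tau> \<omega>)" using t by (intro regular_nonneg[OF reg]) simp
            then have "ennreal (C * (1 / growth ^ (N * n) * limit_size (sub \<tau> \<omega>))) = ennreal C * (ennreal (1 / growth ^ (N * n)) * ennreal (limit_size (sub \<tau> \<omega>)))"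
              by (simp add: ennreal_mult''[symmetric])
            then show ?thesis using t by (simp add: mult.assoc)
          qed
          finally show "W N \<tau> * c ^ N * emeasure \<mu> (cylinder \<tau>) = ennreal C * (c ^ N * (ennreal (1 / growth ^ (N * n)) *
             ((\<Prod>b<N. h (word_block n b \<tau>) (sub (take (b * n) \<tau>) \<omega>)) * F (sub \<tau> \<omega>))))"
            by (simp only: W_def F_def mult_ac)
        qed
        also have "\<dots> = ennreal C * (c ^ N * (ennreal (1 / growth ^ (N * n)) * (\<Sum>\<tau>\<in>level_words m k (N * n).
             (\<Prod>b<N. h (word_block n b \<tau>) (sub (take (b * n) \<tau>) \<omega>)) * F (sub \<tau> \<omega>))))"
          by (simp only: sum_distrib_left)
        also have "ennreal (1 / growth ^ (N * n)) * (\<Sum>\<tau>\<in>level_words m k (N * n).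
             (\<Prod>b<N. h (word_block n b \<tau>) (sub (take (b * n) \<tau>) \<omega>)) * F (sub \<tau> \<omega>)) = spine_functional n h F N \<omega>"
          by (rule spine_functional_eq_sum[symmetric, OF h' _ elim(3)]) (simp add: F_def regular_neglected[OF reg])
        finally show ?thesis by (simp only: mult_ac)
      qed
      have meas: "(\<lambda>\<eta>. W N (seq_prefix \<eta> (N * n)) * c ^ N) \<in> borel_measurable \<mu>" for N by measurable
      have "(\<integral>\<^sup>+\<eta>. (\<Sum>N. W N (seq_prefix \<eta> (N * n)) * c ^ N) \<partial>\<mu>) = (\<Sum>N. ennreal C * (spine_functional n h F N \<omega> * c ^ N))"
        unfolding int[symmetric] by (rule nn_integral_suminf[OF meas])
      also have "\<dots> = ennreal C * (\<Sum>N. spine_functional n h F N \<omega> * c ^ N)"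
        by (rule ennreal_suminf_cmult)
      also have "\<dots> < \<infinity>" using elim(1) by (auto simp: ennreal_mult_less_top less_top)
      finally have "AE \<eta> in \<mu>. (\<Sum>N. W N (seq_prefix \<eta> (N * n)) * c ^ N) \<noteq> \<infinity>"
        using meas by (intro nn_integral_PInf_AE) auto
      then show "AE \<eta> in \<mu>. \<forall>\<^sub>F N in sequentially.
        (\<Prod>b<N. h (seq_block n b \<eta>) (sub (seq_prefix \<eta> (b * n)) \<omega>)) * f (sub (seq_prefix \<eta> (N * n)) \<omega>) \<le> ennreal (\<theta> ^ N)"
      proof eventually_elim
        case (elim \<eta>)
        from ennreal_terms_eventually_le_1[OF elim] show ?case
        proof eventually_elim
          fix N assume le: "W N (seq_prefix \<eta> (N * n)) * c ^ N \<le> 1"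
          have "W N (seq_prefix \<eta> (N * n)) = W N (seq_prefix \<eta> (N * n)) * (c * ennreal \<theta>) ^ N" by (simp add: c\<theta>)
          also have "\<dots> = W N (seq_prefix \<eta> (N * n)) * c ^ N * ennreal \<theta> ^ N" by (simp only: power_mult_distrib mult_ac)
          also have "\<dots> \<le> 1 * ennreal \<theta> ^ N" by (intro mult_right_mono le) simp
          finally have "W N (seq_prefix \<eta> (N * n)) \<le> ennreal (\<theta> ^ N)" using \<theta>(1) by (simp add: ennreal_power)
          moreover have "(\<Prod>b<N. h (word_block n b (seq_prefix \<eta> (N * n))) (sub (take (b * n) (seq_prefix \<eta> (N * n))) \<omega>))
              = (\<Prod>b<N. h (seq_block n b \<eta>) (sub (seq_prefix \<eta> (b * n)) \<omega>))"
            by (intro prod.cong refl) (simp only: lessThan_iff word_block_seq_prefix take_seq_prefix mult_le_mono1 less_imp_le)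
          ultimately show "(\<Prod>b<N. h (seq_block n b \<eta>) (sub (seq_prefix \<eta> (b * n)) \<omega>)) * f (sub (seq_prefix \<eta> (N * n)) \<omega>) \<le> ennreal (\<theta> ^ N)"
            by (simp only: W_def)
        qed
      qed
    qed
  qed
qed


lemma branching_measure_unique:
  assumes "is_branching C \<omega> \<mu>" "is_branching C \<omega> \<nu>"
  shows "\<mu> = \<nu>"
proof -
  let ?M = "\<lambda>_::nat. count_space (alphabet m k)"
  have s\<mu>: "sets \<mu> = sets (seq_space m k)" and s\<nu>: "sets \<nu> = sets (seq_space m k)"
    using assms by (simp_all add: is_branching_def)
  have eq: "emeasure \<mu> (cylinder \<sigma>) = emeasure \<nu> (cylinder \<sigma>)" if "\<sigma> \<in> words m k" for \<sigma>
  proof -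
    have "emeasure \<mu> (cylinder \<sigma>) = ennreal (C / growth ^ length \<sigma> * limit_size (sub \<sigma> \<omega>))"
      using assms(1) that unfolding is_branching_def by blast
    moreover have "emeasure \<nu> (cylinder \<sigma>) = ennreal (C / growth ^ length \<sigma> * limit_size (sub \<sigma> \<omega>))"
      using assms(2) that unfolding is_branching_def by blast
    ultimately show ?thesis by simp
  qed
  show ?thesis
  proof (rule measure_eqI_PiM_infinite)
    show "sets \<mu> = sets (PiM UNIV ?M)" "sets \<nu> = sets (PiM UNIV ?M)"
      using s\<mu> s\<nu> by (simp_all add: seq_space_def)
    have "space \<mu> = cylinder []"
      using sets_eq_imp_space_eq[OF s\<mu>] by simp
    moreover have "emeasure \<mu> (cylinder []) = ennreal (C / growth ^ length ([]::nat list) * limit_size (sub [] \<omega>))"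
      using assms(1) unfolding is_branching_def by blast
    ultimately show "finite_measure \<mu>"
      by (intro finite_measureI) (simp only: ennreal_neq_top not_False_eq_True infinity_ennreal_def)
    fix A :: "nat \<Rightarrow> nat set" and J :: "nat set" assume J: "finite J"
    define n where "n = Suc (\<Sum>i\<in>J. i)"
    have n: "i < n" if "i \<in> J" for i
      unfolding n_def using that J by (auto simp: less_Suc_eq_le intro!: member_le_sum)
    define T where "T = {\<sigma> \<in> level_words m k n. \<forall>i\<in>J. \<sigma> ! i \<in> A i}"
    have finT: "finite T" by (rule finite_subset[OF _ finite_level_words[of m k n]]) (auto simp: T_def)
    have U: "prod_emb UNIV ?M J (Pi\<^sub>E J A) = (\<Union>\<sigma>\<in>T. cylinder \<sigma>)"
    proof (rule set_eqI)
      fix \<eta>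
      have "\<eta> \<in> prod_emb UNIV ?M J (Pi\<^sub>E J A) \<longleftrightarrow> \<eta> \<in> space (seq_space m k) \<and> (\<forall>i\<in>J. \<eta> i \<in> A i)"
        by (auto simp: prod_emb_def space_seq_space PiE_UNIV_domain Pi_iff restrict_PiE_iff)
      also have "\<dots> \<longleftrightarrow> \<eta> \<in> (\<Union>\<sigma>\<in>T. cylinder \<sigma>)"
      proof
        assume e: "\<eta> \<in> space (seq_space m k) \<and> (\<forall>i\<in>J. \<eta> i \<in> A i)"
        then have "seq_prefix \<eta> n \<in> T"
          using seq_prefix_in_words[of \<eta> n] n by (auto simp: T_def)
        then show "\<eta> \<in> (\<Union>\<sigma>\<in>T. cylinder \<sigma>)" using e by (intro UN_I[of "seq_prefix \<eta> n"]) auto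
      next
        assume "\<eta> \<in> (\<Union>\<sigma>\<in>T. cylinder \<sigma>)"
        then obtain \<sigma> where s: "\<sigma> \<in> T" "\<eta> \<in> space (seq_space m k)" "seq_prefix \<eta> (length \<sigma>) = \<sigma>" by blast
        have "\<eta> i \<in> A i" if i: "i \<in> J" for i
        proof -
          have "\<sigma> ! i = \<eta> i" using s(1) n[OF i] by (subst s(3)[symmetric]) (simp add: T_def)
          then show ?thesis using s(1) i by (auto simp: T_def)
        qed
        then show "\<eta> \<in> space (seq_space m k) \<and> (\<forall>i\<in>J. \<eta> i \<in> A i)" using s(2) by blast
      qed
      finally show "\<eta> \<in> prod_emb UNIV ?M J (Pi\<^sub>E J A) \<longleftrightarrow> \<eta> \<in> (\<Union>\<sigma>\<in>T. cylinder \<sigma>)" .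
    qed
    have D: "disjoint_family_on cylinder T" by (auto simp: disjoint_family_on_def T_def)
    have "emeasure \<mu> (\<Union>\<sigma>\<in>T. cylinder \<sigma>) = (\<Sum>\<sigma>\<in>T. emeasure \<mu> (cylinder \<sigma>))"
      using finT D by (intro sum_emeasure[symmetric]) (auto simp: s\<mu>)
    also have "\<dots> = (\<Sum>\<sigma>\<in>T. emeasure \<nu> (cylinder \<sigma>))"
      by (intro sum.cong refl eq) (auto simp: T_def)
    also have "\<dots> = emeasure \<nu> (\<Union>\<sigma>\<in>T. cylinder \<sigma>)"
      using finT D by (intro sum_emeasure) (auto simp: s\<nu>)
    finally show "emeasure \<mu> (prod_emb UNIV ?M J (Pi\<^sub>E J A)) = emeasure \<nu> (prod_emb UNIV ?M J (Pi\<^sub>E J A))"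
      unfolding U .
  qed
qed

text \<open>At words without mass the value is arbitrary, except that it has to define a probability: such
  words are visited with probability 0.\<close>

definition child_weight :: "(nat list \<Rightarrow> status) \<Rightarrow> nat list \<Rightarrow> nat \<Rightarrow> real" where
  "child_weight \<omega> \<sigma> j = (if limit_size (sub \<sigma> \<omega>) = 0 then 1 / real k ^ m
     else limit_size (sub (\<sigma> @ [j]) \<omega>) / (growth * limit_size (sub \<sigma> \<omega>)))"

definition child_kernel :: "(nat list \<Rightarrow> status) \<Rightarrow> nat \<Rightarrow> (nat \<Rightarrow> nat) \<Rightarrow> nat measure" where
  "child_kernel \<omega> i x = density (count_space (alphabet m k)) (\<lambda>j. ennreal (child_weight \<omega> (seq_prefix x i) j))"

text \<open>Divided by its total mass, the branching measure is the law of a random ray that passes from a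
  word to each of its children with a probability proportional to their limit sizes; the theorem
  of Ionescu Tulcea provides this law. If the total mass vanishes, so do all masses.\<close>

lemma branching_measure_exists:
  assumes reg: "regular \<omega>" and C: "0 \<le> C"
  shows "\<exists>\<mu>. is_branching C \<omega> \<mu>"
proof (cases "limit_size (sub [] \<omega>) = 0")
  case True
  have z: "limit_size (sub \<sigma> \<omega>) = 0" if "\<sigma> \<in> words m k" for \<sigma>
    using that
  proof (induction \<sigma> rule: rev_induct)
    case Nil
    then show ?case using True by simp
  next
    case (snoc j \<sigma>)
    then have s: "\<sigma> \<in> words m k" "j \<in> alphabet m k" by auto
    have "(\<Sum>i\<in>alphabet m k. limit_size (sub (\<sigma> @ [i]) \<omega>)) = 0"
      using regular_sum[OF reg s(1)] snoc.IH[OF s(1)] by simp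
    moreover have "0 \<le> limit_size (sub (\<sigma> @ [i]) \<omega>)" if "i \<in> alphabet m k" for i
      using s that by (intro regular_nonneg[OF reg]) simp
    ultimately show ?case using s(2) by (subst (asm) sum_nonneg_eq_0_iff) auto
  qed
  have "is_branching C \<omega> (null_measure (seq_space m k))"
    using z by (simp add: is_branching_def del: in_lists_conv_set)
  then show ?thesis by blast
next
  case False
  define X where "X = limit_size (sub [] \<omega>)"
  have X: "0 < X" using False regular_nonneg[OF reg, of "[]"] by (simp add: X_def)
  let ?A = "alphabet m k" and ?M = "\<lambda>_::nat. count_space (alphabet m k)"
  have word: "seq_prefix x i \<in> words m k" if "x \<in> space (PiM {0..<i} ?M)" for x i
    using that by (auto simp: space_PiM PiE_iff)
  have w0: "0 \<le> child_weight \<omega> \<sigma> j" if "\<sigma> \<in> words m k" "j \<in> ?A" for \<sigma> j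
    using that regular_nonneg[OF reg, of \<sigma>] regular_nonneg[OF reg, of "\<sigma> @ [j]"]
    by (auto simp: child_weight_def intro!: divide_nonneg_nonneg mult_nonneg_nonneg)
  have w1: "(\<Sum>j\<in>?A. child_weight \<omega> \<sigma> j) = 1" if "\<sigma> \<in> words m k" for \<sigma>
  proof (cases "limit_size (sub \<sigma> \<omega>) = 0")
    case True
    then show ?thesis using k2 by (simp add: child_weight_def)
  next
    case False
    then show ?thesis using regular_sum[OF reg that, symmetric] by (simp add: child_weight_def sum_divide_distrib[symmetric])
  qed
  have prob: "prob_space (child_kernel \<omega> i x)" if x: "x \<in> space (PiM {0..<i} ?M)" for i x
  proof
    have "emeasure (child_kernel \<omega> i x) (space (child_kernel \<omega> i x)) = (\<Sum>j\<in>?A. ennreal (child_weight \<omega> (seq_prefix x i) j))"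
      by (simp add: child_kernel_def emeasure_density nn_integral_count_space_finite)
    also have "\<dots> = ennreal (\<Sum>j\<in>?A. child_weight \<omega> (seq_prefix x i) j)"
      using w0[OF word[OF x]] by (intro sum_ennreal) auto
    finally show "emeasure (child_kernel \<omega> i x) (space (child_kernel \<omega> i x)) = 1"
      using w1[OF word[OF x]] by simp
  qed
  have kernel: "child_kernel \<omega> i \<in> PiM {0..<i} ?M \<rightarrow>\<^sub>M subprob_algebra (count_space ?A)" for i
  proof -
    have "PiM {0..<i} ?M = count_space (PiE {0..<i} (\<lambda>_. ?A))"
      by (rule count_space_PiM_finite) (auto intro: countable_finite)
    moreover have "child_kernel \<omega> i x \<in> space (subprob_algebra (count_space ?A))" if "x \<in> PiE {0..<i} (\<lambda>_. ?A)" for x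
    proof -
      have "prob_space (child_kernel \<omega> i x)" using that by (intro prob) (simp add: space_PiM)
      then have "subprob_space (child_kernel \<omega> i x)" by (rule prob_space_imp_subprob_space)
      then show ?thesis by (simp add: space_subprob_algebra child_kernel_def)
    qed
    ultimately show ?thesis by (simp add: measurable_count_space_eq1)
  qed
  interpret IT: Ionescu_Tulcea "child_kernel \<omega>" ?M
    by (rule Ionescu_Tulcea.intro) (fact kernel, fact prob)
  let ?C = "\<lambda>i. IT.C 0 i (\<lambda>_. undefined)"
  have sing: "{x} \<in> sets (PiM {0..<i} ?M)" if "x \<in> space (PiM {0..<i} ?M)" for x and i :: nat
  proof -
    have "PiM {0..<i} ?M = count_space (PiE {0..<i} (\<lambda>_. ?A))"
      by (rule count_space_PiM_finite) (auto intro: countable_finite)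
    then show ?thesis using that by simp
  qed
  have point: "emeasure (?C i) {x} = ennreal (limit_size (sub (seq_prefix x i) \<omega>) / (growth ^ i * X))"
    if "x \<in> space (PiM {0..<i} ?M)" for x i
    using that
  proof (induction i arbitrary: x)
    case 0
    then have "x = (\<lambda>_. undefined)" by (simp add: space_PiM)
    then show ?case using X sing[OF 0] by (simp add: emeasure_return X_def)
  next
    case (Suc i)
    define y where "y = restrict x {0..<i}"
    have y: "y \<in> space (PiM {0..<i} ?M)" using Suc.prems by (auto simp: y_def space_PiM PiE_iff)
    have xi: "x i \<in> ?A" using Suc.prems by (auto simp: space_PiM PiE_iff)
    have pre: "seq_prefix y i = seq_prefix x i" by (simp add: y_def)
    define w where "w = child_weight \<omega> (seq_prefix x i) (x i)"
    have spC: "space (?C i) = space (PiM {0..<i} ?M)" using IT.space_C[of "\<lambda>_. undefined" 0 i] by simp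
    have setsC: "sets (?C i) = sets (PiM {0..<i} ?M)" using IT.sets_C[of "\<lambda>_. undefined" 0 i] by simp
    have step: "emeasure (IT.eP i z) {x} = ennreal w * indicator {y} z" if z: "z \<in> space (PiM {0..<i} ?M)" for z
    proof -
      have "emeasure (IT.eP i z) {x} = emeasure (child_kernel \<omega> i z) ((\<lambda>a. z(i := a)) -` {x} \<inter> space (count_space ?A))"
        by (rule IT.emeasure_eP[OF z sing[OF Suc.prems]])
      also have "(\<lambda>a. z(i := a)) -` {x} \<inter> space (count_space ?A) = (if z = y then {x i} else {})"
      proof (cases "z = y")
        case True
        have "y(i := x i) = x"
        proof
          fix l
          show "(y(i := x i)) l = x l" using Suc.prems by (auto simp: y_def space_PiM PiE_iff extensional_def)
        qed
        moreover have "a = x i" if "y(i := a) = x" for a using that by (metis fun_upd_same)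
        ultimately have "(\<lambda>a. y(i := a)) -` {x} = {x i}" by blast
        then show ?thesis using True xi by (simp only: refl if_True space_count_space Int_insert_left_if1 Int_empty_left)
      next
        case False
        have "z = y" if "z(i := a) = x" for a
        proof
          fix l
          show "z l = y l"
          proof (cases "l < i")
            case True
            then have "x l = z l" using that by (metis fun_upd_other less_irrefl)
            then show ?thesis using True by (simp add: y_def)
          next
            case False
            then have "z l = undefined" using z by (simp add: space_PiM PiE_iff extensional_def)
            then show ?thesis using False by (simp add: y_def)
          qed
        qed
        then have "(\<lambda>a. z(i := a)) -` {x} = {}" using False by blast
        then show ?thesis using False by (simp only: if_False Int_empty_left)
      qed
      also have "emeasure (child_kernel \<omega> i z) (if z = y then {x i} else {}) = ennreal w * indicator {y} z"
        using xi by (auto simp: child_kernel_def emeasure_density w_def pre nn_integral_count_space_finite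
            sum.delta indicator_def if_distrib cong: if_cong)
      finally show ?thesis .
    qed
    have "emeasure (?C (Suc i)) {x} = (\<integral>\<^sup>+z. emeasure (IT.eP i z) {x} \<partial>?C i)"
    proof -
      have "IT.eP i \<in> ?C i \<rightarrow>\<^sub>M subprob_algebra (PiM {0..<Suc i} ?M)"
        using IT.measurable_eP[of i] measurable_cong_sets[OF setsC refl] by blast
      moreover have "space (?C i) \<noteq> {}" using y spC by blast
      ultimately show ?thesis using sing[OF Suc.prems] by (simp add: emeasure_bind)
    qed
    also have "\<dots> = (\<integral>\<^sup>+z. ennreal w * indicator {y} z \<partial>?C i)"
      by (intro nn_integral_cong step) (simp add: spC)
    also have "\<dots> = ennreal w * emeasure (?C i) {y}"
      using sing[OF y] by (intro nn_integral_cmult_indicator) (simp add: setsC)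
    also have "\<dots> = ennreal w * ennreal (limit_size (sub (seq_prefix x i) \<omega>) / (growth ^ i * X))"
      using Suc.IH[OF y] by (simp only: pre)
    also have "\<dots> = ennreal (limit_size (sub (seq_prefix x (Suc i)) \<omega>) / (growth ^ Suc i * X))"
    proof -
      have ww: "seq_prefix x i \<in> words m k" using word[OF y] by (simp only: pre)
      have *: "w * (limit_size (sub (seq_prefix x i) \<omega>) / (growth ^ i * X)) =
         limit_size (sub (seq_prefix x i @ [x i]) \<omega>) / (growth ^ Suc i * X)"
      proof (cases "limit_size (sub (seq_prefix x i) \<omega>) = 0")
        case True
        have "(\<Sum>j\<in>?A. limit_size (sub (seq_prefix x i @ [j]) \<omega>)) = 0"
          using regular_sum[OF reg ww] True by simp
        moreover have "0 \<le> limit_size (sub (seq_prefix x i @ [j]) \<omega>)" if "j \<in> ?A" for j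
          using ww that by (intro regular_nonneg[OF reg]) simp
        ultimately have "limit_size (sub (seq_prefix x i @ [x i]) \<omega>) = 0"
          using xi by (subst (asm) sum_nonneg_eq_0_iff) auto
        then show ?thesis using True by simp
      next
        case False
        then show ?thesis by (simp add: w_def child_weight_def)
      qed
      have "0 \<le> limit_size (sub (seq_prefix x i) \<omega>) / (growth ^ i * X)"
        using regular_nonneg[OF reg ww] X by simp
      moreover have "0 \<le> w" unfolding w_def by (rule w0[OF ww xi])
      ultimately have "ennreal w * ennreal (limit_size (sub (seq_prefix x i) \<omega>) / (growth ^ i * X))
          = ennreal (w * (limit_size (sub (seq_prefix x i) \<omega>) / (growth ^ i * X)))"
        by (simp only: ennreal_mult)
      then show ?thesis unfolding * by simp
    qed
    finally show ?case .
  qed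
  let ?\<mu> = "scale_measure (ennreal (C * X)) IT.PF.lim"
  have "is_branching C \<omega> ?\<mu>"
    unfolding is_branching_def
  proof (intro conjI ballI)
    show "sets ?\<mu> = sets (seq_space m k)" by (simp add: seq_space_def)
    fix \<sigma> assume s: "\<sigma> \<in> words m k"
    define n x where "n = length \<sigma>" and "x = (\<lambda>l\<in>{0..<n}. \<sigma> ! l)"
    have x: "x \<in> space (PiM {0..<n} ?M)"
      using s nth_mem by (fastforce simp: x_def n_def space_PiM)
    have pre: "seq_prefix x n = \<sigma>" by (rule nth_equalityI) (simp_all add: x_def n_def)
    have "cylinder \<sigma> = prod_emb UNIV ?M {0..<n} {x}"
    proof (rule set_eqI)
      fix \<eta> :: "nat \<Rightarrow> nat"
      have "seq_prefix \<eta> n = \<sigma> \<longleftrightarrow> restrict \<eta> {0..<n} = x"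
      proof
        assume e: "seq_prefix \<eta> n = \<sigma>"
        show "restrict \<eta> {0..<n} = x" by (rule ext) (auto simp: x_def e[symmetric])
      next
        assume e: "restrict \<eta> {0..<n} = x"
        show "seq_prefix \<eta> n = \<sigma>"
        proof (rule nth_equalityI)
          fix i assume i: "i < length (seq_prefix \<eta> n)"
          then show "seq_prefix \<eta> n ! i = \<sigma> ! i" using fun_cong[OF e, of i] by (simp add: x_def)
        qed (simp add: n_def)
      qed
      then show "\<eta> \<in> cylinder \<sigma> \<longleftrightarrow> \<eta> \<in> prod_emb UNIV ?M {0..<n} {x}"
        by (auto simp: prod_emb_def n_def[symmetric] space_seq_space PiE_UNIV_domain)
    qed
    then have "emeasure IT.PF.lim (cylinder \<sigma>) = emeasure (IT.CI {0..<n}) {x}"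
      using IT.lim[of "{0..<n}" "{x}"] sing[OF x] by simp
    also have "\<dots> = emeasure (?C n) (prod_emb {0..<n} ?M {0..<n} {x})"
      using sing[OF x] by (intro IT.emeasure_CI) auto
    also have "prod_emb {0..<n} ?M {0..<n} {x} = {x}"
      using x by (intro prod_emb_id) (simp add: space_PiM)
    also have "emeasure (?C n) {x} = ennreal (limit_size (sub \<sigma> \<omega>) / (growth ^ n * X))"
      using point[OF x] by (simp only: pre)
    finally have "emeasure ?\<mu> (cylinder \<sigma>) = ennreal (C * X) * ennreal (limit_size (sub \<sigma> \<omega>) / (growth ^ n * X))"
      by simp
    also have "\<dots> = ennreal (C * X * (limit_size (sub \<sigma> \<omega>) / (growth ^ n * X)))"
      using C X regular_nonneg[OF reg s] by (intro ennreal_mult[symmetric]) auto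
    also have "C * X * (limit_size (sub \<sigma> \<omega>) / (growth ^ n * X)) = C / growth ^ length \<sigma> * limit_size (sub \<sigma> \<omega>)"
      using X by (simp add: n_def)
    finally show "emeasure ?\<mu> (cylinder \<sigma>) = ennreal (C / growth ^ length \<sigma> * limit_size (sub \<sigma> \<omega>))" .
  qed
  then show ?thesis by blast
qed


end

section \<open>Frequencies along a typical ray\<close>

definition density_ge :: "real \<Rightarrow> (nat \<Rightarrow> bool) \<Rightarrow> bool" where
  "density_ge c G \<longleftrightarrow> (\<forall>\<^sub>F N in sequentially. c * real N \<le> real (card {b \<in> {..<N}. G b}))"

lemma density_ge_mono:
  assumes "density_ge c G" "\<And>b. G b \<Longrightarrow> H b" shows "density_ge c H"
  using assms(1) unfolding density_ge_def
proof eventually_elim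
  case (elim N)
  have "card {b \<in> {..<N}. G b} \<le> card {b \<in> {..<N}. H b}"
    using assms(2) by (intro card_mono) auto
  then show ?case using elim by linarith
qed

context percolation
begin

text \<open>Almost every realisation and almost every ray. The quantifier over \<open>\<mu>\<close> is harmless, since at most
  one measure qualifies, and it keeps the definite description out of the arguments.\<close>

definition AE_spine :: "real \<Rightarrow> ((nat list \<Rightarrow> status) \<Rightarrow> (nat \<Rightarrow> nat) \<Rightarrow> bool) \<Rightarrow> bool" where
  "AE_spine C R \<longleftrightarrow> (AE \<omega> in P. \<forall>\<mu>. is_branching C \<omega> \<mu> \<longrightarrow> (AE \<eta> in \<mu>. R \<omega> \<eta>))"

lemma AE_spine_mp:
  assumes "AE_spine C R" "\<And>\<omega> \<eta>. R \<omega> \<eta> \<Longrightarrow> S \<omega> \<eta>" shows "AE_spine C S"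
  using assms(1) unfolding AE_spine_def
proof eventually_elim
  case (elim \<omega>)
  show ?case
  proof (intro allI impI)
    fix \<mu> assume "is_branching C \<omega> \<mu>"
    with elim have "AE \<eta> in \<mu>. R \<omega> \<eta>" by blast
    then show "AE \<eta> in \<mu>. S \<omega> \<eta>" by eventually_elim (rule assms(2))
  qed
qed

lemma AE_spine_conj:
  assumes "AE_spine C R" "AE_spine C S" shows "AE_spine C (\<lambda>\<omega> \<eta>. R \<omega> \<eta> \<and> S \<omega> \<eta>)"
  using assms unfolding AE_spine_def
proof eventually_elim
  case (elim \<omega>)
  show ?case
  proof (intro allI impI)
    fix \<mu> assume "is_branching C \<omega> \<mu>"
    with elim have "AE \<eta> in \<mu>. R \<omega> \<eta>" "AE \<eta> in \<mu>. S \<omega> \<eta>" by blast+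
    then show "AE \<eta> in \<mu>. R \<omega> \<eta> \<and> S \<omega> \<eta>" by eventually_elim blast
  qed
qed

lemma AE_spine_all_countable:
  fixes R :: "'i :: countable \<Rightarrow> _"
  assumes "\<And>i. AE_spine C (R i)" shows "AE_spine C (\<lambda>\<omega> \<eta>. \<forall>i. R i \<omega> \<eta>)"
proof -
  have "AE \<omega> in P. \<forall>i. \<forall>\<mu>. is_branching C \<omega> \<mu> \<longrightarrow> (AE \<eta> in \<mu>. R i \<omega> \<eta>)"
    using assms unfolding AE_spine_def by (simp add: AE_all_countable)
  then show ?thesis unfolding AE_spine_def
    by eventually_elim (auto simp: AE_all_countable)
qed

lemma AE_spine_regular: "AE_spine C (\<lambda>\<omega> \<eta>. regular \<omega> \<and> \<omega> \<in> space P \<and> \<eta> \<in> space (seq_space m k))"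
  unfolding AE_spine_def using AE_regular AE_space
proof eventually_elim
  case (elim \<omega>)
  show ?case
  proof (intro allI impI)
    fix \<mu> assume "is_branching C \<omega> \<mu>"
    then have "space \<mu> = space (seq_space m k)" by (intro sets_eq_imp_space_eq) (simp add: is_branching_def)
    then show "AE \<eta> in \<mu>. regular \<omega> \<and> \<omega> \<in> space P \<and> \<eta> \<in> space (seq_space m k)"
      using elim AE_space[of \<mu>] by auto
  qed
qed

lemma sum_nn_integral_alive: "(\<Sum>\<sigma>\<in>level_words m k n. \<integral>\<^sup>+\<omega>. alive \<sigma> \<omega> \<partial>P) = ennreal (growth ^ n)"
proof -
  have "(\<Sum>\<sigma>\<in>level_words m k n. \<integral>\<^sup>+\<omega>. alive \<sigma> \<omega> \<partial>P) = (\<Sum>\<sigma>\<in>level_words m k n. ennreal (p ^ n))"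
    by (intro sum.cong refl) (auto simp: nn_integral_alive)
  also have "\<dots> = ennreal (\<Sum>\<sigma>\<in>level_words m k n. p ^ n)" using p0 by (intro sum_ennreal) simp
  also have "(\<Sum>\<sigma>\<in>level_words m k n. p ^ n) = growth ^ n"
    by (simp add: growth_def power_mult_distrib)
  finally show ?thesis .
qed

lemma pred_all_level_words:
  assumes "\<And>\<tau>. \<tau> \<in> words m k \<Longrightarrow> Measurable.pred (Omega m k) (Q \<tau>)"
  shows "Measurable.pred (Omega m k) (\<lambda>\<omega>. \<forall>\<tau>\<in>level_words m k n - B. Q \<tau> \<omega>)"
  using assms by (intro pred_intros_finite finite_subset[OF Diff_subset finite_level_words]) auto

text \<open>The weight \<open>1/2\<close> on the good blocks has a step mean less than 1, so the product \<open>2 ^ (- K)\<close> over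
  the \<open>K\<close> good blocks among the first \<open>N\<close> decays exponentially in \<open>N\<close>.\<close>

theorem AE_spine_frequency:
  assumes G: "\<And>\<sigma>. \<sigma> \<in> level_words m k n \<Longrightarrow> Measurable.pred (Omega m k) (G \<sigma>)"
    and dG: "\<And>\<sigma>. \<sigma> \<in> level_words m k n \<Longrightarrow> determined_by (Omega m k) (outside \<sigma>) (G \<sigma>)"
    and s0: "\<rho> \<in> level_words m k n" and pos: "0 < prob {\<omega> \<in> space P. \<omega> \<rho> = Chosen \<and> G \<rho> \<omega>}"
  shows "\<exists>c>0. AE_spine C (\<lambda>\<omega> \<eta>. density_ge c (\<lambda>b. G (seq_block n b \<eta>) (sub (seq_prefix \<eta> (b * n)) \<omega>)))"
proof -
  define h where "h \<sigma> \<omega> = (if G \<sigma> \<omega> then ennreal (1/2) else 1)" for \<sigma> \<omega>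
  define q where "q = prob {\<omega> \<in> space P. \<omega> \<rho> = Chosen \<and> G \<rho> \<omega>}"
  have hm: "h \<sigma> \<in> borel_measurable (Omega m k)" if "\<sigma> \<in> level_words m k n" for \<sigma>
    unfolding h_def[abs_def] using G[OF that] by measurable
  have bw: "block_weight n h"
    unfolding block_weight_def
  proof (intro ballI conjI)
    fix \<sigma> assume s: "\<sigma> \<in> level_words m k n"
    show "h \<sigma> \<in> borel_measurable (Omega m k)" by (rule hm[OF s])
    show "determined_by (Omega m k) (outside \<sigma>) (h \<sigma>)"
      unfolding h_def[abs_def] by (rule determined_by_comp[OF dG[OF s]])
  qed
  let ?s = "\<lambda>\<sigma>. \<integral>\<^sup>+\<omega>. alive \<sigma> \<omega> * h \<sigma> \<omega> \<partial>P" and ?t = "\<lambda>\<sigma>. \<integral>\<^sup>+\<omega>. alive \<sigma> \<omega> \<partial>P"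
  have le: "?s \<sigma> \<le> ?t \<sigma>" for \<sigma>
    unfolding h_def using ennreal_leI[of "1/2" 1] by (intro nn_integral_mono) auto
  have gap: "?s \<rho> + ennreal (q / 2) = ?t \<rho>"
  proof -
    have [measurable]: "\<rho> \<in> words m k" "h \<rho> \<in> borel_measurable (Omega m k)" "Measurable.pred (Omega m k) (G \<rho>)"
      using s0 hm[OF s0] G[OF s0] by simp_all
    have "ennreal (q / 2) = ennreal (1/2) * emeasure P {\<omega> \<in> space P. \<omega> \<rho> = Chosen \<and> G \<rho> \<omega>}"
      unfolding q_def emeasure_eq_measure by (subst ennreal_mult[symmetric]) auto
    also have "\<dots> = (\<integral>\<^sup>+\<omega>. ennreal (1/2) * indicator {\<omega> \<in> space P. \<omega> \<rho> = Chosen \<and> G \<rho> \<omega>} \<omega> \<partial>P)"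
      by (rule nn_integral_cmult_indicator[symmetric]) measurable
    finally have "?s \<rho> + ennreal (q / 2) = (\<integral>\<^sup>+\<omega>. alive \<rho> \<omega> * h \<rho> \<omega> + ennreal (1/2) * indicator {\<omega> \<in> space P. \<omega> \<rho> = Chosen \<and> G \<rho> \<omega>} \<omega> \<partial>P)"
      by (subst nn_integral_add) auto
    also have "\<dots> = ?t \<rho>"
    proof -
      have "ennreal (1/2) + ennreal (1/2) = 1" by (subst ennreal_plus[symmetric]) auto
      then have "inverse 2 + inverse 2 = (1 :: ennreal)" by simp
      then show ?thesis by (intro nn_integral_cong) (auto simp: h_def)
    qed
    finally show ?thesis .
  qed
  define S where "S = (\<Sum>\<sigma>\<in>level_words m k n. ?s \<sigma>)"
  have "S + ennreal (q / 2) = ?s \<rho> + ennreal (q / 2) + (\<Sum>\<sigma>\<in>level_words m k n - {\<rho>}. ?s \<sigma>)"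
    unfolding S_def using s0 by (subst sum.remove[of _ \<rho>]) (auto simp: add_ac)
  also have "\<dots> \<le> ?t \<rho> + (\<Sum>\<sigma>\<in>level_words m k n - {\<rho>}. ?t \<sigma>)"
    unfolding gap by (intro add_left_mono sum_mono le)
  also have "\<dots> = (\<Sum>\<sigma>\<in>level_words m k n. ?t \<sigma>)"
    using s0 by (subst sum.remove[of _ \<rho> ?t]) auto
  finally have S_le: "S + ennreal (q / 2) \<le> ennreal (growth ^ n)" unfolding sum_nn_integral_alive .
  then obtain s where s: "0 \<le> s" "S = ennreal s" by (cases S) (auto simp: top_unique)
  have "s + q / 2 \<le> growth ^ n"
    using S_le s pos by (simp add: q_def ennreal_plus[symmetric] del: ennreal_plus)
  then have slt: "s < growth ^ n" using pos by (simp add: q_def)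
  define H where "H = s / growth ^ n"
  have H: "0 \<le> H" "H < 1" "step_mean n h = ennreal H"
    using s slt unfolding H_def step_mean_def S_def[symmetric] by (auto simp: ennreal_mult[symmetric])
  define \<theta> where "\<theta> = (1 + H) / 2"
  have \<theta>: "0 < \<theta>" "\<theta> < 1" "H < \<theta>" using H by (auto simp: \<theta>_def)
  define c where "c = ln (1 / \<theta>) / ln 2"
  have c: "0 < c" using \<theta> unfolding c_def by (intro divide_pos_pos) auto
  have "AE_spine C (\<lambda>\<omega> \<eta>. \<forall>\<^sub>F N in sequentially.
      (\<Prod>b<N. h (seq_block n b \<eta>) (sub (seq_prefix \<eta> (b * n)) \<omega>)) * 1 \<le> ennreal (\<theta> ^ N))"
    unfolding AE_spine_def
    using H \<theta> by (intro AE_spine_product_bound[OF bw]) (auto simp: nn_integral_limit_size ennreal_less_iff)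
  then have "AE_spine C (\<lambda>\<omega> \<eta>. density_ge c (\<lambda>b. G (seq_block n b \<eta>) (sub (seq_prefix \<eta> (b * n)) \<omega>)))"
  proof (rule AE_spine_mp)
    fix \<omega> \<eta>
    assume "\<forall>\<^sub>F N in sequentially. (\<Prod>b<N. h (seq_block n b \<eta>) (sub (seq_prefix \<eta> (b * n)) \<omega>)) * 1 \<le> ennreal (\<theta> ^ N)"
    then show "density_ge c (\<lambda>b. G (seq_block n b \<eta>) (sub (seq_prefix \<eta> (b * n)) \<omega>))"
      unfolding density_ge_def
    proof eventually_elim
      case (elim N)
      let ?G = "\<lambda>b. G (seq_block n b \<eta>) (sub (seq_prefix \<eta> (b * n)) \<omega>)"
      define K where "K = card {b \<in> {..<N}. ?G b}"
      have "(\<Prod>b<N. h (seq_block n b \<eta>) (sub (seq_prefix \<eta> (b * n)) \<omega>)) = ennreal (1/2) ^ K"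
        unfolding h_def K_def by (simp add: prod.If_cases Int_def)
      then have "ennreal ((1/2) ^ K) \<le> ennreal (\<theta> ^ N)" using elim by (simp only: mult_1_right) (subst ennreal_power[symmetric], auto)
      then have "(1/2) ^ K \<le> \<theta> ^ N" using \<theta>(1) by (simp only: ennreal_le_iff zero_le_power less_imp_le)
      then have "ln ((1/2) ^ K) \<le> ln (\<theta> ^ N)" using \<theta>(1) by (subst ln_le_cancel_iff) auto
      then have "real N * ln (1 / \<theta>) \<le> real K * ln 2" using \<theta>(1) by (simp add: ln_realpow ln_div)
      then show ?case unfolding K_def[symmetric] by (simp add: c_def field_simps)
    qed
  qed
  with c show ?thesis by blast
qed

lemma regular_sum_level:
  assumes reg: "regular \<omega>" and s: "\<sigma> \<in> words m k"
  shows "growth ^ n * limit_size (sub \<sigma> \<omega>) = (\<Sum>\<tau>\<in>level_words m k n. limit_size (sub (\<sigma> @ \<tau>) \<omega>))"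
  using s
proof (induction n arbitrary: \<sigma>)
  case 0
  have "level_words m k 0 = {[]}" by auto
  then show ?case by simp
next
  case (Suc n)
  have "growth ^ Suc n * limit_size (sub \<sigma> \<omega>) = growth ^ n * (\<Sum>i\<in>alphabet m k. limit_size (sub (\<sigma> @ [i]) \<omega>))"
    using regular_sum[OF reg Suc.prems] by simp
  also have "\<dots> = (\<Sum>i\<in>alphabet m k. growth ^ n * limit_size (sub (\<sigma> @ [i]) \<omega>))" by (rule sum_distrib_left)
  also have "\<dots> = (\<Sum>i\<in>alphabet m k. \<Sum>\<tau>\<in>level_words m k n. limit_size (sub ((\<sigma> @ [i]) @ \<tau>) \<omega>))"
    using Suc.prems by (intro sum.cong refl Suc.IH) simp
  also have "\<dots> = (\<Sum>\<tau>\<in>level_words m k (Suc n). limit_size (sub (\<sigma> @ \<tau>) \<omega>))"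
    unfolding sum_level_words_Suc by simp
  finally show ?case .
qed

lemma nn_integral_limit_size_sub:
  assumes s: "\<sigma> \<in> words m k"
  shows "(\<integral>\<^sup>+\<omega>. ennreal (limit_size (sub \<sigma> \<omega>)) \<partial>P) = ennreal (p ^ length \<sigma>)"
proof -
  have "(\<integral>\<^sup>+\<omega>. ennreal (limit_size (sub \<sigma> \<omega>)) \<partial>P) = (\<integral>\<^sup>+\<omega>. alive \<sigma> \<omega> * 1 * ennreal (limit_size (sub \<sigma> \<omega>)) \<partial>P)"
  proof (rule nn_integral_cong_AE)
    show "AE \<omega> in P. ennreal (limit_size (sub \<sigma> \<omega>)) = alive \<sigma> \<omega> * 1 * ennreal (limit_size (sub \<sigma> \<omega>))"
      using AE_regular by eventually_elim (simp add: regular_neglected s)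
  qed
  also have "\<dots> = (\<integral>\<^sup>+\<omega>. alive \<sigma> \<omega> * 1 \<partial>P) * (\<integral>\<^sup>+\<omega>. ennreal (limit_size \<omega>) \<partial>P)"
    by (rule branching[OF s]) (auto intro!: determined_byI)
  finally show ?thesis by (simp add: nn_integral_limit_size nn_integral_alive[OF s])
qed

lemma sub_eqI: "(\<And>\<tau>. \<tau> \<in> words m k \<Longrightarrow> x (\<sigma> @ \<tau>) = y (\<sigma> @ \<tau>)) \<Longrightarrow> sub \<sigma> x = sub \<sigma> y"
  by (auto simp: subtree_def)

lemma determined_by_sub_sibling:
  assumes "\<sigma> \<in> level_words m k n" "\<tau> \<in> level_words m k n" "\<tau> \<noteq> \<sigma>"
    "x \<in> space (Omega m k)" "y \<in> space (Omega m k)"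
    "\<And>\<rho>. \<rho> \<in> outside \<sigma> \<Longrightarrow> x \<rho> = y \<rho>"
  shows "sub \<tau> x = sub \<tau> y"
proof (rule sub_eqI)
  fix \<rho> assume r: "\<rho> \<in> words m k"
  have "\<not> prefix \<sigma> (\<tau> @ \<rho>)"
  proof
    assume "prefix \<sigma> (\<tau> @ \<rho>)"
    then obtain zs where "\<tau> @ \<rho> = \<sigma> @ zs" by (rule prefixE)
    moreover have "length \<tau> = length \<sigma>" using assms(1,2) by simp
    ultimately show False using assms(3) by simp
  qed
  then show "x (\<tau> @ \<rho>) = y (\<tau> @ \<rho>)" using r assms(2) by (intro assms(6)) (auto simp: strict_prefix_def)
qed

text \<open>The mass that leaves the ray within a block.\<close>

definition sibling_mass :: "nat \<Rightarrow> nat list \<Rightarrow> (nat list \<Rightarrow> status) \<Rightarrow> ennreal" where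
  "sibling_mass n \<sigma> \<omega> = (\<Sum>\<tau>\<in>level_words m k n - {\<sigma>}. ennreal (limit_size (sub \<tau> \<omega>)))"

lemma measurable_sibling_mass: "sibling_mass n \<sigma> \<in> borel_measurable (Omega m k)"
  unfolding sibling_mass_def[abs_def]
proof (rule borel_measurable_sum)
  fix \<tau> assume "\<tau> \<in> level_words m k n - {\<sigma>}"
  then have [measurable]: "\<tau> \<in> words m k" by simp
  show "(\<lambda>\<omega>. ennreal (limit_size (sub \<tau> \<omega>))) \<in> borel_measurable (Omega m k)" by measurable
qed

lemma determined_by_sibling_mass:
  assumes "\<sigma> \<in> level_words m k n"
  shows "determined_by (Omega m k) (outside \<sigma>) (sibling_mass n \<sigma>)"
proof (rule determined_byI)
  fix x y assume xy: "x \<in> space (Omega m k)" "y \<in> space (Omega m k)"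
    "\<And>\<tau>. \<tau> \<in> outside \<sigma> \<Longrightarrow> x \<tau> = y \<tau>"
  have "sub \<tau> x = sub \<tau> y" if "\<tau> \<in> level_words m k n - {\<sigma>}" for \<tau>
    using that by (intro determined_by_sub_sibling[OF assms _ _ xy]) auto
  then show "sibling_mass n \<sigma> x = sibling_mass n \<sigma> y"
    unfolding sibling_mass_def by (intro sum.cong refl) simp
qed

text \<open>Dropping the condition that the block itself is chosen leaves the mean of the total mass after
  \<open>n\<close> generations, which is \<open>growth ^ n\<close>.\<close>

lemma step_mean_sibling_mass:
  assumes "0 < M"
  shows "step_mean n (\<lambda>\<sigma> \<omega>. 1 + ennreal (1 / M) * sibling_mass n \<sigma> \<omega>) \<le> ennreal (1 + (real k ^ m) ^ n / M)"
proof -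
  let ?L = "level_words m k n"
  have one: "(\<integral>\<^sup>+\<omega>. alive \<sigma> \<omega> * (1 + ennreal (1 / M) * sibling_mass n \<sigma> \<omega>) \<partial>P)
      \<le> (\<integral>\<^sup>+\<omega>. alive \<sigma> \<omega> \<partial>P) + ennreal (1 / M * growth ^ n)" if s: "\<sigma> \<in> ?L" for \<sigma>
  proof -
    have [measurable]: "\<sigma> \<in> words m k" "sibling_mass n \<sigma> \<in> borel_measurable (Omega m k)"
      using s measurable_sibling_mass by auto
    have "(\<integral>\<^sup>+\<omega>. alive \<sigma> \<omega> * (1 + ennreal (1 / M) * sibling_mass n \<sigma> \<omega>) \<partial>P)
        \<le> (\<integral>\<^sup>+\<omega>. alive \<sigma> \<omega> + ennreal (1 / M) * sibling_mass n \<sigma> \<omega> \<partial>P)"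
      by (intro nn_integral_mono) auto
    also have "\<dots> = (\<integral>\<^sup>+\<omega>. alive \<sigma> \<omega> \<partial>P) + ennreal (1 / M) * (\<integral>\<^sup>+\<omega>. sibling_mass n \<sigma> \<omega> \<partial>P)"
      by (simp add: nn_integral_add nn_integral_cmult)
    also have "(\<integral>\<^sup>+\<omega>. sibling_mass n \<sigma> \<omega> \<partial>P) = (\<Sum>\<tau>\<in>?L - {\<sigma>}. \<integral>\<^sup>+\<omega>. ennreal (limit_size (sub \<tau> \<omega>)) \<partial>P)"
      unfolding sibling_mass_def
    proof (rule nn_integral_sum)
      fix \<tau> assume "\<tau> \<in> ?L - {\<sigma>}"
      then have [measurable]: "\<tau> \<in> words m k" by simp
      show "(\<lambda>\<omega>. ennreal (limit_size (sub \<tau> \<omega>))) \<in> borel_measurable P" by measurable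
    qed
    also have "\<dots> \<le> (\<Sum>\<tau>\<in>?L. \<integral>\<^sup>+\<omega>. ennreal (limit_size (sub \<tau> \<omega>)) \<partial>P)"
      by (intro sum_mono2) auto
    also have "\<dots> = (\<Sum>\<tau>\<in>?L. \<integral>\<^sup>+\<omega>. alive \<tau> \<omega> \<partial>P)"
      by (intro sum.cong refl) (simp add: nn_integral_limit_size_sub nn_integral_alive del: in_lists_conv_set)
    also have "\<dots> = ennreal (growth ^ n)" by (rule sum_nn_integral_alive)
    also have "ennreal (1 / M) * ennreal (growth ^ n) = ennreal (1 / M * growth ^ n)"
      using assms by (intro ennreal_mult[symmetric]) auto
    finally show ?thesis by (simp add: mult_left_mono add_left_mono)
  qed
  have "(\<Sum>\<sigma>\<in>?L. \<integral>\<^sup>+\<omega>. alive \<sigma> \<omega> * (1 + ennreal (1 / M) * sibling_mass n \<sigma> \<omega>) \<partial>P)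
     \<le> (\<Sum>\<sigma>\<in>?L. (\<integral>\<^sup>+\<omega>. alive \<sigma> \<omega> \<partial>P) + ennreal (1 / M * growth ^ n))"
    by (intro sum_mono one)
  also have "\<dots> = ennreal (growth ^ n) + ennreal (\<Sum>\<sigma>\<in>?L. 1 / M * growth ^ n)"
    using assms by (subst sum_ennreal[symmetric]) (auto simp: sum.distrib sum_nn_integral_alive simp del: sum_constant)
  also have "\<dots> = ennreal (growth ^ n + (real k ^ m) ^ n * (1 / M * growth ^ n))"
    using assms by (simp add: ennreal_plus[symmetric] del: ennreal_plus)
  finally have "step_mean n (\<lambda>\<sigma> \<omega>. 1 + ennreal (1 / M) * sibling_mass n \<sigma> \<omega>)
      \<le> ennreal (1 / growth ^ n) * ennreal (growth ^ n + (real k ^ m) ^ n * (1 / M * growth ^ n))"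
    unfolding step_mean_def by (intro mult_left_mono) auto
  also have "\<dots> = ennreal (1 / growth ^ n * (growth ^ n + (real k ^ m) ^ n * (1 / M * growth ^ n)))"
    using assms by (intro ennreal_mult[symmetric]) auto
  also have "1 / growth ^ n * (growth ^ n + (real k ^ m) ^ n * (1 / M * growth ^ n)) = 1 + (real k ^ m) ^ n / M"
    by (simp add: field_simps)
  finally show ?thesis .
qed

lemma seq_prefix_block: "seq_prefix \<eta> (Suc b * n) = seq_prefix \<eta> (b * n) @ seq_block n b \<eta>"
proof -
  have "[0..<Suc b * n] = [0..<b * n] @ [b * n..<b * n + n]"
    using upt_add_eq_append[of 0 "b * n" n] by (simp add: add.commute)
  then show ?thesis by (simp only: map_append)
qed

text \<open>Let \<open>X b\<close> and \<open>S b\<close> be the masses on and off the ray at block \<open>b\<close>. If \<open>X b > M\<close>, then either \<open>S b\<close> is small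
  and \<open>X\<close> grows by the factor \<open>\<beta> > 1\<close>, or \<open>S b\<close> is so large that the weight \<open>1 + S b / M0\<close> compensates for a
  drop of \<open>max 1 (X / M)\<close> to 1 and for another factor \<open>\<beta>\<close>. So \<open>\<beta>\<close> to the number of blocks with \<open>X b > M\<close> is
  at most the product of the weights times the final value of \<open>max 1 (X / M)\<close>. Finiteness of the mean of
  the latter along the ray is the second moment bound.\<close>

theorem AE_spine_mass_mostly_bounded:
  assumes n: "0 < n" and c: "0 < c"
  shows "\<exists>M>0. AE_spine C (\<lambda>\<omega> \<eta>. \<forall>\<^sub>F N in sequentially.
    real (card {b \<in> {..<N}. M < limit_size (sub (seq_prefix \<eta> (b * n)) \<omega>)}) \<le> c * real N)"
proof -
  define A where "A = growth ^ n"
  have A: "1 < A" using growth_gt_1 n by (simp add: A_def one_less_power)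
  define \<beta> where "\<beta> = (A + 1) / 2"
  have \<beta>: "1 < \<beta>" using A by (simp add: \<beta>_def)
  \<comment> \<open>The bound \<open>\<beta> ^ K \<le> \<theta> ^ N\<close> will mean \<open>K \<le> c * N\<close>, and \<open>M0\<close> makes the step mean less than \<open>\<theta>\<close>.\<close>
  define \<theta> where "\<theta> = \<beta> powr c"
  have \<theta>: "1 < \<theta>" using \<beta> c by (simp add: \<theta>_def)
  define M0 where "M0 = 2 * (real k ^ m) ^ n / (\<theta> - 1)"
  have km: "0 < (real k ^ m) ^ n" using k2 by simp
  have M0: "0 < M0" using \<theta> km unfolding M0_def by (intro divide_pos_pos) auto
  \<comment> \<open>The condition \<open>S > (A - 1) / 2 * X\<close> then says \<open>S / M0 > \<beta> * (X / M)\<close>.\<close>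
  define M where "M = 2 * \<beta> * M0 / (A - 1)"
  have M: "0 < M" using A \<beta> M0 unfolding M_def by (intro divide_pos_pos) auto
  define h where "h = (\<lambda>\<sigma> \<omega>. 1 + ennreal (1 / M0) * sibling_mass n \<sigma> \<omega>)"
  define V where "V = (\<lambda>\<omega>. max 1 (limit_size \<omega> / M))"
  have [measurable]: "V \<in> borel_measurable (Omega m k)" unfolding V_def by measurable
  have bw: "block_weight n h"
    unfolding block_weight_def
  proof (intro ballI conjI)
    fix \<sigma> assume s: "\<sigma> \<in> level_words m k n"
    have [measurable]: "sibling_mass n \<sigma> \<in> borel_measurable (Omega m k)" by (rule measurable_sibling_mass)
    show "h \<sigma> \<in> borel_measurable (Omega m k)" unfolding h_def by measurable
    show "determined_by (Omega m k) (outside \<sigma>) (h \<sigma>)"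
      unfolding h_def by (rule determined_by_comp[OF determined_by_sibling_mass[OF s]])
  qed
  have "step_mean n h \<le> ennreal (1 + (real k ^ m) ^ n / M0)"
    unfolding h_def by (rule step_mean_sibling_mass[OF M0])
  also have "(real k ^ m) ^ n / M0 = (\<theta> - 1) / 2" using km \<theta> k2 by (simp add: M0_def)
  also have "ennreal (1 + (\<theta> - 1) / 2) < ennreal \<theta>" using \<theta> by (intro ennreal_lessI) (auto simp: field_simps)
  finally have step: "step_mean n h < ennreal \<theta>" .
  have fint: "(\<integral>\<^sup>+\<omega>. ennreal (limit_size \<omega>) * ennreal (V \<omega>) \<partial>P) < \<infinity>"
  proof -
    have "(\<integral>\<^sup>+\<omega>. ennreal (limit_size \<omega>) * ennreal (V \<omega>) \<partial>P)
       \<le> (\<integral>\<^sup>+\<omega>. ennreal (limit_size \<omega>) + ennreal (1 / M) * ennreal ((limit_size \<omega>)\<^sup>2) \<partial>P)"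
    proof (intro nn_integral_mono_AE)
      show "AE \<omega> in P. ennreal (limit_size \<omega>) * ennreal (V \<omega>) \<le> ennreal (limit_size \<omega>) + ennreal (1 / M) * ennreal ((limit_size \<omega>)\<^sup>2)"
        using AE_limit_size_nonneg
      proof eventually_elim
        case (elim \<omega>)
        have "V \<omega> \<le> 1 + limit_size \<omega> / M" using elim M by (simp add: V_def)
        then have "limit_size \<omega> * V \<omega> \<le> limit_size \<omega> * (1 + limit_size \<omega> / M)"
          using elim by (rule mult_left_mono)
        also have "\<dots> = limit_size \<omega> + 1 / M * (limit_size \<omega>)\<^sup>2" by (simp add: field_simps power2_eq_square)
        finally show ?case
          using elim M by (simp add: V_def ennreal_mult[symmetric] ennreal_plus[symmetric] ennreal_leI del: ennreal_plus)
      qed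
    qed
    also have "\<dots> = 1 + ennreal (1 / M) * (\<integral>\<^sup>+\<omega>. ennreal ((limit_size \<omega>)\<^sup>2) \<partial>P)"
      by (simp add: nn_integral_add nn_integral_cmult nn_integral_limit_size)
    also have "\<dots> < \<infinity>" using nn_integral_limit_size_square by (simp add: ennreal_mult_less_top less_top)
    finally show ?thesis .
  qed
  have bound: "AE_spine C (\<lambda>\<omega> \<eta>. \<forall>\<^sub>F N in sequentially.
      (\<Prod>b<N. h (seq_block n b \<eta>) (sub (seq_prefix \<eta> (b * n)) \<omega>)) * ennreal (V (sub (seq_prefix \<eta> (N * n)) \<omega>)) \<le> ennreal (\<theta> ^ N))"
    unfolding AE_spine_def using \<theta> step fint by (intro AE_spine_product_bound[OF bw]) auto
  have "AE_spine C (\<lambda>\<omega> \<eta>. \<forall>\<^sub>F N in sequentially.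
    real (card {b \<in> {..<N}. M < limit_size (sub (seq_prefix \<eta> (b * n)) \<omega>)}) \<le> c * real N)"
    using AE_spine_conj[OF bound AE_spine_regular]
  proof (rule AE_spine_mp, elim conjE)
    fix \<omega> \<eta>
    assume reg: "regular \<omega>" and e: "\<eta> \<in> space (seq_space m k)"
      and ev: "\<forall>\<^sub>F N in sequentially. (\<Prod>b<N. h (seq_block n b \<eta>) (sub (seq_prefix \<eta> (b * n)) \<omega>)) * ennreal (V (sub (seq_prefix \<eta> (N * n)) \<omega>)) \<le> ennreal (\<theta> ^ N)"
    define X where "X b = limit_size (sub (seq_prefix \<eta> (b * n)) \<omega>)" for b
    define S where "S b = (\<Sum>\<tau>\<in>level_words m k n - {seq_block n b \<eta>}. limit_size (sub (seq_prefix \<eta> (b * n) @ \<tau>) \<omega>))" for b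
    define K where "K N = card {b \<in> {..<N}. M < X b}" for N
    have pw: "seq_prefix \<eta> j \<in> words m k" for j using seq_prefix_in_words[OF e, of j] by simp
    have bwd: "seq_block n b \<eta> \<in> level_words m k n" for b using e by (auto simp: space_seq_space Pi_iff)
    have X0: "0 \<le> X b" for b unfolding X_def by (rule regular_nonneg[OF reg pw])
    have Xt0: "0 \<le> limit_size (sub (seq_prefix \<eta> (b * n) @ \<tau>) \<omega>)" if "\<tau> \<in> level_words m k n" for b \<tau>
      using pw[of "b * n"] that by (intro regular_nonneg[OF reg]) simp
    have S0: "0 \<le> S b" for b unfolding S_def using Xt0 by (intro sum_nonneg) blast
    have rec: "A * X b = X (Suc b) + S b" for b
      unfolding A_def X_def S_def regular_sum_level[OF reg pw] seq_prefix_block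
      using bwd by (intro sum.remove) auto
    have hS: "h (seq_block n b \<eta>) (sub (seq_prefix \<eta> (b * n)) \<omega>) = ennreal (1 + S b / M0)" for b
    proof -
      have "sibling_mass n (seq_block n b \<eta>) (sub (seq_prefix \<eta> (b * n)) \<omega>)
         = (\<Sum>\<tau>\<in>level_words m k n - {seq_block n b \<eta>}. ennreal (limit_size (sub (seq_prefix \<eta> (b * n) @ \<tau>) \<omega>)))"
        unfolding sibling_mass_def by (intro sum.cong refl) (simp add: subtree_subtree del: in_lists_conv_set)
      also have "\<dots> = ennreal (S b)" unfolding S_def using Xt0 by (intro sum_ennreal) blast
      finally show ?thesis using S0[of b] M0 by (simp add: h_def ennreal_mult[symmetric])
    qed
    have key: "\<beta> ^ K N \<le> (\<Prod>b<N. 1 + S b / M0) * max 1 (X N / M)" for N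
    proof (induction N)
      case (Suc N)
      have P0: "0 \<le> (\<Prod>b<N. 1 + S b / M0)" using S0 M0 by (intro prod_nonneg) (simp add: add_nonneg_nonneg)
      have SN: "1 \<le> 1 + S N / M0" using S0[of N] M0 by simp
      have main: "(if M < X N then \<beta> else 1) * max 1 (X N / M) \<le> (1 + S N / M0) * max 1 (X (Suc N) / M)"
      proof (cases "M < X N")
        case True
        then have V1: "max 1 (X N / M) = X N / M" using M by (simp add: max_def)
        show ?thesis
        proof (cases "S N \<le> (A - 1) / 2 * X N")
          case True
          then have "\<beta> * X N \<le> X (Suc N)" using rec[of N] by (simp add: \<beta>_def field_simps)
          then have "\<beta> * (X N / M) \<le> X (Suc N) / M" using M by (simp add: field_simps)
          also have "\<dots> \<le> max 1 (X (Suc N) / M)" by simp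
          also have "\<dots> \<le> (1 + S N / M0) * max 1 (X (Suc N) / M)"
            using mult_right_mono[OF SN, of "max 1 (X (Suc N) / M)"] by simp
          finally show ?thesis using V1 \<open>M < X N\<close> by simp
        next
          case False
          have "\<beta> * (X N / M) = (A - 1) / 2 * X N / M0" using A M0 \<beta> by (simp add: M_def field_simps)
          also have "\<dots> \<le> S N / M0" using False M0 by (intro divide_right_mono) auto
          also have "\<dots> \<le> (1 + S N / M0) * 1" by simp
          also have "\<dots> \<le> (1 + S N / M0) * max 1 (X (Suc N) / M)"
            using SN by (intro mult_left_mono) auto
          finally show ?thesis using V1 \<open>M < X N\<close> by simp
        qed
      next
        case False
        then have "max 1 (X N / M) = 1" using M by (simp add: max_def field_simps)
        moreover have "1 * 1 \<le> (1 + S N / M0) * max 1 (X (Suc N) / M)" using SN by (intro mult_mono) auto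
        ultimately show ?thesis using False by simp
      qed
      have "{b \<in> {..<Suc N}. M < X b} = (if M < X N then insert N {b \<in> {..<N}. M < X b} else {b \<in> {..<N}. M < X b})"
        by (auto simp: less_Suc_eq)
      then have "\<beta> ^ K (Suc N) = (if M < X N then \<beta> else 1) * \<beta> ^ K N"
        by (simp add: K_def)
      also have "\<dots> \<le> (if M < X N then \<beta> else 1) * ((\<Prod>b<N. 1 + S b / M0) * max 1 (X N / M))"
        using Suc \<beta> by (intro mult_left_mono) auto
      also have "\<dots> = (\<Prod>b<N. 1 + S b / M0) * ((if M < X N then \<beta> else 1) * max 1 (X N / M))" by (simp only: mult_ac)
      also have "\<dots> \<le> (\<Prod>b<N. 1 + S b / M0) * ((1 + S N / M0) * max 1 (X (Suc N) / M))"
        by (intro mult_left_mono main P0)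
      finally show ?case by (simp only: prod.lessThan_Suc mult_ac)
    qed (simp add: K_def)
    from ev show "\<forall>\<^sub>F N in sequentially. real (card {b \<in> {..<N}. M < limit_size (sub (seq_prefix \<eta> (b * n)) \<omega>)}) \<le> c * real N"
    proof eventually_elim
      case (elim N)
      have "(\<Prod>b<N. ennreal (1 + S b / M0)) = ennreal (\<Prod>b<N. 1 + S b / M0)"
        using S0 M0 by (intro prod_ennreal) (simp add: add_nonneg_nonneg)
      then have "ennreal ((\<Prod>b<N. 1 + S b / M0) * max 1 (X N / M)) \<le> ennreal (\<theta> ^ N)"
        using elim unfolding hS V_def X_def[symmetric] by (simp add: ennreal_mult'')
      then have "(\<Prod>b<N. 1 + S b / M0) * max 1 (X N / M) \<le> \<theta> ^ N" using \<theta> by (subst (asm) ennreal_le_iff) auto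
      with key[of N] have "\<beta> ^ K N \<le> \<theta> ^ N" by linarith
      then have "\<beta> powr real (K N) \<le> \<beta> powr (c * real N)"
        using \<beta> by (simp add: powr_realpow \<theta>_def powr_powr[symmetric] powr_gt_zero)
      then have "real (K N) \<le> c * real N" using \<beta> by (simp add: powr_le_cancel_iff)
      then show ?case by (simp add: K_def X_def)
    qed
  qed
  with M show ?thesis by blast
qed

section \<open>Local configurations of positive probability\<close>

lemma child_prob_nonneg: "0 \<le> child_prob p a b"
  using p0 p1 by (cases a; cases b) auto

lemma measure_agree_upto_pos:
  assumes "\<eta> [] = Chosen"
    and "\<And>\<sigma> j. \<sigma> \<in> words m k \<Longrightarrow> j \<in> alphabet m k \<Longrightarrow> child_prob p (\<eta> \<sigma>) (\<eta> (\<sigma> @ [j])) \<noteq> 0"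
  shows "0 < measure P (agree_upto m k \<eta> n)"
proof (induction n)
  case 0
  then show ?case using assms(1) by (simp add: measure_agree_upto_0)
next
  case (Suc n)
  have "0 < (\<Prod>\<sigma>\<in>level_words m k n. \<Prod>j\<in>alphabet m k. child_prob p (\<eta> \<sigma>) (\<eta> (\<sigma> @ [j])))"
  proof (intro prod_pos ballI)
    fix \<sigma> j assume "\<sigma> \<in> level_words m k n" "j \<in> alphabet m k"
    then show "0 < child_prob p (\<eta> \<sigma>) (\<eta> (\<sigma> @ [j]))"
      using assms(2)[of \<sigma> j] child_prob_nonneg[of "\<eta> \<sigma>" "\<eta> (\<sigma> @ [j])"] by simp
  qed
  then show ?case unfolding measure_agree_upto_Suc using Suc by (rule mult_pos_pos[rotated])
qed

lemma nn_integral_event: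
  assumes "{\<omega> \<in> space P. Q \<omega>} \<in> sets P"
  shows "(\<integral>\<^sup>+\<omega>. (if Q \<omega> then 1 else 0) \<partial>P) = ennreal (prob {\<omega> \<in> space P. Q \<omega>})"
proof -
  have "(\<integral>\<^sup>+\<omega>. (if Q \<omega> then 1 else 0) \<partial>P) = (\<integral>\<^sup>+\<omega>. indicator {\<omega> \<in> space P. Q \<omega>} \<omega> \<partial>P)"
    by (intro nn_integral_cong) (auto simp: indicator_def)
  also have "\<dots> = emeasure P {\<omega> \<in> space P. Q \<omega>}" using assms by (rule nn_integral_indicator)
  finally show ?thesis by (simp only: emeasure_eq_measure)
qed

text \<open>The limit size has mean 1.\<close>

lemma limit_size_positive: "\<exists>\<delta>>0. 0 < prob {\<omega> \<in> space P. \<delta> \<le> limit_size \<omega>}"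
proof (rule ccontr)
  assume contra: "\<not> (\<exists>\<delta>>0. 0 < prob {\<omega> \<in> space P. \<delta> \<le> limit_size \<omega>})"
  have z: "prob {\<omega> \<in> space P. \<delta> \<le> limit_size \<omega>} = 0" if "0 < \<delta>" for \<delta>
  proof -
    have "\<not> 0 < prob {\<omega> \<in> space P. \<delta> \<le> limit_size \<omega>}" using contra that by blast
    then show ?thesis using measure_nonneg[of P "{\<omega> \<in> space P. \<delta> \<le> limit_size \<omega>}"] by linarith
  qed
  have "AE \<omega> in P. \<not> 1 / real (Suc n) \<le> limit_size \<omega>" for n
  proof (subst prob_Collect_eq_0[symmetric])
    show "{\<omega> \<in> space P. 1 / real (Suc n) \<le> limit_size \<omega>} \<in> sets P" by measurable
    show "prob {\<omega> \<in> space P. 1 / real (Suc n) \<le> limit_size \<omega>} = 0" by (rule z) simp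
  qed
  then have "AE \<omega> in P. \<forall>n. \<not> 1 / real (Suc n) \<le> limit_size \<omega>" by (simp add: AE_all_countable)
  then have "AE \<omega> in P. limit_size \<omega> \<le> 0"
  proof eventually_elim
    case (elim \<omega>)
    show ?case
    proof (rule ccontr)
      assume "\<not> limit_size \<omega> \<le> 0"
      then obtain n where "inverse (real (Suc n)) < limit_size \<omega>"
        using reals_Archimedean[of "limit_size \<omega>"] by auto
      then show False using elim by (auto simp: inverse_eq_divide dest: spec[of _ n])
    qed
  qed
  then have "(\<integral>\<omega>. limit_size \<omega> \<partial>P) \<le> (\<integral>\<omega>. 0 \<partial>P)"
    by (intro integral_mono_AE expectation_limit_size(1)) auto
  then show False using expectation_limit_size(2) by simp
qed

text \<open>Given that all words up to level \<open>n\<close> are chosen, the trees below level \<open>n\<close> are independent copies, so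
  the probability is at least a positive power of that of a limit size above \<open>\<delta>\<close>.\<close>

lemma positive_prob_all_children_large:
  assumes q: "0 < prob {\<omega> \<in> space P. \<delta> \<le> limit_size \<omega>}" and s0: "\<sigma>0 \<in> level_words m k n"
  shows "0 < prob {\<omega> \<in> space P. \<omega> \<sigma>0 = Chosen \<and> (\<forall>\<tau>\<in>level_words m k n - {\<sigma>0}. \<delta> \<le> limit_size (sub \<tau> \<omega>))}"
proof -
  let ?L = "level_words m k n" and ?E = "agree_upto m k (\<lambda>_. Chosen) n"
  define I where "I = (\<lambda>\<omega>. if \<delta> \<le> limit_size \<omega> then 1 else 0 :: ennreal)"
  have I[measurable]: "I \<in> borel_measurable (Omega m k)" unfolding I_def by measurable
  have Iq: "(\<integral>\<^sup>+\<omega>. I \<omega> \<partial>P) = ennreal (prob {\<omega> \<in> space P. \<delta> \<le> limit_size \<omega>})"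
    unfolding I_def by (rule nn_integral_event) measurable
  have E0: "0 < emeasure P ?E"
    using measure_agree_upto_pos[of "\<lambda>_. Chosen" n] p0 by (simp add: emeasure_eq_measure)
  have pos: "0 < (\<integral>\<^sup>+\<omega>. indicator ?E \<omega> * (\<Prod>\<tau>\<in>B. I (sub \<tau> \<omega>)) \<partial>P)" if "finite B" "B \<subseteq> ?L" for B
    using that
  proof (induction B)
    case empty
    then show ?case using E0 by simp
  next
    case (insert \<tau> B)
    define g where "g = (\<lambda>\<omega>. indicator ?E \<omega> * (\<Prod>\<tau>\<in>B. I (sub \<tau> \<omega>)))"
    have tL: "\<tau> \<in> ?L" and tw: "\<tau> \<in> words m k" and tn: "length \<tau> = n" using insert.prems by auto
    have gm: "g \<in> borel_measurable (Omega m k)"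
      unfolding g_def
    proof (intro borel_measurable_times_ennreal borel_measurable_prod_ennreal)
      show "indicator ?E \<in> borel_measurable (Omega m k)" by measurable
      fix \<rho> assume "\<rho> \<in> B"
      then have [measurable]: "\<rho> \<in> words m k" using insert.prems by auto
      show "(\<lambda>\<omega>. I (sub \<rho> \<omega>)) \<in> borel_measurable (Omega m k)" by measurable
    qed
    have dg: "determined_by (Omega m k) (outside \<tau>) g"
    proof (rule determined_byI)
      fix x y assume xy: "x \<in> space (Omega m k)" "y \<in> space (Omega m k)"
        "\<And>\<rho>. \<rho> \<in> outside \<tau> \<Longrightarrow> x \<rho> = y \<rho>"
      have "x \<rho> = y \<rho>" if "\<rho> \<in> words m k" "length \<rho> \<le> n" for \<rho>
        using that tn by (intro xy(3)) (auto dest: prefix_length_less)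
      then have "(x \<in> ?E) = (y \<in> ?E)" using xy(1,2) by (simp add: agree_upto_def)
      moreover have "sub \<rho> x = sub \<rho> y" if "\<rho> \<in> B" for \<rho>
        using that insert.prems insert.hyps by (intro determined_by_sub_sibling[OF tL _ _ xy]) auto
      ultimately show "g x = g y" by (simp add: g_def indicator_def cong: prod.cong)
    qed
    have "(\<integral>\<^sup>+\<omega>. indicator ?E \<omega> * (\<Prod>\<tau>\<in>insert \<tau> B. I (sub \<tau> \<omega>)) \<partial>P)
        = (\<integral>\<^sup>+\<omega>. alive \<tau> \<omega> * g \<omega> * I (sub \<tau> \<omega>) \<partial>P)"
    proof (rule nn_integral_cong)
      fix \<omega>
      have "\<omega> \<tau> = Chosen" if "\<omega> \<in> ?E" using that tw tn by (simp add: agree_upto_def)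
      then show "indicator ?E \<omega> * (\<Prod>\<tau>\<in>insert \<tau> B. I (sub \<tau> \<omega>)) = alive \<tau> \<omega> * g \<omega> * I (sub \<tau> \<omega>)"
        using insert.hyps by (auto simp: g_def indicator_def mult_ac)
    qed
    also have "\<dots> = (\<integral>\<^sup>+\<omega>. alive \<tau> \<omega> * g \<omega> \<partial>P) * (\<integral>\<^sup>+\<omega>. I \<omega> \<partial>P)"
      by (rule branching[OF tw gm I dg])
    also have "(\<integral>\<^sup>+\<omega>. alive \<tau> \<omega> * g \<omega> \<partial>P) = (\<integral>\<^sup>+\<omega>. g \<omega> \<partial>P)"
    proof (rule nn_integral_cong)
      fix \<omega>
      have "\<omega> \<tau> = Chosen" if "\<omega> \<in> ?E" using that tw tn by (simp add: agree_upto_def)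
      then show "alive \<tau> \<omega> * g \<omega> = g \<omega>" by (auto simp: g_def indicator_def)
    qed
    finally show ?case using insert q unfolding Iq g_def by (simp add: ennreal_zero_less_mult_iff)
  qed
  define T where "T = {\<omega> \<in> space P. \<omega> \<sigma>0 = Chosen \<and> (\<forall>\<tau>\<in>?L - {\<sigma>0}. \<delta> \<le> limit_size (sub \<tau> \<omega>))}"
  have Tm: "T \<in> sets P"
  proof -
    have [measurable]: "\<sigma>0 \<in> words m k" using s0 by simp
    have [measurable]: "Measurable.pred (Omega m k) (\<lambda>\<omega>. \<forall>\<tau>\<in>?L - {\<sigma>0}. \<delta> \<le> limit_size (sub \<tau> \<omega>))"
    proof (rule pred_all_level_words)
      fix \<tau> assume [measurable]: "\<tau> \<in> words m k"
      show "Measurable.pred (Omega m k) (\<lambda>\<omega>. \<delta> \<le> limit_size (sub \<tau> \<omega>))" by measurable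
    qed
    show ?thesis unfolding T_def by measurable
  qed
  have "0 < (\<integral>\<^sup>+\<omega>. indicator ?E \<omega> * (\<Prod>\<tau>\<in>?L. I (sub \<tau> \<omega>)) \<partial>P)" by (rule pos) simp_all
  also have "\<dots> \<le> (\<integral>\<^sup>+\<omega>. indicator T \<omega> \<partial>P)"
  proof (rule nn_integral_mono)
    fix \<omega> assume w: "\<omega> \<in> space P"
    show "indicator ?E \<omega> * (\<Prod>\<tau>\<in>?L. I (sub \<tau> \<omega>)) \<le> indicator T \<omega>"
    proof (cases "\<omega> \<in> ?E \<and> (\<forall>\<tau>\<in>?L. \<delta> \<le> limit_size (sub \<tau> \<omega>))")
      case True
      then have "\<omega> \<in> T" using w s0 by (auto simp: T_def agree_upto_def)
      moreover have "(\<Prod>\<tau>\<in>?L. I (sub \<tau> \<omega>)) = 1" using True by (intro prod.neutral) (simp add: I_def)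
      ultimately show ?thesis by (simp add: indicator_def)
    next
      case False
      then have "indicator ?E \<omega> * (\<Prod>\<tau>\<in>?L. I (sub \<tau> \<omega>)) = 0"
      proof (cases "\<omega> \<in> ?E")
        case True
        then obtain \<tau> where "\<tau> \<in> ?L" "\<not> \<delta> \<le> limit_size (sub \<tau> \<omega>)" using False by blast
        then have "(\<Prod>\<tau>\<in>?L. I (sub \<tau> \<omega>)) = 0" by (intro prod_zero finite_level_words bexI[of _ \<tau>]) (auto simp: I_def)
        then show ?thesis by simp
      qed simp
      then show ?thesis by (simp only: zero_le)
    qed
  qed
  also have "\<dots> = ennreal (prob T)" using Tm by (simp only: nn_integral_indicator emeasure_eq_measure)
  finally show ?thesis by (simp add: T_def)
qed

lemma positive_prob_single_ray:
  assumes "p < 1" and c: "c \<in> alphabet m k"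
  shows "0 < prob {\<omega> \<in> space P. \<omega> (replicate n c) = Chosen \<and>
    (\<forall>\<tau>\<in>level_words m k n - {replicate n c}. \<omega> \<tau> = Neglected)}"
proof -
  define \<eta> where "\<eta> \<tau> = (if \<tau> = replicate (length \<tau>) c then Chosen else Neglected)" for \<tau>
  have "0 < measure P (agree_upto m k \<eta> n)"
  proof (rule measure_agree_upto_pos)
    fix \<sigma> j
    have "\<sigma> = replicate (length \<sigma>) c" if "\<sigma> @ [j] = replicate (Suc (length \<sigma>)) c"
      using that by (metis append1_eq_conv replicate_Suc replicate_append_same)
    then show "child_prob p (\<eta> \<sigma>) (\<eta> (\<sigma> @ [j])) \<noteq> 0" using p0 assms(1) by (simp add: \<eta>_def)
  qed (simp add: \<eta>_def)
  also have "\<dots> \<le> prob {\<omega> \<in> space P. \<omega> (replicate n c) = Chosen \<and>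
    (\<forall>\<tau>\<in>level_words m k n - {replicate n c}. \<omega> \<tau> = Neglected)}" (is "_ \<le> prob ?T")
  proof (rule finite_measure_mono)
    have rw: "replicate n c \<in> level_words m k n" using c by (auto simp: lists_eq_set)
    show "agree_upto m k \<eta> n \<subseteq> ?T"
    proof
      fix \<omega> assume w: "\<omega> \<in> agree_upto m k \<eta> n"
      have eq: "\<omega> \<tau> = \<eta> \<tau>" if "\<tau> \<in> level_words m k n" for \<tau>
        using w that by (simp add: agree_upto_def)
      have "\<omega> \<in> space P"
        using w sets_eq_imp_space_eq[OF sets_P] by (simp add: agree_upto_def)
      moreover have "\<omega> (replicate n c) = Chosen" unfolding eq[OF rw] by (simp add: \<eta>_def)
      moreover have "\<forall>\<tau>\<in>level_words m k n - {replicate n c}. \<omega> \<tau> = Neglected"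
      proof
        fix \<tau> assume t: "\<tau> \<in> level_words m k n - {replicate n c}"
        then have "\<omega> \<tau> = \<eta> \<tau>" by (intro eq) (rule DiffD1)
        then show "\<omega> \<tau> = Neglected" using t by (auto simp: \<eta>_def)
      qed
      ultimately show "\<omega> \<in> ?T" by blast
    qed
    have [measurable]: "replicate n c \<in> words m k" using rw by simp
    have [measurable]: "Measurable.pred (Omega m k) (\<lambda>\<omega>. \<forall>\<tau>\<in>level_words m k n - {replicate n c}. \<omega> \<tau> = Neglected)"
    proof (rule pred_all_level_words)
      fix \<tau> assume [measurable]: "\<tau> \<in> words m k"
      show "Measurable.pred (Omega m k) (\<lambda>\<omega>. \<omega> \<tau> = Neglected)" by measurable
    qed
    show "?T \<in> sets P" by measurable
  qed
  finally show ?thesis .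
qed

text \<open>Blocks of length 1 with this letter have positive lower density.\<close>

lemma AE_spine_letters_infinitely_often:
  assumes i: "i \<in> alphabet m k" "D i"
  shows "AE_spine C (\<lambda>\<omega> \<eta>. \<exists>\<^sub>F j in sequentially. D (\<eta> j))"
proof -
  have [measurable]: "[i] \<in> words m k" using i by simp
  have "prob {\<omega> \<in> space P. \<omega> [i] = Chosen} = p"
  proof -
    have "(\<integral>\<^sup>+\<omega>. alive [i] \<omega> \<partial>P) = ennreal (prob {\<omega> \<in> space P. \<omega> [i] = Chosen})"
      by (rule nn_integral_event) measurable
    then show ?thesis using p0 i by (simp add: nn_integral_alive)
  qed
  then have "\<exists>c>0. AE_spine C (\<lambda>\<omega> \<eta>. density_ge c (\<lambda>b. D (hd (seq_block 1 b \<eta>))))"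
    using i p0 by (intro AE_spine_frequency[where G="\<lambda>\<sigma> _. D (hd \<sigma>)" and n=1 and \<rho>="[i]"])
      (auto intro!: determined_byI)
  then obtain c where c: "0 < c" "AE_spine C (\<lambda>\<omega> \<eta>. density_ge c (\<lambda>b. D (hd (seq_block 1 b \<eta>))))" by blast
  from c(2) show ?thesis
  proof (rule AE_spine_mp)
    fix \<eta> assume ev: "density_ge c (\<lambda>b. D (hd (seq_block 1 b \<eta>)))"
    have [simp]: "hd (seq_block 1 b \<eta>) = \<eta> b" for b by (simp add: upt_conv_Cons)
    show "\<exists>\<^sub>F j in sequentially. D (\<eta> j)"
    proof (rule ccontr)
      assume "\<not> ?thesis"
      then obtain n0 where n0: "\<And>j. n0 \<le> j \<Longrightarrow> \<not> D (\<eta> j)"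
        by (auto simp: not_frequently eventually_sequentially)
      have "real (card {b \<in> {..<N}. D (\<eta> b)}) \<le> real n0" for N
      proof -
        have "{b \<in> {..<N}. D (\<eta> b)} \<subseteq> {..<n0}" using n0 not_less by auto
        then have "card {b \<in> {..<N}. D (\<eta> b)} \<le> card {..<n0}" by (intro card_mono) auto
        then show ?thesis by simp
      qed
      then have "\<forall>\<^sub>F N in sequentially. c * real N \<le> real n0"
        using ev unfolding density_ge_def by (auto elim!: eventually_mono intro: order_trans)
      moreover have "filterlim (\<lambda>N. c * real N) at_top sequentially"
        using c(1) by (intro filterlim_tendsto_pos_mult_at_top[OF tendsto_const _ filterlim_real_sequentially]) auto
      then have "\<forall>\<^sub>F N in sequentially. real n0 < c * real N" by (simp add: filterlim_at_top_dense)
      ultimately have "\<forall>\<^sub>F N in sequentially. False" by eventually_elim simp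
      then show False by simp
    qed
  qed
qed

text \<open>The rays through words without mass form a countable union of null cylinders.\<close>

lemma AE_spine_limit_size_pos:
  "AE_spine C (\<lambda>\<omega> \<eta>. \<forall>j. 0 < limit_size (sub (seq_prefix \<eta> j) \<omega>))"
proof (rule AE_spine_all_countable)
  fix j
  show "AE_spine C (\<lambda>\<omega> \<eta>. 0 < limit_size (sub (seq_prefix \<eta> j) \<omega>))"
    unfolding AE_spine_def using AE_regular
  proof eventually_elim
    case (elim \<omega>)
    show ?case
    proof (intro allI impI)
      fix \<mu> assume b: "is_branching C \<omega> \<mu>"
      then have s\<mu>: "sets \<mu> = sets (seq_space m k)" by (simp add: is_branching_def)
      have sp: "space \<mu> = space (seq_space m k)" by (rule sets_eq_imp_space_eq[OF s\<mu>])
      let ?N = "\<Union>\<sigma>\<in>{\<sigma> \<in> level_words m k j. limit_size (sub \<sigma> \<omega>) = 0}. cylinder \<sigma>"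
      have N: "?N \<in> null_sets \<mu>"
      proof (rule null_sets_UN')
        show "countable {\<sigma> \<in> level_words m k j. limit_size (sub \<sigma> \<omega>) = 0}" by (rule countableI_type)
        fix \<sigma> assume s: "\<sigma> \<in> {\<sigma> \<in> level_words m k j. limit_size (sub \<sigma> \<omega>) = 0}"
        then have "\<sigma> \<in> words m k" by simp
        then have "emeasure \<mu> (cylinder \<sigma>) = ennreal (C / growth ^ length \<sigma> * limit_size (sub \<sigma> \<omega>))"
          using b unfolding is_branching_def by blast
        then have "emeasure \<mu> (cylinder \<sigma>) = 0" using s by simp
        then show "cylinder \<sigma> \<in> null_sets \<mu>" by (intro null_setsI) (simp_all only: s\<mu> sets_cylinder)
      qed
      show "AE \<eta> in \<mu>. 0 < limit_size (sub (seq_prefix \<eta> j) \<omega>)"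
      proof (rule AE_I'[OF N], safe)
        fix \<eta> assume e: "\<eta> \<in> space \<mu>" "\<not> 0 < limit_size (sub (seq_prefix \<eta> j) \<omega>)"
        have pw: "seq_prefix \<eta> j \<in> level_words m k j" using e(1) by (intro seq_prefix_in_words) (simp add: sp)
        then have "0 \<le> limit_size (sub (seq_prefix \<eta> j) \<omega>)" by (intro regular_nonneg[OF elim]) simp
        then have "seq_prefix \<eta> j \<in> {\<sigma> \<in> level_words m k j. limit_size (sub \<sigma> \<omega>) = 0}" using e(2) pw by auto
        moreover have "\<eta> \<in> cylinder (seq_prefix \<eta> j)" using e(1) by (simp add: sp)
        ultimately show "\<eta> \<in> ?N" by blast
      qed
    qed
  qed
qed

end

section \<open>Half-open k-adic cubes and codes\<close>

text \<open>The dimension is also a number \<open>m\<close>, so that the locale can be combined with \<open>percolation\<close>, which does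
  not know about the type \<open>'m\<close>.\<close>

locale kadic_code =
  fixes m k :: nat and e :: "nat \<Rightarrow> nat ^ 'm"
  assumes dim: "m = CARD('m)" and base: "2 \<le> k" and enumeration: "enumeration e k"
begin

lemma enum: "bij_betw e (alphabet m k) {a. \<forall>l. a $ l < k}"
  using enumeration by (simp add: enumeration_def dim)

abbreviation letters :: "nat set" where "letters \<equiv> alphabet m k"
abbreviation code_words :: "nat list set" where "code_words \<equiv> words m k"

definition half_open_cube :: "nat list \<Rightarrow> (real ^ 'm) set" where
  "half_open_cube \<sigma> = {y. \<forall>l. corner e k \<sigma> $ l \<le> y $ l \<and> y $ l < corner e k \<sigma> $ l + 1 / real k ^ length \<sigma>}"

lemma k_pos [simp]: "0 < real k ^ n" using base by simp

lemma digit_less: "i \<in> letters \<Longrightarrow> e i $ l < k"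
  using enum bij_betwE by fastforce

lemma inj_letters: "i \<in> letters \<Longrightarrow> j \<in> letters \<Longrightarrow> (\<And>l. e i $ l = e j $ l) \<Longrightarrow> i = j"
  using enum by (auto simp: bij_betw_def inj_on_def vec_eq_iff)

lemma letter_of_digits:
  assumes "\<And>l. a $ l < k" obtains i where "i \<in> letters" "e i = a"
proof -
  have "a \<in> e ` letters" using enum assms by (simp add: enumeration_def bij_betw_def)
  then show thesis using that by blast
qed

lemma corner_Nil [simp]: "corner e k [] = 0"
  by (simp add: corner_def vec_eq_iff)

lemma corner_snoc: "corner e k (\<sigma> @ [i]) $ l = corner e k \<sigma> $ l + real (e i $ l) / real k ^ Suc (length \<sigma>)"
  by (simp add: corner_def nth_append)

lemma corner_grid: "\<exists>a::nat. real k ^ length \<sigma> * corner e k \<sigma> $ l = real a"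
proof (induction \<sigma> rule: rev_induct)
  case Nil
  then show ?case by (auto intro: exI[of _ 0])
next
  case (snoc i \<sigma>)
  then obtain a :: nat where a: "real k ^ length \<sigma> * corner e k \<sigma> $ l = real a" by blast
  have "real k ^ length (\<sigma> @ [i]) * corner e k (\<sigma> @ [i]) $ l = real k * (real k ^ length \<sigma> * corner e k \<sigma> $ l) + real (e i $ l)"
    using base unfolding corner_snoc by (simp add: field_simps)
  also have "\<dots> = real (k * a + e i $ l)" by (simp add: a)
  finally show ?case by blast
qed

lemma half_open_cube_snoc_subset:
  assumes "i \<in> letters" shows "half_open_cube (\<sigma> @ [i]) \<subseteq> half_open_cube \<sigma>"
proof
  fix y assume y: "y \<in> half_open_cube (\<sigma> @ [i])"
  show "y \<in> half_open_cube \<sigma>"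
    unfolding half_open_cube_def
  proof (intro CollectI allI conjI)
    fix l
    let ?K = "real k ^ Suc (length \<sigma>)"
    have y1: "corner e k \<sigma> $ l + real (e i $ l) / ?K \<le> y $ l" "y $ l < corner e k \<sigma> $ l + real (e i $ l) / ?K + 1 / ?K"
      using y unfolding half_open_cube_def by (auto simp: corner_snoc)
    have "0 \<le> real (e i $ l) / ?K" by simp
    then show "corner e k \<sigma> $ l \<le> y $ l" using y1 by linarith
    have "real (e i $ l) + 1 \<le> real k" using digit_less[OF assms, of l] by linarith
    then have "(real (e i $ l) + 1) / ?K \<le> real k / ?K" by (intro divide_right_mono) auto
    also have "real k / ?K = 1 / real k ^ length \<sigma>" using base by simp
    finally have "real (e i $ l) / ?K + 1 / ?K \<le> 1 / real k ^ length \<sigma>" by (simp only: add_divide_distrib)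
    then show "y $ l < corner e k \<sigma> $ l + 1 / real k ^ length \<sigma>" using y1 by linarith
  qed
qed

lemma half_open_cube_subdivide:
  assumes y: "y \<in> half_open_cube \<sigma>" obtains i where "i \<in> letters" "y \<in> half_open_cube (\<sigma> @ [i])"
proof -
  let ?K = "real k ^ Suc (length \<sigma>)"
  define t where "t l = \<lfloor>(y $ l - corner e k \<sigma> $ l) * ?K\<rfloor>" for l
  have yl: "0 \<le> y $ l - corner e k \<sigma> $ l" "y $ l - corner e k \<sigma> $ l < 1 / real k ^ length \<sigma>" for l
    using y unfolding half_open_cube_def by (auto simp: algebra_simps)
  have t0: "0 \<le> t l" for l unfolding t_def using yl(1)[of l] by simp
  have "(y $ l - corner e k \<sigma> $ l) * ?K < 1 / real k ^ length \<sigma> * ?K" for l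
    using yl(2) k_pos by (rule mult_strict_right_mono)
  then have "(y $ l - corner e k \<sigma> $ l) * ?K < real k" for l using base by simp
  then have tk: "t l < int k" for l unfolding t_def by (simp add: floor_less_iff)
  obtain i where i: "i \<in> letters" "e i = (\<chi> l. nat (t l))"
    using letter_of_digits[of "\<chi> l. nat (t l)"] t0 tk by (auto simp: nat_less_iff)
  have ei: "real (e i $ l) = of_int (t l)" for l using t0 by (simp add: i(2))
  have "y \<in> half_open_cube (\<sigma> @ [i])"
    unfolding half_open_cube_def
  proof (intro CollectI allI conjI)
    fix l
    have "of_int (t l) \<le> (y $ l - corner e k \<sigma> $ l) * ?K" "(y $ l - corner e k \<sigma> $ l) * ?K < of_int (t l) + 1"
      unfolding t_def by linarith+
    then have *: "of_int (t l) / ?K \<le> y $ l - corner e k \<sigma> $ l"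
        "y $ l - corner e k \<sigma> $ l < of_int (t l) / ?K + 1 / ?K"
      by (simp_all only: pos_divide_le_eq pos_less_divide_eq k_pos flip: add_divide_distrib)
    then show "corner e k (\<sigma> @ [i]) $ l \<le> y $ l" unfolding corner_snoc ei by linarith
    show "y $ l < corner e k (\<sigma> @ [i]) $ l + 1 / real k ^ length (\<sigma> @ [i])"
      using *(2) unfolding corner_snoc ei length_append_singleton by linarith
  qed
  then show thesis using i(1) that by blast
qed

lemma half_open_cube_subdivide_level:
  assumes "y \<in> half_open_cube \<sigma>" shows "\<exists>\<tau>\<in>code_words. length \<tau> = n \<and> y \<in> half_open_cube (\<sigma> @ \<tau>)"
proof (induction n)
  case 0
  then show ?case using assms by (intro bexI[of _ "[]"]) auto
next
  case (Suc n)
  then obtain \<tau> where t: "\<tau> \<in> code_words" "length \<tau> = n" "y \<in> half_open_cube (\<sigma> @ \<tau>)" by blast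
  obtain i where "i \<in> letters" "y \<in> half_open_cube ((\<sigma> @ \<tau>) @ [i])"
    using half_open_cube_subdivide[OF t(3)] by blast
  then show ?case using t by (intro bexI[of _ "\<tau> @ [i]"]) auto
qed

lemma half_open_cube_grid:
  assumes y: "y \<in> half_open_cube \<sigma>"
  shows "corner e k \<sigma> $ l = of_int \<lfloor>real k ^ length \<sigma> * y $ l\<rfloor> / real k ^ length \<sigma>"
proof -
  let ?K = "real k ^ length \<sigma>"
  obtain a :: nat where a: "?K * corner e k \<sigma> $ l = real a" using corner_grid by blast
  have "corner e k \<sigma> $ l \<le> y $ l" "y $ l < corner e k \<sigma> $ l + 1 / ?K"
    using y unfolding half_open_cube_def by auto
  then have "?K * corner e k \<sigma> $ l \<le> ?K * y $ l" "?K * y $ l < ?K * (corner e k \<sigma> $ l + 1 / ?K)"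
    by (simp_all only: mult_le_cancel_left_pos mult_less_cancel_left_pos k_pos)
  then have "real a \<le> ?K * y $ l" "?K * y $ l < real a + 1"
    using base by (simp_all add: a distrib_left)
  then have "\<lfloor>?K * y $ l\<rfloor> = int a" by linarith
  then have "of_int \<lfloor>?K * y $ l\<rfloor> = ?K * corner e k \<sigma> $ l" by (simp add: a)
  then show ?thesis using base by simp
qed

lemma kadic_cube_eq:
  assumes y: "y \<in> half_open_cube \<sigma>" shows "kadic_cube k (length \<sigma>) y = half_open_cube \<sigma>"
  unfolding kadic_cube_def half_open_cube_def half_open_cube_grid[OF y] by (simp add: add_divide_distrib)

text \<open>The corner of a cube is determined by any of its points, and the corners determine the digits.\<close>

lemma half_open_cube_unique:
  assumes "length \<sigma> = length \<tau>" "\<sigma> \<in> code_words" "\<tau> \<in> code_words"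
    "y \<in> half_open_cube \<sigma>" "y \<in> half_open_cube \<tau>"
  shows "\<sigma> = \<tau>"
  using assms
proof (induction \<sigma> arbitrary: \<tau> rule: rev_induct)
  case (snoc i \<sigma>)
  obtain \<tau>' j where t: "\<tau> = \<tau>' @ [j]" using snoc.prems(1) by (cases \<tau> rule: rev_cases) auto
  have i: "i \<in> letters" "\<sigma> \<in> code_words" and j: "j \<in> letters" "\<tau>' \<in> code_words" and len: "length \<sigma> = length \<tau>'"
    using snoc.prems unfolding t by auto
  have "\<sigma> = \<tau>'"
    using half_open_cube_snoc_subset[OF i(1), of \<sigma>] half_open_cube_snoc_subset[OF j(1), of \<tau>'] snoc.prems(4,5)
    unfolding t by (intro snoc.IH[OF len i(2) j(2)]) auto
  moreover have "corner e k (\<sigma> @ [i]) $ l = corner e k (\<tau>' @ [j]) $ l" for l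
    using half_open_cube_grid[OF snoc.prems(4), of l] half_open_cube_grid[OF snoc.prems(5), of l] len
    unfolding t by simp
  ultimately have "real (e i $ l) / real k ^ Suc (length \<sigma>) = real (e j $ l) / real k ^ Suc (length \<sigma>)" for l
    by (simp only: corner_snoc add_left_cancel)
  then have "e i $ l = e j $ l" for l using base by simp
  then show ?case using inj_letters[OF i(1) j(1)] \<open>\<sigma> = \<tau>'\<close> t by simp
qed simp

text \<open>The upper corners of the cubes along a sequence decrease and the lower corners increase, so
  a digit that is not extremal moves the limit point strictly inside all earlier cubes.\<close>

definition limit_point :: "(nat \<Rightarrow> nat) \<Rightarrow> real ^ 'm" where
  "limit_point \<eta> = (\<chi> l. \<Sum>i. real (e (\<eta> i) $ l) / real k ^ Suc i)"

context
  fixes \<eta> :: "nat \<Rightarrow> nat" assumes \<eta>: "\<And>i. \<eta> i \<in> letters"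
begin

lemma corner_prefix_Suc:
  "corner e k (seq_prefix \<eta> (Suc n)) $ l = corner e k (seq_prefix \<eta> n) $ l + real (e (\<eta> n) $ l) / real k ^ Suc n"
  using corner_snoc[of "seq_prefix \<eta> n" "\<eta> n" l] by simp

lemma corner_prefix_mono: "n \<le> n' \<Longrightarrow> corner e k (seq_prefix \<eta> n) $ l \<le> corner e k (seq_prefix \<eta> n') $ l"
  by (rule lift_Suc_mono_le) (auto simp del: upt_Suc map_append simp: corner_prefix_Suc)

lemma upper_corner_Suc:
  "corner e k (seq_prefix \<eta> (Suc n)) $ l + 1 / real k ^ Suc n =
   corner e k (seq_prefix \<eta> n) $ l + 1 / real k ^ n - (real k - 1 - real (e (\<eta> n) $ l)) / real k ^ Suc n"
  unfolding corner_prefix_Suc using base by (simp add: field_simps)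

lemma upper_corner_antimono:
  assumes "n \<le> n'"
  shows "corner e k (seq_prefix \<eta> n') $ l + 1 / real k ^ n' \<le> corner e k (seq_prefix \<eta> n) $ l + 1 / real k ^ n"
proof (rule lift_Suc_antimono_le[OF _ assms])
  fix n
  have "real (e (\<eta> n) $ l) + 1 \<le> real k" using digit_less[OF \<eta>, of n l] by linarith
  then have "0 \<le> (real k - 1 - real (e (\<eta> n) $ l)) / real k ^ Suc n" by (intro divide_nonneg_nonneg) auto
  then show "corner e k (seq_prefix \<eta> (Suc n)) $ l + 1 / real k ^ Suc n \<le> corner e k (seq_prefix \<eta> n) $ l + 1 / real k ^ n"
    unfolding upper_corner_Suc by linarith
qed

lemma corner_prefix_tendsto: "(\<lambda>n. corner e k (seq_prefix \<eta> n) $ l) \<longlonglongrightarrow> limit_point \<eta> $ l"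
proof -
  have eq: "corner e k (seq_prefix \<eta> n) $ l = (\<Sum>i<n. real (e (\<eta> i) $ l) / real k ^ Suc i)" for n
    by (simp add: corner_def)
  have "summable (\<lambda>i. real (e (\<eta> i) $ l) / real k ^ Suc i)"
  proof (rule bounded_imp_summable)
    show "(\<Sum>i\<le>n. real (e (\<eta> i) $ l) / real k ^ Suc i) \<le> 1" for n
    proof -
      have "(\<Sum>i\<le>n. real (e (\<eta> i) $ l) / real k ^ Suc i) = corner e k (seq_prefix \<eta> (Suc n)) $ l"
        unfolding eq lessThan_Suc_atMost ..
      also have "\<dots> \<le> corner e k (seq_prefix \<eta> 0) $ l + 1 / real k ^ 0"
        using upper_corner_antimono[of 0 "Suc n" l] k_pos[of "Suc n"] by (smt (verit) divide_pos_pos zero_le)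
      finally show ?thesis by simp
    qed
  qed simp
  then show ?thesis unfolding eq limit_point_def by (simp add: summable_LIMSEQ)
qed

lemma inverse_power_tendsto: "(\<lambda>n. 1 / real k ^ n) \<longlonglongrightarrow> 0"
  using base LIMSEQ_power_zero[of "1 / real k"] by (simp add: power_one_over)

lemma limit_point_ge: "corner e k (seq_prefix \<eta> n) $ l \<le> limit_point \<eta> $ l"
  using corner_prefix_tendsto by (rule LIMSEQ_le_const) (use corner_prefix_mono in blast)

lemma limit_point_le: "limit_point \<eta> $ l \<le> corner e k (seq_prefix \<eta> n) $ l + 1 / real k ^ n"
proof (rule LIMSEQ_le_const2)
  show "(\<lambda>n. corner e k (seq_prefix \<eta> n) $ l + 1 / real k ^ n) \<longlonglongrightarrow> limit_point \<eta> $ l"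
    using tendsto_add[OF corner_prefix_tendsto inverse_power_tendsto] by simp
qed (use upper_corner_antimono in blast)

lemma limit_point_gt:
  assumes "\<exists>\<^sub>F j in sequentially. e (\<eta> j) $ l \<noteq> 0"
  shows "corner e k (seq_prefix \<eta> n) $ l < limit_point \<eta> $ l"
proof -
  obtain j where j: "n \<le> j" "e (\<eta> j) $ l \<noteq> 0"
    using assms by (auto simp: frequently_sequentially)
  have "corner e k (seq_prefix \<eta> n) $ l \<le> corner e k (seq_prefix \<eta> j) $ l" by (rule corner_prefix_mono[OF j(1)])
  also have "\<dots> < corner e k (seq_prefix \<eta> (Suc j)) $ l"
    unfolding corner_prefix_Suc using j(2) base by simp
  also have "\<dots> \<le> limit_point \<eta> $ l" by (rule limit_point_ge)
  finally show ?thesis .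
qed

lemma limit_point_less:
  assumes "\<exists>\<^sub>F j in sequentially. e (\<eta> j) $ l \<noteq> k - 1"
  shows "limit_point \<eta> $ l < corner e k (seq_prefix \<eta> n) $ l + 1 / real k ^ n"
proof -
  obtain j where j: "n \<le> j" "e (\<eta> j) $ l \<noteq> k - 1"
    using assms by (auto simp: frequently_sequentially)
  have "limit_point \<eta> $ l \<le> corner e k (seq_prefix \<eta> (Suc j)) $ l + 1 / real k ^ Suc j" by (rule limit_point_le)
  also have "\<dots> < corner e k (seq_prefix \<eta> j) $ l + 1 / real k ^ j"
  proof -
    have "real (e (\<eta> j) $ l) + 1 < real k" using digit_less[OF \<eta>, of j l] j(2) by linarith
    then have "0 < (real k - 1 - real (e (\<eta> j) $ l)) / real k ^ Suc j" by (intro divide_pos_pos) auto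
    then show ?thesis unfolding upper_corner_Suc by linarith
  qed
  also have "\<dots> \<le> corner e k (seq_prefix \<eta> n) $ l + 1 / real k ^ n" by (rule upper_corner_antimono[OF j(1)])
  finally show ?thesis .
qed

lemma code_point_eq: "code_point e k \<eta> = limit_point \<eta>"
  unfolding code_point_def
proof (rule the_equality)
  show "\<forall>i. limit_point \<eta> \<in> cube e k (seq_prefix \<eta> i)"
    using limit_point_ge limit_point_le by (simp add: cube_def)
  fix x assume x: "\<forall>i. x \<in> cube e k (seq_prefix \<eta> i)"
  show "x = limit_point \<eta>"
  proof (rule vec_eq_iff[THEN iffD2], rule allI)
    fix l
    have "(\<lambda>n. corner e k (seq_prefix \<eta> n) $ l + 1 / real k ^ n) \<longlonglongrightarrow> limit_point \<eta> $ l"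
      using tendsto_add[OF corner_prefix_tendsto inverse_power_tendsto] by simp
    moreover have "corner e k (seq_prefix \<eta> n) $ l \<le> x $ l" "x $ l \<le> corner e k (seq_prefix \<eta> n) $ l + 1 / real k ^ n" for n
      using x by (auto simp: cube_def dest!: spec[of _ n])
    ultimately show "x $ l = limit_point \<eta> $ l"
      using corner_prefix_tendsto[of l] by (intro antisym LIMSEQ_le_const LIMSEQ_le_const2) blast+
  qed
qed

end

text \<open>A sequence is generic if none of its coordinate expansions is eventually 0 or eventually
  \<open>k - 1\<close>; its point then lies in the interior of all cubes along the sequence.\<close>

definition generic :: "(nat \<Rightarrow> nat) \<Rightarrow> bool" where
  "generic \<eta> \<longleftrightarrow> (\<forall>i. \<eta> i \<in> letters) \<and>
    (\<forall>l. (\<exists>\<^sub>F j in sequentially. e (\<eta> j) $ l \<noteq> 0) \<and> (\<exists>\<^sub>F j in sequentially. e (\<eta> j) $ l \<noteq> k - 1))"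

lemma generic_interior:
  assumes "generic \<eta>"
  shows "corner e k (seq_prefix \<eta> n) $ l < code_point e k \<eta> $ l"
    "code_point e k \<eta> $ l < corner e k (seq_prefix \<eta> n) $ l + 1 / real k ^ n"
  using assms limit_point_gt[of \<eta> l n] limit_point_less[of \<eta> l n] by (auto simp: generic_def code_point_eq)

lemma generic_in_half_open_cube: "generic \<eta> \<Longrightarrow> code_point e k \<eta> \<in> half_open_cube (seq_prefix \<eta> n)"
  using generic_interior[of \<eta>] by (auto simp: half_open_cube_def less_imp_le)

lemma generic_in_half_open_cube_iff:
  assumes g: "generic \<eta>" and s: "\<sigma> \<in> code_words"
  shows "code_point e k \<eta> \<in> half_open_cube \<sigma> \<longleftrightarrow> seq_prefix \<eta> (length \<sigma>) = \<sigma>"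
proof
  assume "code_point e k \<eta> \<in> half_open_cube \<sigma>"
  then show "seq_prefix \<eta> (length \<sigma>) = \<sigma>"
    using generic_in_half_open_cube[OF g, of "length \<sigma>"] s g
    by (intro half_open_cube_unique[of _ _ "code_point e k \<eta>"]) (auto simp: generic_def)
next
  assume "seq_prefix \<eta> (length \<sigma>) = \<sigma>"
  then show "code_point e k \<eta> \<in> half_open_cube \<sigma>" using generic_in_half_open_cube[OF g, of "length \<sigma>"] by simp
qed

lemma space_seq_space_letters: "space (seq_space m k) = {\<eta>. \<forall>i. \<eta> i \<in> letters}"
  by (auto simp: seq_space_def space_PiM PiE_UNIV_domain)

lemma measurable_seq_letter: "(\<lambda>\<eta>. f (\<eta> i)) \<in> seq_space m k \<rightarrow>\<^sub>M borel"
  for f :: "nat \<Rightarrow> real"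
proof -
  have "(\<lambda>\<eta>. \<eta> i) \<in> seq_space m k \<rightarrow>\<^sub>M count_space letters"
    unfolding seq_space_def by (rule measurable_component_singleton) simp
  moreover have "f \<in> count_space letters \<rightarrow>\<^sub>M borel" by simp
  ultimately show ?thesis by (rule measurable_compose)
qed

lemma borel_measurable_cartI:
  fixes f :: "'a \<Rightarrow> real ^ 'm"
  assumes "\<And>l. (\<lambda>x. f x $ l) \<in> borel_measurable M" shows "f \<in> borel_measurable M"
proof (subst borel_measurable_euclidean_space, rule ballI)
  fix b :: "real ^ 'm" assume "b \<in> Basis"
  then obtain l where "b = axis l 1" by (auto simp: Basis_vec_def)
  then show "(\<lambda>x. f x \<bullet> b) \<in> borel_measurable M" using assms[of l] by (simp add: inner_axis)
qed

lemma measurable_code_point: "code_point e k \<in> seq_space m k \<rightarrow>\<^sub>M borel"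
proof -
  have "limit_point \<in> seq_space m k \<rightarrow>\<^sub>M borel"
  proof (rule borel_measurable_cartI)
    fix l
    have [measurable]: "(\<lambda>\<eta>. real (e (\<eta> i) $ l)) \<in> seq_space m k \<rightarrow>\<^sub>M borel" for i
      by (rule measurable_seq_letter)
    show "(\<lambda>\<eta>. limit_point \<eta> $ l) \<in> seq_space m k \<rightarrow>\<^sub>M borel"
      unfolding limit_point_def by simp
  qed
  then show ?thesis
    by (rule measurable_cong[THEN iffD1, rotated]) (simp add: code_point_eq space_seq_space_letters)
qed

lemma sets_half_open_cube [measurable]: "half_open_cube \<sigma> \<in> sets borel"
proof -
  have "{y \<in> space borel. \<forall>l. corner e k \<sigma> $ l \<le> y $ l \<and> y $ l < corner e k \<sigma> $ l + 1 / real k ^ length \<sigma>} \<in> sets borel"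
    by measurable
  then show ?thesis by (simp add: half_open_cube_def)
qed

text \<open>The sequence of letters given by the base \<open>k\<close> digits of the coordinates: a measurable inverse of the
  coding on generic points.\<close>

definition address :: "real ^ 'm \<Rightarrow> nat \<Rightarrow> nat" where
  "address x i = inv_into letters e (\<chi> l. nat (\<lfloor>real k ^ Suc i * x $ l\<rfloor> mod int k))"

lemma address_digit:
  "address x i \<in> letters" "e (address x i) = (\<chi> l. nat (\<lfloor>real k ^ Suc i * x $ l\<rfloor> mod int k))"
proof -
  let ?d = "(\<chi> l. nat (\<lfloor>real k ^ Suc i * x $ l\<rfloor> mod int k)) :: nat ^ 'm"
  have "?d $ l < k" for l using base by (simp add: nat_less_iff)
  then obtain j where "j \<in> letters" "e j = ?d" by (rule letter_of_digits)
  then have "?d \<in> e ` letters" by (metis imageI)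
  then show "address x i \<in> letters" "e (address x i) = ?d"
    unfolding address_def by (rule inv_into_into, rule f_inv_into_f)
qed

lemma in_half_open_cube_address:
  assumes x: "x \<in> half_open_cube []" shows "x \<in> half_open_cube (seq_prefix (address x) n)"
proof -
  have c: "corner e k (seq_prefix (address x) n) $ l = of_int \<lfloor>real k ^ n * x $ l\<rfloor> / real k ^ n" for l
  proof (induction n)
    case 0
    have "0 \<le> x $ l" "x $ l < 1" using x by (simp_all add: half_open_cube_def)
    then have "\<lfloor>x $ l\<rfloor> = 0" by linarith
    then show ?case by simp
  next
    case (Suc n)
    define t where "t = \<lfloor>real k ^ Suc n * x $ l\<rfloor>"
    have "real k ^ n * x $ l = (real k ^ Suc n * x $ l) / real_of_int (int k)" using base by simp
    then have div: "\<lfloor>real k ^ n * x $ l\<rfloor> = t div int k"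
      unfolding t_def by (simp only: floor_divide_real_eq_div of_nat_0_le_iff)
    have dig: "real (e (address x n) $ l) = of_int (t mod int k)"
      using base by (simp add: address_digit(2) t_def)
    have "corner e k (seq_prefix (address x) (Suc n)) $ l
        = of_int (t div int k) / real k ^ n + of_int (t mod int k) / real k ^ Suc n"
      using corner_snoc[of "seq_prefix (address x) n" "address x n" l] Suc by (simp add: div dig)
    also have "\<dots> = of_int t / real k ^ Suc n"
    proof -
      have "real_of_int t = real k * of_int (t div int k) + of_int (t mod int k)"
        by (metis mult_div_mod_eq of_int_add of_int_mult of_int_of_nat_eq)
      then show ?thesis using base by (simp add: field_simps)
    qed
    finally show ?case by (simp only: t_def)
  qed
  show ?thesis
    unfolding half_open_cube_def
  proof (intro CollectI allI conjI)
    fix l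
    let ?K = "real k ^ n"
    have f: "of_int \<lfloor>?K * x $ l\<rfloor> \<le> x $ l * ?K" "x $ l * ?K < of_int \<lfloor>?K * x $ l\<rfloor> + 1"
      by (simp_all add: mult.commute)
    show "corner e k (seq_prefix (address x) n) $ l \<le> x $ l"
      unfolding c using f(1) by (simp only: pos_divide_le_eq k_pos)
    have "x $ l < (of_int \<lfloor>?K * x $ l\<rfloor> + 1) / ?K" using f(2) by (simp only: pos_less_divide_eq k_pos)
    then show "x $ l < corner e k (seq_prefix (address x) n) $ l + 1 / real k ^ length (seq_prefix (address x) n)"
      unfolding c by (simp add: add_divide_distrib)
  qed
qed

lemma measurable_address: "address \<in> borel \<rightarrow>\<^sub>M seq_space m k"
  unfolding seq_space_def
proof (rule measurable_PiM_single')
  fix i :: nat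
  show "(\<lambda>x. address x i) \<in> borel \<rightarrow>\<^sub>M count_space letters"
  proof (subst measurable_count_space_eq2[OF finite_alphabet], intro conjI ballI)
    show "(\<lambda>x. address x i) \<in> space borel \<rightarrow> letters" using address_digit(1) by simp
    fix a assume a: "a \<in> letters"
    have "(\<lambda>x. address x i) -` {a} \<inter> space borel = {x \<in> space borel. \<forall>l. nat (\<lfloor>real k ^ Suc i * x $ l\<rfloor> mod int k) = e a $ l}"
    proof (intro set_eqI iffI)
      fix x :: "real ^ 'm" assume "x \<in> (\<lambda>x. address x i) -` {a} \<inter> space borel"
      then have "e (address x i) = e a" by simp
      then show "x \<in> {x \<in> space borel. \<forall>l. nat (\<lfloor>real k ^ Suc i * x $ l\<rfloor> mod int k) = e a $ l}"
        unfolding address_digit(2) by (simp add: vec_eq_iff)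
    next
      fix x :: "real ^ 'm" assume "x \<in> {x \<in> space borel. \<forall>l. nat (\<lfloor>real k ^ Suc i * x $ l\<rfloor> mod int k) = e a $ l}"
      then have d: "\<forall>l. nat (\<lfloor>real k ^ Suc i * x $ l\<rfloor> mod int k) = e a $ l" by simp
      have "address x i = a"
        by (rule inj_letters[OF address_digit(1) a]) (simp add: address_digit(2) d[rule_format] del: power_Suc)
      then show "x \<in> (\<lambda>x. address x i) -` {a} \<inter> space borel" by simp
    qed
    also have "\<dots> \<in> sets borel" by measurable
    finally show "(\<lambda>x. address x i) -` {a} \<inter> space borel \<in> sets borel" .
  qed
next
  show "address \<in> space borel \<rightarrow> (\<Pi>\<^sub>E i\<in>UNIV. space (count_space letters))"
    using address_digit(1) by (auto simp: PiE_UNIV_domain)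
qed

lemma address_code_point:
  assumes g: "generic \<eta>" shows "address (code_point e k \<eta>) = \<eta>"
proof
  fix i
  let ?x = "code_point e k \<eta>"
  have "?x \<in> half_open_cube (seq_prefix (address ?x) (Suc i))"
    using generic_in_half_open_cube[OF g, of 0] by (intro in_half_open_cube_address) simp
  then have "seq_prefix \<eta> (Suc i) = seq_prefix (address ?x) (Suc i)"
    using g address_digit(1) by (subst (asm) generic_in_half_open_cube_iff[OF g]) (auto simp del: upt_Suc)
  then have "seq_prefix \<eta> (Suc i) ! i = seq_prefix (address ?x) (Suc i) ! i" by (rule arg_cong)
  then show "address ?x i = \<eta> i" by (simp del: upt_Suc)
qed

lemma infnorm_less_iff: "infnorm (x :: real ^ 'm) < r \<longleftrightarrow> (\<forall>l. \<bar>x $ l\<bar> < r)"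
proof -
  have "infnorm x = Max (range (\<lambda>l. \<bar>x $ l\<bar>))"
    unfolding infnorm_cart by (subst cSup_eq_Max[symmetric]) (auto simp: full_SetCompr_eq)
  then show ?thesis by simp
qed

lemma max_ball_iff: "y \<in> max_ball z r \<longleftrightarrow> (\<forall>l. \<bar>z $ l - y $ l\<bar> < r)" for y z :: "real ^ 'm"
  by (simp add: max_ball_def infnorm_less_iff)

lemma half_open_cube_subset_max_ball:
  assumes z: "z \<in> half_open_cube \<sigma>" and r: "1 / real k ^ length \<sigma> \<le> r"
  shows "half_open_cube \<sigma> \<subseteq> max_ball z r"
proof
  fix y assume y: "y \<in> half_open_cube \<sigma>"
  show "y \<in> max_ball z r"
    unfolding max_ball_iff
  proof
    fix l
    have "corner e k \<sigma> $ l \<le> z $ l" "z $ l < corner e k \<sigma> $ l + 1 / real k ^ length \<sigma>"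
      "corner e k \<sigma> $ l \<le> y $ l" "y $ l < corner e k \<sigma> $ l + 1 / real k ^ length \<sigma>"
      using y z by (simp_all add: half_open_cube_def)
    then show "\<bar>z $ l - y $ l\<bar> < r" using r by linarith
  qed
qed

lemma sets_max_ball [measurable]: "max_ball z r \<in> sets borel" for z :: "real ^ 'm"
proof -
  have "{y \<in> space borel. \<forall>l. \<bar>z $ l - y $ l\<bar> < r} \<in> sets borel" by measurable
  moreover have "max_ball z r = {y \<in> space borel. \<forall>l. \<bar>z $ l - y $ l\<bar> < r}" by (auto simp: max_ball_iff)
  ultimately show ?thesis by simp
qed

text \<open>Only the centre of a cube is the centre of an inscribed ball of full size.\<close>

lemma full_ball_contains_interior:
  assumes sub: "max_ball z (1 / 2 / real k ^ length \<sigma>) \<subseteq> half_open_cube \<sigma>"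
    and y: "\<And>l. corner e k \<sigma> $ l < y $ l" "\<And>l. y $ l < corner e k \<sigma> $ l + 1 / real k ^ length \<sigma>"
  shows "y \<in> max_ball z (1 / 2 / real k ^ length \<sigma>)"
proof -
  define r where "r = 1 / 2 / real k ^ length \<sigma>"
  have r: "0 < r" "1 / real k ^ length \<sigma> = 2 * r" using base by (simp_all add: r_def)
  have shifted: "z + (\<chi> l. s) \<in> half_open_cube \<sigma>" if "\<bar>s\<bar> < r" for s
    using that by (intro subsetD[OF sub]) (simp add: max_ball_iff r_def)
  have "z $ l = corner e k \<sigma> $ l + r" for l
  proof (rule antisym)
    show "z $ l \<le> corner e k \<sigma> $ l + r"
    proof (rule ccontr)
      assume "\<not> ?thesis"
      define s where "s = max 0 (corner e k \<sigma> $ l + 2 * r - z $ l)"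
      have "\<bar>s\<bar> < r" using \<open>\<not> z $ l \<le> corner e k \<sigma> $ l + r\<close> r(1) by (auto simp: s_def)
      then have "z + (\<chi> l. s) \<in> half_open_cube \<sigma>" by (rule shifted)
      then have "z $ l + s < corner e k \<sigma> $ l + 2 * r" by (auto simp: half_open_cube_def r(2))
      then show False by (simp add: s_def)
    qed
    show "corner e k \<sigma> $ l + r \<le> z $ l"
    proof (rule ccontr)
      assume "\<not> ?thesis"
      define s where "s = (z $ l - corner e k \<sigma> $ l + r) / 2"
      have "z + (\<chi> l. 0) \<in> half_open_cube \<sigma>" using r(1) by (intro shifted) simp
      then have "corner e k \<sigma> $ l \<le> z $ l" by (simp add: half_open_cube_def)
      then have s: "\<bar>- s\<bar> < r" "z $ l - s < corner e k \<sigma> $ l"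
        using \<open>\<not> corner e k \<sigma> $ l + r \<le> z $ l\<close> r(1) by (auto simp: s_def abs_if field_simps)
      have "z + (\<chi> l. - s) \<in> half_open_cube \<sigma>" using s(1) by (rule shifted)
      then have "corner e k \<sigma> $ l \<le> z $ l - s" by (auto simp: half_open_cube_def)
      then show False using s(2) by simp
    qed
  qed
  then have "\<bar>z $ l - y $ l\<bar> < r" for l
    using y(1)[of l] y(2)[of l] unfolding r(2) abs_less_iff by (smt (verit))
  then show ?thesis unfolding max_ball_iff r_def by blast
qed

end

section \<open>Mean porosities as infima\<close>

lemma Lim_at_right_mono:
  fixes f :: "real \<Rightarrow> ereal"
  assumes "\<And>a b. x < a \<Longrightarrow> a \<le> b \<Longrightarrow> f a \<le> f b"
  shows "Lim (at_right x) f = Inf (f ` {x<..})"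
proof (rule tendsto_Lim)
  show "(f \<longlongrightarrow> Inf (f ` {x<..})) (at_right x)"
    using Lim_right_bound[of UNIV x f "-\<infinity>"] assms by simp
qed simp

lemma has_hole_mono:
  assumes "has_hole k \<mu> x \<alpha> \<epsilon> j" "\<epsilon> \<le> \<epsilon>'"
  shows "has_hole k \<mu> x \<alpha> \<epsilon>' j"
proof -
  have "ennreal \<epsilon> * emeasure \<mu> (kadic_cube k j x) \<le> ennreal \<epsilon>' * emeasure \<mu> (kadic_cube k j x)"
    using assms(2) by (intro mult_right_mono ennreal_leI) auto
  then show ?thesis using assms(1) unfolding has_hole_def by (meson order_trans)
qed

lemma num_holes_le: "num_holes k \<mu> x \<alpha> \<epsilon> i \<le> i"
proof -
  have "card {j \<in> {1..i}. has_hole k \<mu> x \<alpha> \<epsilon> j} \<le> card {1..i}" by (intro card_mono) auto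
  then show ?thesis by (simp add: num_holes_def)
qed

lemma num_holes_mono: "\<epsilon> \<le> \<epsilon>' \<Longrightarrow> num_holes k \<mu> x \<alpha> \<epsilon> i \<le> num_holes k \<mu> x \<alpha> \<epsilon>' i"
  unfolding num_holes_def by (intro card_mono) (auto intro: has_hole_mono)

lemma hole_ratio_mono: "\<epsilon> \<le> \<epsilon>' \<Longrightarrow>
  ereal (real (num_holes k \<mu> x \<alpha> \<epsilon> i) / real i) \<le> ereal (real (num_holes k \<mu> x \<alpha> \<epsilon>' i) / real i)"
  using num_holes_mono[of \<epsilon> \<epsilon>' k \<mu> x \<alpha> i] by (simp add: divide_right_mono)

lemma lower_mean_porosity_eq:
  "lower_mean_porosity k \<mu> x \<alpha> = Inf ((\<lambda>\<epsilon>. liminf (\<lambda>i. ereal (real (num_holes k \<mu> x \<alpha> \<epsilon> i) / real i))) ` {0<..})"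
  unfolding lower_mean_porosity_def
  by (intro Lim_at_right_mono Liminf_mono always_eventually allI hole_ratio_mono)

lemma upper_mean_porosity_eq:
  "upper_mean_porosity k \<mu> x \<alpha> = Inf ((\<lambda>\<epsilon>. limsup (\<lambda>i. ereal (real (num_holes k \<mu> x \<alpha> \<epsilon> i) / real i))) ` {0<..})"
  unfolding upper_mean_porosity_def
  by (intro Lim_at_right_mono Limsup_mono always_eventually allI hole_ratio_mono)

lemma lower_le_upper_mean_porosity: "lower_mean_porosity k \<mu> x \<alpha> \<le> upper_mean_porosity k \<mu> x \<alpha>"
  unfolding lower_mean_porosity_eq upper_mean_porosity_eq
proof (rule INF_mono)
  fix \<epsilon> :: real assume "\<epsilon> \<in> {0<..}"
  moreover have "liminf (\<lambda>i. ereal (real (num_holes k \<mu> x \<alpha> \<epsilon> i) / real i)) \<le> limsup (\<lambda>i. ereal (real (num_holes k \<mu> x \<alpha> \<epsilon> i) / real i))"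
    by (rule Liminf_le_Limsup) simp
  ultimately show "\<exists>\<epsilon>'\<in>{0<..}. liminf (\<lambda>i. ereal (real (num_holes k \<mu> x \<alpha> \<epsilon>' i) / real i)) \<le> limsup (\<lambda>i. ereal (real (num_holes k \<mu> x \<alpha> \<epsilon> i) / real i))"
    by blast
qed

lemma lower_mean_porosity_ge:
  assumes "\<And>\<epsilon>. 0 < \<epsilon> \<Longrightarrow> \<forall>\<^sub>F i in sequentially. c * real i \<le> real (num_holes k \<mu> x \<alpha> \<epsilon> i)"
  shows "ereal c \<le> lower_mean_porosity k \<mu> x \<alpha>"
  unfolding lower_mean_porosity_eq
proof (rule INF_greatest)
  fix \<epsilon> :: real assume "\<epsilon> \<in> {0<..}"
  then have "\<forall>\<^sub>F i in sequentially. c * real i \<le> real (num_holes k \<mu> x \<alpha> \<epsilon> i)" using assms by simp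
  then have "\<forall>\<^sub>F i in sequentially. ereal c \<le> ereal (real (num_holes k \<mu> x \<alpha> \<epsilon> i) / real i)"
    using eventually_gt_at_top[of 0] by eventually_elim (simp add: le_divide_eq)
  then show "ereal c \<le> liminf (\<lambda>i. ereal (real (num_holes k \<mu> x \<alpha> \<epsilon> i) / real i))"
    by (rule Liminf_bounded)
qed

lemma upper_mean_porosity_le:
  assumes "0 < \<epsilon>" "\<forall>\<^sub>F i in sequentially. real (num_holes k \<mu> x \<alpha> \<epsilon> i) \<le> c * real i"
  shows "upper_mean_porosity k \<mu> x \<alpha> \<le> ereal c"
  unfolding upper_mean_porosity_eq
proof (rule INF_lower2[of \<epsilon>])
  have "\<forall>\<^sub>F i in sequentially. ereal (real (num_holes k \<mu> x \<alpha> \<epsilon> i) / real i) \<le> ereal c"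
    using assms(2) eventually_gt_at_top[of 0] by eventually_elim (simp add: divide_le_eq)
  then show "limsup (\<lambda>i. ereal (real (num_holes k \<mu> x \<alpha> \<epsilon> i) / real i)) \<le> ereal c"
    by (rule Limsup_bounded)
qed (use assms in simp)

text \<open>The open ball of radius 0 is empty, so every scale has a hole.\<close>

lemma mean_porosity_zero: "mean_porosity_eq k \<mu> x 0 1" if "0 < k" for x :: "real ^ 'm"
proof -
  have hole: "has_hole k \<mu> x 0 \<epsilon> j" for \<epsilon> j
  proof -
    have "x \<in> kadic_cube k j x"
      using that by (auto simp: kadic_cube_def field_simps) linarith+
    moreover have "max_ball x 0 = {}" by (simp add: max_ball_def infnorm_pos_le not_less)
    ultimately show ?thesis unfolding has_hole_def by (intro bexI[of _ x]) auto
  qed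
  have "num_holes k \<mu> x 0 \<epsilon> i = i" for \<epsilon> i
  proof -
    have "{j \<in> {1..i}. has_hole k \<mu> x 0 \<epsilon> j} = {1..i}" using hole by blast
    then show ?thesis by (simp only: num_holes_def) simp
  qed
  then have "ereal 1 \<le> lower_mean_porosity k \<mu> x 0" "upper_mean_porosity k \<mu> x 0 \<le> ereal 1"
    by (intro lower_mean_porosity_ge, simp) (intro upper_mean_porosity_le[of 1] always_eventually allI, simp_all add: num_holes_le)
  then show ?thesis
    using lower_le_upper_mean_porosity[of k \<mu> x 0] by (auto simp: mean_porosity_eq_def one_ereal_def intro: antisym order_trans)
qed

lemma mean_porosity_eq_0I:
  assumes "0 < \<epsilon>" "\<And>j. \<not> has_hole k \<mu> x \<alpha> \<epsilon> j"
  shows "mean_porosity_eq k \<mu> x \<alpha> 0"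
proof -
  have "num_holes k \<mu> x \<alpha> \<epsilon> i = 0" for i by (simp add: num_holes_def assms(2))
  then have "upper_mean_porosity k \<mu> x \<alpha> \<le> ereal 0"
    using assms(1) by (intro upper_mean_porosity_le[of \<epsilon>]) auto
  moreover have "ereal 0 \<le> lower_mean_porosity k \<mu> x \<alpha>" by (rule lower_mean_porosity_ge) simp
  ultimately show ?thesis
    using lower_le_upper_mean_porosity[of k \<mu> x \<alpha>]
    by (auto simp: mean_porosity_eq_def zero_ereal_def[symmetric] intro: antisym order_trans)
qed

text \<open>The factor 2 pays for block 0, since the scales start at 1, and for the incomplete last block.\<close>

lemma frequency_of_scales:
  assumes n: "0 < n" and c: "0 < c" and G: "\<And>b. 0 < b \<Longrightarrow> G b \<Longrightarrow> Q (b * n)"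
    and ev: "density_ge c G"
  shows "\<forall>\<^sub>F i in sequentially. c / (2 * real n) * real i \<le> real (card {j \<in> {1..i}. Q j})"
proof -
  obtain N0 where N0: "\<And>N. N0 \<le> N \<Longrightarrow> c * real N \<le> real (card {b \<in> {..<N}. G b})"
    using ev by (auto simp: density_ge_def eventually_sequentially)
  obtain i1 :: nat where i1: "2 * real n * (c + 1) / c \<le> real i1" using real_arch_simple by blast
  show ?thesis
    unfolding eventually_sequentially
  proof (intro exI allI impI)
    fix i assume i: "max (N0 * n) i1 \<le> i"
    define N where "N = i div n"
    have "N0 * n div n \<le> N" unfolding N_def using i by (intro div_le_mono) simp
    then have N: "N0 \<le> N" using n by simp
    have Nn: "N * n \<le> i" unfolding N_def by simp
    have "(\<lambda>b. b * n) ` ({b \<in> {..<N}. G b} - {0}) \<subseteq> {j \<in> {1..i}. Q j}"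
    proof (rule image_subsetI)
      fix b assume "b \<in> {b \<in> {..<N}. G b} - {0}"
      then have b: "b < N" "G b" "b \<noteq> 0" by auto
      have "Q (b * n)" using b by (intro G) auto
      moreover have "b * n \<le> N * n" using b by simp
      then have "b * n \<le> i" using Nn by linarith
      moreover have "0 < b * n" using b n by simp
      ultimately show "b * n \<in> {j \<in> {1..i}. Q j}" by simp
    qed
    then have "card ((\<lambda>b. b * n) ` ({b \<in> {..<N}. G b} - {0})) \<le> card {j \<in> {1..i}. Q j}"
      by (intro card_mono) auto
    moreover have "card ((\<lambda>b. b * n) ` ({b \<in> {..<N}. G b} - {0})) = card ({b \<in> {..<N}. G b} - {0})"
      using n by (intro card_image) (simp add: inj_on_def)
    moreover have "card {b \<in> {..<N}. G b} \<le> card ({b \<in> {..<N}. G b} - {0}) + 1"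
      unfolding card_Diff_singleton_if by (split if_split) linarith
    ultimately have "real (card {b \<in> {..<N}. G b}) - 1 \<le> real (card {j \<in> {1..i}. Q j})" by linarith
    moreover have "c * real N \<le> real (card {b \<in> {..<N}. G b})" by (rule N0[OF N])
    moreover have "c / (2 * real n) * real i \<le> c * real N - 1"
    proof -
      have "i < (N + 1) * n" unfolding N_def using n dividend_less_div_times[of n i] by simp
      then have "real i < (real N + 1) * real n" by (metis of_nat_1 of_nat_add of_nat_less_iff of_nat_mult)
      then have "real i / real n - 1 \<le> real N" using n by (simp add: field_simps)
      then have "c * (real i / real n - 1) \<le> c * real N" using c by simp
      moreover have "c + 1 \<le> c / (2 * real n) * real i"
      proof -
        have "2 * real n * (c + 1) / c \<le> real i" using i1 i by simp
        then have "c / (2 * real n) * (2 * real n * (c + 1) / c) \<le> c / (2 * real n) * real i"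
          using c n by (intro mult_left_mono) auto
        then show ?thesis using c n by simp
      qed
      ultimately show ?thesis by (simp add: field_simps)
    qed
    ultimately show "c / (2 * real n) * real i \<le> real (card {j \<in> {1..i}. Q j})" by linarith
  qed
qed

section \<open>Holes of the natural measure\<close>

locale mandelbrot_percolation = percolation m k p P + kadic_code m k e
  for m k :: nat and p :: real and P :: "(nat list \<Rightarrow> status) measure" and e :: "nat \<Rightarrow> nat ^ 'm"
begin

definition mass_scale :: real where
  "mass_scale = diameter (cube e k []) powr limit_dim m k p"

lemma mass_scale_pos: "0 < mass_scale"
proof -
  have "cube e k [] = {x. \<forall>l. 0 \<le> x $ l \<and> x $ l \<le> 1}" by (simp add: cube_def)
  also have "\<dots> = cbox 0 1" by (auto simp: mem_box_cart)
  finally have c: "cube e k [] = cbox (0::real^'m) 1" .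
  have "(0::real^'m) \<in> cbox 0 1" "(1::real^'m) \<in> cbox 0 1" by (auto simp: mem_box_cart)
  then have "dist (0::real^'m) 1 \<le> diameter (cube e k [])"
    unfolding c by (intro diameter_bounded_bound bounded_cbox)
  then have "0 < diameter (cube e k [])" by (rule less_le_trans[rotated]) simp
  then show ?thesis unfolding mass_scale_def by simp
qed

lemma branching_measure_is_branching:
  assumes "regular \<omega>" shows "is_branching mass_scale \<omega> (branching_measure e k p \<omega>)"
proof -
  have eq: "(sets \<mu> = sets (seq_space CARD('m) k) \<and>
       (\<forall>\<sigma>\<in>words CARD('m) k.
          emeasure \<mu> {\<eta> \<in> space (seq_space CARD('m) k). seq_prefix \<eta> (length \<sigma>) = \<sigma>} =
          ennreal (diameter (cube e k []) powr limit_dim CARD('m) k p *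
                   real k powr (- (real (length \<sigma>) * limit_dim CARD('m) k p)) *
                   mart_limit CARD('m) k p \<omega> \<sigma>))) \<longleftrightarrow> is_branching mass_scale \<omega> \<mu>" for \<mu>
    unfolding is_branching_def mass_scale_def dim[symmetric] powr_limit_dim
    by (intro conj_cong ball_cong refl) (simp only: mart_limit_eq times_divide_eq_right mult_1_right)
  have "\<exists>!\<mu>. is_branching mass_scale \<omega> \<mu>"
    using branching_measure_exists[OF assms, of mass_scale] mass_scale_pos
    by (intro ex_ex1I branching_measure_unique) auto
  then show ?thesis unfolding branching_measure_def eq by (rule theI')
qed

lemma AE_spine_generic: "AE_spine C (\<lambda>\<omega> \<eta>. generic \<eta>)"
proof -
  obtain i0 i1 where i0: "i0 \<in> letters" "e i0 = (\<chi> l. 0)" and i1: "i1 \<in> letters" "e i1 = (\<chi> l. 1)"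
    using letter_of_digits[of "\<chi> l. 0"] letter_of_digits[of "\<chi> l. 1"] base by (metis vec_lambda_beta less_le_trans pos2 one_less_numeral_iff semiring_norm(76))
  have "AE_spine C (\<lambda>\<omega> \<eta>. \<forall>l. \<exists>\<^sub>F j in sequentially. e (\<eta> j) $ l \<noteq> 0)"
    using i1 by (intro AE_spine_all_countable AE_spine_letters_infinitely_often[of i1]) auto
  moreover have "AE_spine C (\<lambda>\<omega> \<eta>. \<forall>l. \<exists>\<^sub>F j in sequentially. e (\<eta> j) $ l \<noteq> k - 1)"
    using i0 base by (intro AE_spine_all_countable AE_spine_letters_infinitely_often[of i0]) auto
  ultimately have "AE_spine C (\<lambda>\<omega> \<eta>. (\<forall>l. \<exists>\<^sub>F j in sequentially. e (\<eta> j) $ l \<noteq> 0) \<and>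
      (\<forall>l. \<exists>\<^sub>F j in sequentially. e (\<eta> j) $ l \<noteq> k - 1))"
    by (rule AE_spine_conj)
  from AE_spine_conj[OF this AE_spine_regular] show ?thesis
    by (rule AE_spine_mp) (auto simp: generic_def space_seq_space Pi_iff)
qed

text \<open>A block in which only the corner subcube survives makes the cube porous, by
  \<open>hole_of_surviving_corner\<close> below.\<close>

lemma AE_spine_porous_blocks:
  assumes "p < 1" and c: "c \<in> letters"
  shows "AE_spine C (\<lambda>\<omega> \<eta>. \<forall>n. \<exists>\<gamma>>0. density_ge \<gamma>
    (\<lambda>b. \<forall>\<tau>\<in>level_words m k n - {replicate n c}. sub (seq_prefix \<eta> (b * n)) \<omega> \<tau> = Neglected))"
proof (rule AE_spine_all_countable)
  fix n
  define G where "G \<sigma> \<omega> \<longleftrightarrow> \<sigma> = replicate n c \<and> (\<forall>\<tau>\<in>level_words m k n - {\<sigma>}. \<omega> \<tau> = Neglected)" for \<sigma> \<omega>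
  have "\<exists>\<gamma>>0. AE_spine C (\<lambda>\<omega> \<eta>. density_ge \<gamma>
    (\<lambda>b. G (seq_block n b \<eta>) (sub (seq_prefix \<eta> (b * n)) \<omega>)))"
  proof (rule AE_spine_frequency)
    fix \<sigma> assume s: "\<sigma> \<in> level_words m k n"
    have [measurable]: "Measurable.pred (Omega m k) (\<lambda>\<omega>. \<forall>\<tau>\<in>level_words m k n - {\<sigma>}. \<omega> \<tau> = Neglected)"
    proof (rule pred_all_level_words)
      fix \<tau> assume [measurable]: "\<tau> \<in> words m k"
      show "Measurable.pred (Omega m k) (\<lambda>\<omega>. \<omega> \<tau> = Neglected)" by measurable
    qed
    show "Measurable.pred (Omega m k) (G \<sigma>)" unfolding G_def by measurable
    show "determined_by (Omega m k) (outside \<sigma>) (G \<sigma>)"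
    proof (rule determined_byI)
      fix x y :: "nat list \<Rightarrow> status"
      assume xy: "\<And>\<tau>. \<tau> \<in> outside \<sigma> \<Longrightarrow> x \<tau> = y \<tau>"
      have "x \<tau> = y \<tau>" if "\<tau> \<in> level_words m k n - {\<sigma>}" for \<tau>
        using that s by (intro xy) (auto dest: prefix_length_less)
      then show "G \<sigma> x = G \<sigma> y" unfolding G_def by (intro conj_cong ball_cong refl) simp
    qed
  next
    show "replicate n c \<in> level_words m k n" using c by (auto simp: lists_eq_set)
    show "0 < prob {\<omega> \<in> space P. \<omega> (replicate n c) = Chosen \<and> G (replicate n c) \<omega>}"
      using positive_prob_single_ray[OF assms] by (simp add: G_def)
  qed
  then obtain \<gamma> where g: "0 < \<gamma>" "AE_spine C (\<lambda>\<omega> \<eta>. density_ge \<gamma>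
    (\<lambda>b. G (seq_block n b \<eta>) (sub (seq_prefix \<eta> (b * n)) \<omega>)))" by blast
  from g(2) show "AE_spine C (\<lambda>\<omega> \<eta>. \<exists>\<gamma>>0. density_ge \<gamma>
    (\<lambda>b. \<forall>\<tau>\<in>level_words m k n - {replicate n c}. sub (seq_prefix \<eta> (b * n)) \<omega> \<tau> = Neglected))"
  proof (rule AE_spine_mp, intro exI conjI)
    show "0 < \<gamma>" by fact
    fix \<omega> \<eta> assume "density_ge \<gamma>
    (\<lambda>b. G (seq_block n b \<eta>) (sub (seq_prefix \<eta> (b * n)) \<omega>))"
    then show "density_ge \<gamma>
      (\<lambda>b. \<forall>\<tau>\<in>level_words m k n - {replicate n c}. sub (seq_prefix \<eta> (b * n)) \<omega> \<tau> = Neglected)"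
      by (rule density_ge_mono) (simp add: G_def)
  qed
qed

text \<open>No subcube off the ray is much lighter than the whole cube. Subcubes on the ray are exempted
  because their mass depends on the tree below the block.\<close>

definition balanced_block :: "nat \<Rightarrow> real \<Rightarrow> real \<Rightarrow> (nat list \<Rightarrow> status) \<Rightarrow> (nat \<Rightarrow> nat) \<Rightarrow> nat \<Rightarrow> bool" where
  "balanced_block n \<delta> M \<omega> \<eta> b \<longleftrightarrow> limit_size (sub (seq_prefix \<eta> (b * n)) \<omega>) \<le> M \<and>
    (\<forall>\<tau>\<in>level_words m k n - {seq_block n b \<eta>}. \<delta> \<le> limit_size (sub (seq_prefix \<eta> (b * n) @ \<tau>) \<omega>))"

text \<open>Heavy siblings have some positive lower density \<open>\<gamma>\<close>, and \<open>M\<close> can be chosen such that the mass exceeds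
  \<open>M\<close> in at most a proportion \<open>\<gamma> / 2\<close> of the blocks.\<close>

lemma AE_spine_balanced_blocks:
  "AE_spine C (\<lambda>\<omega> \<eta>. \<forall>n>0. \<exists>\<gamma>>0. \<exists>\<delta>>0. \<exists>M>0. density_ge \<gamma> (\<lambda>b. balanced_block n \<delta> M \<omega> \<eta> b))"
proof (rule AE_spine_all_countable)
  fix n :: nat
  obtain \<delta> where d: "0 < \<delta>" "0 < prob {\<omega> \<in> space P. \<delta> \<le> limit_size \<omega>}" using limit_size_positive by blast
  define G where "G \<sigma> \<omega> \<longleftrightarrow> (\<forall>\<tau>\<in>level_words m k n - {\<sigma>}. \<delta> \<le> limit_size (sub \<tau> \<omega>))" for \<sigma> \<omega>
  obtain i where i: "i \<in> letters" using letter_of_digits[of "\<chi> l. 0"] base by (metis vec_lambda_beta less_le_trans pos2)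
  have "\<exists>\<gamma>>0. AE_spine C (\<lambda>\<omega> \<eta>. density_ge \<gamma>
    (\<lambda>b. G (seq_block n b \<eta>) (sub (seq_prefix \<eta> (b * n)) \<omega>)))"
  proof (rule AE_spine_frequency)
    fix \<sigma> assume s: "\<sigma> \<in> level_words m k n"
    show "Measurable.pred (Omega m k) (G \<sigma>)"
      unfolding G_def
    proof (rule pred_all_level_words)
      fix \<tau> assume [measurable]: "\<tau> \<in> words m k"
      show "Measurable.pred (Omega m k) (\<lambda>\<omega>. \<delta> \<le> limit_size (sub \<tau> \<omega>))" by measurable
    qed
    show "determined_by (Omega m k) (outside \<sigma>) (G \<sigma>)"
    proof (rule determined_byI)
      fix x y assume xy: "x \<in> space (Omega m k)" "y \<in> space (Omega m k)"
        "\<And>\<tau>. \<tau> \<in> outside \<sigma> \<Longrightarrow> x \<tau> = y \<tau>"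
      have "sub \<tau> x = sub \<tau> y" if "\<tau> \<in> level_words m k n - {\<sigma>}" for \<tau>
        using that by (intro determined_by_sub_sibling[OF s _ _ xy]) auto
      then show "G \<sigma> x = G \<sigma> y" unfolding G_def by (intro ball_cong refl) simp
    qed
  next
    show rL: "replicate n i \<in> level_words m k n" using i by (auto simp: lists_eq_set)
    show "0 < prob {\<omega> \<in> space P. \<omega> (replicate n i) = Chosen \<and> G (replicate n i) \<omega>}"
      using positive_prob_all_children_large[OF d(2) rL] by (simp only: G_def)
  qed
  then obtain \<gamma> where g: "0 < \<gamma>" "AE_spine C (\<lambda>\<omega> \<eta>. density_ge \<gamma>
    (\<lambda>b. G (seq_block n b \<eta>) (sub (seq_prefix \<eta> (b * n)) \<omega>)))" by blast
  show "AE_spine C (\<lambda>\<omega> \<eta>. 0 < n \<longrightarrow> (\<exists>\<gamma>>0. \<exists>\<delta>>0. \<exists>M>0. density_ge \<gamma> (\<lambda>b. balanced_block n \<delta> M \<omega> \<eta> b)))"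
  proof (cases "0 < n")
    case False
    then show ?thesis by (simp add: AE_spine_def)
  next
    case True
    obtain M where M: "0 < M" "AE_spine C (\<lambda>\<omega> \<eta>. \<forall>\<^sub>F N in sequentially.
      real (card {b \<in> {..<N}. M < limit_size (sub (seq_prefix \<eta> (b * n)) \<omega>)}) \<le> \<gamma> / 2 * real N)"
      using AE_spine_mass_mostly_bounded[OF True, of "\<gamma> / 2" C] g(1) by auto
    from AE_spine_conj[OF g(2) M(2)] show ?thesis
    proof (rule AE_spine_mp, elim conjE)
      fix \<omega> \<eta>
      let ?G = "\<lambda>b. G (seq_block n b \<eta>) (sub (seq_prefix \<eta> (b * n)) \<omega>)"
        and ?M = "\<lambda>b. M < limit_size (sub (seq_prefix \<eta> (b * n)) \<omega>)"
      assume "density_ge \<gamma> (\<lambda>b. ?G b)"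
        "\<forall>\<^sub>F N in sequentially. real (card {b \<in> {..<N}. ?M b}) \<le> \<gamma> / 2 * real N"
      then have "density_ge (\<gamma> / 2) (\<lambda>b. balanced_block n \<delta> M \<omega> \<eta> b)"
        unfolding density_ge_def
      proof eventually_elim
        case (elim N)
        have "balanced_block n \<delta> M \<omega> \<eta> b" if "?G b" "\<not> ?M b" for b
          using that unfolding balanced_block_def G_def
          by (auto simp: subtree_subtree not_less simp del: in_lists_conv_set)
        then have "{b \<in> {..<N}. ?G b} \<subseteq> {b \<in> {..<N}. balanced_block n \<delta> M \<omega> \<eta> b} \<union> {b \<in> {..<N}. ?M b}" by blast
        then have "card {b \<in> {..<N}. ?G b} \<le> card ({b \<in> {..<N}. balanced_block n \<delta> M \<omega> \<eta> b} \<union> {b \<in> {..<N}. ?M b})"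
          by (intro card_mono) auto
        also have "\<dots> \<le> card {b \<in> {..<N}. balanced_block n \<delta> M \<omega> \<eta> b} + card {b \<in> {..<N}. ?M b}"
          by (rule card_Un_le)
        finally have "real (card {b \<in> {..<N}. ?G b}) \<le> real (card {b \<in> {..<N}. balanced_block n \<delta> M \<omega> \<eta> b}) + real (card {b \<in> {..<N}. ?M b})"
          by linarith
        then show ?case using elim by simp
      qed
      then show "0 < n \<longrightarrow> (\<exists>\<gamma>>0. \<exists>\<delta>>0. \<exists>M>0. density_ge \<gamma> (\<lambda>b. balanced_block n \<delta> M \<omega> \<eta> b))"
        using g(1) d(1) M(1) half_gt_zero by blast
    qed
  qed
qed

end

context mandelbrot_percolation
begin

context
  fixes \<omega> :: "nat list \<Rightarrow> status" and \<mu> :: "(nat \<Rightarrow> nat) measure" and \<nu> :: "(real ^ 'm) measure"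
  assumes reg: "regular \<omega>" and branching: "is_branching mass_scale \<omega> \<mu>"
    and AE_generic: "AE \<eta> in \<mu>. generic \<eta>"
    and \<nu>: "\<nu> = distr \<mu> borel (code_point e k)"
begin

lemma sets_\<mu> [measurable_cong, simp]: "sets \<mu> = sets (seq_space m k)"
  using branching by (simp add: is_branching_def)

lemma space_\<mu>: "space \<mu> = space (seq_space m k)"
  by (rule sets_eq_imp_space_eq[OF sets_\<mu>])

lemma measurable_code_point_\<mu> [measurable]: "code_point e k \<in> \<mu> \<rightarrow>\<^sub>M borel"
  using measurable_code_point by (simp add: measurable_cong_sets[OF sets_\<mu> refl])

lemma emeasure_\<nu>: "B \<in> sets borel \<Longrightarrow> emeasure \<nu> B = emeasure \<mu> (code_point e k -` B \<inter> space \<mu>)"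
  unfolding \<nu> by (rule emeasure_distr[OF measurable_code_point_\<mu>])

text \<open>Generic sequences lie in the half-open cube exactly if they start with its word.\<close>

lemma emeasure_\<nu>_half_open_cube:
  assumes s: "\<sigma> \<in> words m k"
  shows "emeasure \<nu> (half_open_cube \<sigma>) = ennreal (mass_scale / growth ^ length \<sigma> * limit_size (sub \<sigma> \<omega>))"
proof -
  have "emeasure \<nu> (half_open_cube \<sigma>) = emeasure \<mu> (code_point e k -` half_open_cube \<sigma> \<inter> space \<mu>)"
    by (rule emeasure_\<nu>) simp
  also have "\<dots> = emeasure \<mu> (cylinder \<sigma>)"
  proof (rule emeasure_eq_AE)
    show "AE \<eta> in \<mu>. \<eta> \<in> code_point e k -` half_open_cube \<sigma> \<inter> space \<mu> \<longleftrightarrow> \<eta> \<in> cylinder \<sigma>"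
      using AE_generic by eventually_elim (simp add: generic_in_half_open_cube_iff[OF _ s] space_\<mu> conj_commute)
    show "code_point e k -` half_open_cube \<sigma> \<inter> space \<mu> \<in> sets \<mu>"
      by (intro measurable_sets[OF measurable_code_point_\<mu>]) simp
  qed (simp only: sets_\<mu> sets_cylinder)
  also have "\<dots> = ennreal (mass_scale / growth ^ length \<sigma> * limit_size (sub \<sigma> \<omega>))"
    using branching s unfolding is_branching_def by blast
  finally show ?thesis .
qed

text \<open>The address map inverts the coding almost everywhere, so null sets of sequences
  transfer to null sets of points.\<close>

lemma AE_\<nu>_address:
  assumes "AE \<eta> in \<mu>. R \<eta>"
  shows "AE x in \<nu>. x \<in> half_open_cube [] \<and> R (address x)"
proof -
  have sets\<nu>: "sets \<nu> = sets borel" by (simp add: \<nu>)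
  have ma: "address \<in> \<nu> \<rightarrow>\<^sub>M seq_space m k"
    using measurable_address by (simp add: measurable_cong_sets[OF sets\<nu> refl])
  have "distr \<nu> (seq_space m k) address = distr \<mu> (seq_space m k) (address \<circ> code_point e k)"
    unfolding \<nu> using measurable_address by (intro distr_distr) auto
  also have "\<dots> = distr \<mu> (seq_space m k) (\<lambda>\<eta>. \<eta>)"
  proof (rule distr_cong_AE)
    show "AE \<eta> in \<mu>. (address \<circ> code_point e k) \<eta> = \<eta>"
      using AE_generic by eventually_elim (simp add: address_code_point)
    show "address \<circ> code_point e k \<in> \<mu> \<rightarrow>\<^sub>M seq_space m k"
      using measurable_comp[OF measurable_code_point_\<mu> measurable_address] .
    show "(\<lambda>\<eta>. \<eta>) \<in> \<mu> \<rightarrow>\<^sub>M seq_space m k" by (simp add: measurable_cong_sets[OF sets_\<mu> refl])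
  qed simp_all
  also have "\<dots> = \<mu>" by (rule distr_id2) simp
  finally have inverse: "distr \<nu> (seq_space m k) address = \<mu>" .
  have "AE \<eta> in distr \<nu> (seq_space m k) address. R \<eta>" unfolding inverse by (rule assms)
  from AE_distrD[OF ma this] have "AE x in \<nu>. R (address x)" .
  moreover have "AE x in \<nu>. x \<in> half_open_cube []"
    unfolding \<nu>
  proof (subst AE_distr_iff)
    show "AE \<eta> in \<mu>. code_point e k \<eta> \<in> half_open_cube []"
      using AE_generic by eventually_elim (use generic_in_half_open_cube[of _ 0] in simp)
  qed auto
  ultimately show ?thesis by eventually_elim simp
qed

context
  fixes x :: "real ^ 'm" and \<eta> :: "nat \<Rightarrow> nat"
  assumes letters: "\<And>i. \<eta> i \<in> letters" and x: "\<And>n. x \<in> half_open_cube (seq_prefix \<eta> n)"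
begin

lemma kadic_cube_prefix: "kadic_cube k j x = half_open_cube (seq_prefix \<eta> j)"
  using kadic_cube_eq[OF x[of j]] by simp

lemma prefix_words: "seq_prefix \<eta> j \<in> words m k"
  using letters by auto

lemma emeasure_kadic_cube:
  "emeasure \<nu> (kadic_cube k j x) = ennreal (mass_scale / growth ^ j * limit_size (sub (seq_prefix \<eta> j) \<omega>))"
  using emeasure_\<nu>_half_open_cube[OF prefix_words] by (simp add: kadic_cube_prefix)

text \<open>The ball is the interior of the cube and has the same positive and finite mass.\<close>

lemma no_full_hole:
  assumes pos: "0 < limit_size (sub (seq_prefix \<eta> j) \<omega>)" and \<epsilon>: "\<epsilon> < 1"
  shows "\<not> has_hole k \<nu> x 1 \<epsilon> j"
proof
  let ?Q = "kadic_cube k j x"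
  assume "has_hole k \<nu> x 1 \<epsilon> j"
  then obtain z where z: "max_ball z (1 / 2 / real k ^ j) \<subseteq> ?Q"
    "emeasure \<nu> (max_ball z (1 / 2 / real k ^ j)) \<le> ennreal \<epsilon> * emeasure \<nu> ?Q"
    unfolding has_hole_def by blast
  define B where "B = max_ball z (1 / 2 / real k ^ j)"
  have "emeasure \<nu> ?Q \<le> emeasure \<nu> B"
  proof -
    have Qb: "?Q \<in> sets borel" "B \<in> sets borel" by (simp_all add: kadic_cube_prefix B_def)
    have "emeasure \<mu> (code_point e k -` ?Q \<inter> space \<mu>) \<le> emeasure \<mu> (code_point e k -` B \<inter> space \<mu>)"
    proof (rule emeasure_mono_AE)
      show "AE \<zeta> in \<mu>. \<zeta> \<in> code_point e k -` ?Q \<inter> space \<mu> \<longrightarrow> \<zeta> \<in> code_point e k -` B \<inter> space \<mu>"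
        using AE_generic
      proof eventually_elim
        case (elim \<zeta>)
        show ?case
        proof
          assume a: "\<zeta> \<in> code_point e k -` ?Q \<inter> space \<mu>"
          then have pre: "seq_prefix \<zeta> j = seq_prefix \<eta> j"
            using generic_in_half_open_cube_iff[OF elim prefix_words[of j]] by (simp add: kadic_cube_prefix)
          have "code_point e k \<zeta> \<in> max_ball z (1 / 2 / real k ^ length (seq_prefix \<eta> j))"
            using z(1) generic_interior[OF elim, where n=j, unfolded pre]
            by (intro full_ball_contains_interior) (simp_all add: kadic_cube_prefix)
          then show "\<zeta> \<in> code_point e k -` B \<inter> space \<mu>" using a by (simp add: B_def)
        qed
      qed
      show "code_point e k -` B \<inter> space \<mu> \<in> sets \<mu>" using Qb by measurable
    qed
    then show ?thesis using Qb by (simp add: emeasure_\<nu>)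
  qed
  also have "\<dots> \<le> ennreal \<epsilon> * emeasure \<nu> ?Q" using z(2) by (simp add: B_def)
  finally have le: "emeasure \<nu> ?Q \<le> ennreal \<epsilon> * emeasure \<nu> ?Q" .
  define q where "q = mass_scale / growth ^ j * limit_size (sub (seq_prefix \<eta> j) \<omega>)"
  have q: "0 < q" unfolding q_def using mass_scale_pos pos by simp
  have "ennreal q \<le> ennreal (max 0 \<epsilon>) * ennreal q"
    using le unfolding emeasure_kadic_cube q_def[symmetric] by (cases "0 \<le> \<epsilon>") (simp_all add: max_def ennreal_neg)
  then have "ennreal q \<le> ennreal (max 0 \<epsilon> * q)" using q by (simp add: ennreal_mult)
  then have "q \<le> max 0 \<epsilon> * q" using q by (subst (asm) ennreal_le_iff) auto
  then show False using q \<epsilon> by (simp add: max_def mult_le_cancel_right1 split: if_splits)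
qed

text \<open>The open ball around the centre of the cube keeps a distance of \<open>(1 - \<alpha>) / 2\<close>, relative to the
  side length, from the lower faces. So it misses the surviving corner subcube if that has at most
  this side length, and its mass is 0.\<close>

lemma hole_of_surviving_corner:
  assumes c: "c \<in> letters" "e c = (\<chi> l. 0)" and n: "2 / real k ^ n \<le> 1 - \<alpha>" and \<alpha>: "0 < \<alpha>" "\<alpha> < 1"
    and neglected: "\<And>\<tau>. \<tau> \<in> level_words m k n - {replicate n c} \<Longrightarrow> sub (seq_prefix \<eta> j) \<omega> \<tau> = Neglected"
  shows "has_hole k \<nu> x \<alpha> \<epsilon> j"
proof -
  let ?\<sigma> = "seq_prefix \<eta> j" and ?K = "real k ^ j"
  define z where "z = corner e k ?\<sigma> + (\<chi> l. 1 / 2 / ?K)"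
  define B where "B = max_ball z (\<alpha> / 2 / ?K)"
  have zl: "z $ l = corner e k ?\<sigma> $ l + 1 / 2 / ?K" for l by (simp add: z_def)
  have K: "0 < ?K" by (rule k_pos)
  have half: "\<alpha> / 2 / ?K < 1 / 2 / ?K" by (rule divide_strict_right_mono[OF _ K]) (use \<alpha> in simp)
  have sum1: "1 / 2 / ?K + 1 / 2 / ?K = 1 / ?K" by simp
  have sub: "B \<subseteq> half_open_cube ?\<sigma>"
  proof
    fix y assume y: "y \<in> B"
    show "y \<in> half_open_cube ?\<sigma>"
      unfolding half_open_cube_def
    proof (intro CollectI allI conjI)
      fix l
      have "\<bar>z $ l - y $ l\<bar> < \<alpha> / 2 / ?K" using y by (simp only: B_def max_ball_iff)
      then show "corner e k ?\<sigma> $ l \<le> y $ l" "y $ l < corner e k ?\<sigma> $ l + 1 / real k ^ length ?\<sigma>"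
        using half zl[of l] sum1 by (simp_all only: length_map length_upt diff_zero)
    qed
  qed
  have cc: "corner e k (\<sigma> @ replicate i c) = corner e k \<sigma>" for \<sigma> i
  proof (induction i)
    case (Suc i)
    have "corner e k ((\<sigma> @ replicate i c) @ [c]) = corner e k (\<sigma> @ replicate i c)"
      by (rule vec_eq_iff[THEN iffD2]) (simp only: corner_snoc c(2) vec_lambda_beta, simp)
    then show ?case using Suc by (simp add: replicate_append_same)
  qed simp
  have null: "emeasure \<nu> B = 0"
  proof -
    have Bb: "B \<in> sets borel" by (simp add: B_def)
    have "AE \<zeta> in \<mu>. \<zeta> \<notin> cylinder (?\<sigma> @ \<tau>)" if t: "\<tau> \<in> level_words m k n - {replicate n c}" for \<tau>
    proof -
      have w: "?\<sigma> @ \<tau> \<in> words m k" using prefix_words[of j] t by simp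
      have "\<omega> (?\<sigma> @ \<tau>) \<noteq> Chosen" using neglected[OF t] t by (simp add: subtree_apply)
      then have "limit_size (sub (?\<sigma> @ \<tau>) \<omega>) = 0" by (rule regular_neglected[OF reg w])
      moreover have "emeasure \<mu> (cylinder (?\<sigma> @ \<tau>)) = ennreal (mass_scale / growth ^ length (?\<sigma> @ \<tau>) * limit_size (sub (?\<sigma> @ \<tau>) \<omega>))"
        using branching w unfolding is_branching_def by blast
      ultimately have "cylinder (?\<sigma> @ \<tau>) \<in> null_sets \<mu>" by (intro null_setsI) (simp_all only: sets_\<mu> sets_cylinder mult_zero_right ennreal_0)
      then show ?thesis by (rule AE_not_in)
    qed
    then have "AE \<zeta> in \<mu>. \<forall>\<tau>\<in>level_words m k n - {replicate n c}. \<zeta> \<notin> cylinder (?\<sigma> @ \<tau>)"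
      by (subst AE_ball_countable) (auto intro: countableI_type)
    then have "AE \<zeta> in \<mu>. \<zeta> \<notin> code_point e k -` B \<inter> space \<mu>"
      using AE_generic
    proof eventually_elim
      case (elim \<zeta>)
      show ?case
      proof
        assume a: "\<zeta> \<in> code_point e k -` B \<inter> space \<mu>"
        let ?y = "code_point e k \<zeta>"
        have y: "?y \<in> half_open_cube (seq_prefix \<zeta> (j + n))" by (rule generic_in_half_open_cube[OF elim(2)])
        have "?y \<in> B" "\<zeta> \<in> space \<mu>" using a by simp_all
        then have \<sigma>: "seq_prefix \<zeta> j = ?\<sigma>"
          using generic_in_half_open_cube_iff[OF elim(2) prefix_words[of j]] sub by (metis length_map length_upt diff_zero subsetD)
        have pre: "seq_prefix \<zeta> (j + n) = ?\<sigma> @ map \<zeta> [j..<j + n]"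
          unfolding upt_add_eq_append[of 0 j n, OF le0] map_append \<sigma> ..
        have "length (?\<sigma> @ map \<zeta> [j..<j + n]) = j + n" by simp
        then have "\<zeta> \<in> cylinder (?\<sigma> @ map \<zeta> [j..<j + n])"
          using pre \<open>\<zeta> \<in> space \<mu>\<close> unfolding space_\<mu> by (simp only: mem_Collect_eq)
        moreover have "map \<zeta> [j..<j + n] \<in> level_words m k n" using elim(2) by (auto simp: generic_def)
        ultimately have "map \<zeta> [j..<j + n] = replicate n c" using elim(1) by blast
        then have "?y \<in> half_open_cube (?\<sigma> @ replicate n c)" using y unfolding pre by (simp only:)
        then have y1: "?y $ l < corner e k ?\<sigma> $ l + 1 / real k ^ (j + n)" for l
          by (simp add: half_open_cube_def cc)
        have y2: "\<bar>z $ l - ?y $ l\<bar> < \<alpha> / 2 / ?K" for l using a unfolding B_def vimage_def Int_iff mem_Collect_eq max_ball_iff by blast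
        have "1 / real k ^ (j + n) \<le> 1 / 2 / ?K - \<alpha> / 2 / ?K"
        proof -
          have "1 / real k ^ (j + n) = (2 / real k ^ n) * (1 / 2 / ?K)" by (simp add: power_add)
          also have "\<dots> \<le> (1 - \<alpha>) * (1 / 2 / ?K)" using n by (intro mult_right_mono) auto
          also have "\<dots> = 1 / 2 / ?K - \<alpha> / 2 / ?K" by (simp add: left_diff_distrib diff_divide_distrib)
          finally show ?thesis .
        qed
        then show False using y1[of undefined] y2[of undefined] zl[of undefined] by linarith
      qed
    qed
    then have "code_point e k -` B \<inter> space \<mu> \<in> null_sets \<mu>"
      using measurable_sets[OF measurable_code_point_\<mu> Bb] by (simp only: AE_iff_null_sets)
    then have "emeasure \<mu> (code_point e k -` B \<inter> space \<mu>) = 0" by (rule null_setsD1)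
    then show ?thesis using Bb by (simp add: emeasure_\<nu>)
  qed
  have "0 < \<alpha> / 2 / ?K" using \<alpha>(1) K by (intro divide_pos_pos) auto
  then have "z \<in> B" unfolding B_def max_ball_iff by simp
  then show ?thesis
    unfolding has_hole_def kadic_cube_prefix using sub null by (intro bexI[of _ z]) (auto simp: B_def)
qed

text \<open>A ball of relative size \<open>\<alpha>\<close> contains a whole subcube of level \<open>n\<close>, hence two of level \<open>n + 1\<close>,
  and one of these is off the ray.\<close>

lemma no_hole_of_balanced_block:
  assumes n: "1 / real k ^ n \<le> \<alpha> / 2" and bal: "balanced_block (Suc n) \<delta> M \<omega> \<eta> b" and \<delta>: "0 < \<delta>" and M: "0 < M"
  shows "\<not> has_hole k \<nu> x \<alpha> (\<delta> / (2 * growth ^ Suc n * M)) (b * Suc n)"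
proof
  define j where "j = b * Suc n"
  define \<epsilon> where "\<epsilon> = \<delta> / (2 * growth ^ Suc n * M)"
  have \<epsilon>: "0 < \<epsilon>" using \<delta> M by (simp add: \<epsilon>_def)
  let ?\<sigma> = "seq_prefix \<eta> j"
  assume "has_hole k \<nu> x \<alpha> (\<delta> / (2 * growth ^ Suc n * M)) (b * Suc n)"
  then obtain z where z: "z \<in> half_open_cube ?\<sigma>"
    "emeasure \<nu> (max_ball z (\<alpha> / 2 / real k ^ j)) \<le> ennreal \<epsilon> * emeasure \<nu> (kadic_cube k j x)"
    unfolding has_hole_def j_def[symmetric] \<epsilon>_def[symmetric] kadic_cube_prefix by blast
  obtain \<tau> where t: "\<tau> \<in> words m k" "length \<tau> = n" "z \<in> half_open_cube (?\<sigma> @ \<tau>)"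
    using half_open_cube_subdivide_level[OF z(1), of n] by blast
  obtain i0 i1 where i01: "i0 \<in> letters" "i1 \<in> letters" "i0 \<noteq> i1"
  proof -
    obtain i0 where i0: "i0 \<in> letters" "e i0 = (\<chi> l. 0)" using letter_of_digits[of "\<chi> l. 0"] base by auto
    obtain i1 where i1: "i1 \<in> letters" "e i1 = (\<chi> l. 1)" using letter_of_digits[of "\<chi> l. 1"] base by auto
    have "i0 \<noteq> i1" using i0(2) i1(2) by (auto simp: vec_eq_iff)
    then show thesis using that i0 i1 by blast
  qed
  obtain i where i: "i \<in> letters" "\<tau> @ [i] \<noteq> seq_block (Suc n) b \<eta>"
  proof (cases "\<tau> @ [i0] = seq_block (Suc n) b \<eta>")
    case True
    then have "\<tau> @ [i1] \<noteq> seq_block (Suc n) b \<eta>" using i01(3) by (metis append1_eq_conv)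
    then show thesis using that i01 by blast
  qed (use that i01 in blast)
  have ti: "\<tau> @ [i] \<in> level_words m k (Suc n) - {seq_block (Suc n) b \<eta>}" using t i by auto
  then have heavy: "\<delta> \<le> limit_size (sub (?\<sigma> @ \<tau> @ [i]) \<omega>)"
    using bal unfolding balanced_block_def j_def by blast
  have light: "limit_size (sub ?\<sigma> \<omega>) \<le> M"
    using bal unfolding balanced_block_def j_def by blast
  have w: "?\<sigma> @ \<tau> @ [i] \<in> words m k" using prefix_words[of j] t i by simp
  have "half_open_cube (?\<sigma> @ \<tau> @ [i]) \<subseteq> half_open_cube (?\<sigma> @ \<tau>)"
    using half_open_cube_snoc_subset[OF i(1), of "?\<sigma> @ \<tau>"] by simp
  also have "\<dots> \<subseteq> max_ball z (\<alpha> / 2 / real k ^ j)"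
  proof (rule half_open_cube_subset_max_ball[OF t(3)])
    have "1 / real k ^ length (?\<sigma> @ \<tau>) = 1 / real k ^ n / real k ^ j" using t by (simp add: power_add mult.commute)
    also have "\<dots> \<le> \<alpha> / 2 / real k ^ j" using n by (rule divide_right_mono) simp
    finally show "1 / real k ^ length (?\<sigma> @ \<tau>) \<le> \<alpha> / 2 / real k ^ j" .
  qed
  finally have "emeasure \<nu> (half_open_cube (?\<sigma> @ \<tau> @ [i])) \<le> emeasure \<nu> (max_ball z (\<alpha> / 2 / real k ^ j))"
    by (rule emeasure_mono) (simp add: \<nu>)
  also have "\<dots> \<le> ennreal \<epsilon> * emeasure \<nu> (kadic_cube k j x)" by (rule z(2))
  finally have "ennreal (mass_scale / growth ^ (j + Suc n) * limit_size (sub (?\<sigma> @ \<tau> @ [i]) \<omega>))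
      \<le> ennreal \<epsilon> * ennreal (mass_scale / growth ^ j * limit_size (sub ?\<sigma> \<omega>))"
    using emeasure_\<nu>_half_open_cube[OF w] t(2) by (simp add: emeasure_kadic_cube)
  also have "\<dots> = ennreal (\<epsilon> * (mass_scale / growth ^ j * limit_size (sub ?\<sigma> \<omega>)))"
    using \<epsilon> mass_scale_pos regular_nonneg[OF reg prefix_words[of j]] by (intro ennreal_mult[symmetric]) auto
  finally have "mass_scale / growth ^ (j + Suc n) * limit_size (sub (?\<sigma> @ \<tau> @ [i]) \<omega>)
      \<le> \<epsilon> * (mass_scale / growth ^ j * limit_size (sub ?\<sigma> \<omega>))"
    using \<epsilon> mass_scale_pos regular_nonneg[OF reg prefix_words[of j]] by (subst (asm) ennreal_le_iff) auto
  moreover have "mass_scale / growth ^ (j + Suc n) * \<delta> \<le> mass_scale / growth ^ (j + Suc n) * limit_size (sub (?\<sigma> @ \<tau> @ [i]) \<omega>)"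
    using heavy mass_scale_pos by (intro mult_left_mono) auto
  moreover have "\<epsilon> * (mass_scale / growth ^ j * limit_size (sub ?\<sigma> \<omega>)) \<le> \<epsilon> * (mass_scale / growth ^ j * M)"
    using light \<epsilon> mass_scale_pos by (intro mult_left_mono) auto
  ultimately have "mass_scale / growth ^ (j + Suc n) * \<delta> \<le> \<epsilon> * (mass_scale / growth ^ j * M)" by linarith
  also have "\<dots> = mass_scale / growth ^ (j + Suc n) * \<delta> / 2"
    using M by (simp add: \<epsilon>_def power_add field_simps)
  finally have "mass_scale / growth ^ (j + Suc n) * \<delta> \<le> mass_scale / growth ^ (j + Suc n) * \<delta> / 2" .
  moreover have "0 < mass_scale / growth ^ (j + Suc n) * \<delta>" using mass_scale_pos \<delta> by simp
  moreover have "X \<le> X / 2 \<Longrightarrow> 0 < X \<Longrightarrow> False" for X :: real by linarith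
  ultimately show False by blast
qed

lemma lower_mean_porosity_pos:
  assumes c: "c \<in> letters" "e c = (\<chi> l. 0)" and \<alpha>: "0 < \<alpha>" "\<alpha> < 1"
    and freq: "\<And>n. \<exists>\<gamma>>0. density_ge \<gamma>
    (\<lambda>b. \<forall>\<tau>\<in>level_words m k n - {replicate n c}. sub (seq_prefix \<eta> (b * n)) \<omega> \<tau> = Neglected)"
  shows "0 < lower_mean_porosity k \<nu> x \<alpha>"
proof -
  obtain n where "(1 / real k) ^ n < (1 - \<alpha>) / 2"
    using real_arch_pow_inv[of "(1 - \<alpha>) / 2" "1 / real k"] \<alpha> base by auto
  moreover have "(1 / real k) ^ Suc n \<le> (1 / real k) ^ n" using base by (intro power_decreasing) auto
  ultimately have n: "2 / real k ^ Suc n \<le> 1 - \<alpha>" by (simp add: power_one_over)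
  obtain \<gamma> where \<gamma>: "0 < \<gamma>" "density_ge \<gamma>
    (\<lambda>b. \<forall>\<tau>\<in>level_words m k (Suc n) - {replicate (Suc n) c}. sub (seq_prefix \<eta> (b * Suc n)) \<omega> \<tau> = Neglected)"
    using freq[of "Suc n"] by blast
  have "ereal (\<gamma> / (2 * real (Suc n))) \<le> lower_mean_porosity k \<nu> x \<alpha>"
  proof (rule lower_mean_porosity_ge)
    fix \<epsilon> :: real
    have "\<forall>\<^sub>F i in sequentially. \<gamma> / (2 * real (Suc n)) * real i \<le> real (card {j \<in> {1..i}. has_hole k \<nu> x \<alpha> \<epsilon> j})"
    proof (rule frequency_of_scales[OF _ \<gamma>(1) _ \<gamma>(2)])
      fix b
      assume "\<forall>\<tau>\<in>level_words m k (Suc n) - {replicate (Suc n) c}. sub (seq_prefix \<eta> (b * Suc n)) \<omega> \<tau> = Neglected"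
      then show "has_hole k \<nu> x \<alpha> \<epsilon> (b * Suc n)" by (intro hole_of_surviving_corner[OF c n \<alpha>]) blast
    qed simp
    then show "\<forall>\<^sub>F i in sequentially. \<gamma> / (2 * real (Suc n)) * real i \<le> real (num_holes k \<nu> x \<alpha> \<epsilon> i)"
      by (simp only: num_holes_def)
  qed
  moreover have "(0 :: ereal) < ereal (\<gamma> / (2 * real (Suc n)))" using \<gamma>(1) by (simp del: of_nat_Suc)
  ultimately show ?thesis by (rule less_le_trans[rotated])
qed

lemma upper_mean_porosity_less_1:
  assumes \<alpha>: "0 < \<alpha>"
    and freq: "\<And>n. 0 < n \<Longrightarrow> \<exists>\<gamma>>0. \<exists>\<delta>>0. \<exists>M>0. density_ge \<gamma> (\<lambda>b. balanced_block n \<delta> M \<omega> \<eta> b)"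
  shows "upper_mean_porosity k \<nu> x \<alpha> < 1"
proof -
  obtain n where "(1 / real k) ^ n < \<alpha> / 2"
    using real_arch_pow_inv[of "\<alpha> / 2" "1 / real k"] \<alpha> base by auto
  then have n: "1 / real k ^ n \<le> \<alpha> / 2" by (simp add: power_one_over)
  obtain \<gamma> \<delta> M where \<gamma>: "0 < \<gamma>" "0 < \<delta>" "0 < M" "density_ge \<gamma> (\<lambda>b. balanced_block (Suc n) \<delta> M \<omega> \<eta> b)"
    using freq[of "Suc n"] by blast
  define \<epsilon> where "\<epsilon> = \<delta> / (2 * growth ^ Suc n * M)"
  have \<epsilon>: "0 < \<epsilon>" using \<gamma> by (simp add: \<epsilon>_def)
  define c where "c = \<gamma> / (2 * real (Suc n))"
  have c: "0 < c" unfolding c_def using \<gamma>(1) by (simp del: of_nat_Suc)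
  have ev: "\<forall>\<^sub>F i in sequentially. c * real i \<le> real (card {j \<in> {1..i}. \<not> has_hole k \<nu> x \<alpha> \<epsilon> j})"
    unfolding c_def
  proof (rule frequency_of_scales[OF _ \<gamma>(1) _ \<gamma>(4)])
    fix b assume "balanced_block (Suc n) \<delta> M \<omega> \<eta> b"
    then show "\<not> has_hole k \<nu> x \<alpha> \<epsilon> (b * Suc n)"
      unfolding \<epsilon>_def using \<gamma> by (intro no_hole_of_balanced_block[OF n])
  qed simp
  have "upper_mean_porosity k \<nu> x \<alpha> \<le> ereal (1 - c)"
  proof (rule upper_mean_porosity_le[OF \<epsilon>])
    from ev show "\<forall>\<^sub>F i in sequentially. real (num_holes k \<nu> x \<alpha> \<epsilon> i) \<le> (1 - c) * real i"
    proof eventually_elim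
      case (elim i)
      have "{1..i} = {j \<in> {1..i}. has_hole k \<nu> x \<alpha> \<epsilon> j} \<union> {j \<in> {1..i}. \<not> has_hole k \<nu> x \<alpha> \<epsilon> j}" by blast
      then have "card {1..i} = card ({j \<in> {1..i}. has_hole k \<nu> x \<alpha> \<epsilon> j} \<union> {j \<in> {1..i}. \<not> has_hole k \<nu> x \<alpha> \<epsilon> j})"
        by (rule arg_cong)
      also have "\<dots> = num_holes k \<nu> x \<alpha> \<epsilon> i + card {j \<in> {1..i}. \<not> has_hole k \<nu> x \<alpha> \<epsilon> j}"
        unfolding num_holes_def by (rule card_Un_disjoint) auto
      finally have "real i = real (num_holes k \<nu> x \<alpha> \<epsilon> i) + real (card {j \<in> {1..i}. \<not> has_hole k \<nu> x \<alpha> \<epsilon> j})"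
        by simp
      then show ?case using elim by (simp add: left_diff_distrib)
    qed
  qed
  also have "ereal (1 - c) < 1" using c by (simp add: one_ereal_def)
  finally show ?thesis .
qed

end

end

text \<open>The frequencies hold for almost every ray. Through the address map they hold for almost every
  point, and only countably many block lengths are involved, whereas \<open>\<alpha>\<close> ranges over an interval.\<close>

theorem AE_porosity:
  "AE \<omega> in P. AE x in natural_measure e k p \<omega>.
    (\<forall>\<alpha>. 0 < \<alpha> \<and> \<alpha> < 1 \<longrightarrow>
       (p < 1 \<longrightarrow> 0 < lower_mean_porosity k (natural_measure e k p \<omega>) x \<alpha>) \<and>
       lower_mean_porosity k (natural_measure e k p \<omega>) x \<alpha> \<le> upper_mean_porosity k (natural_measure e k p \<omega>) x \<alpha> \<and>
       upper_mean_porosity k (natural_measure e k p \<omega>) x \<alpha> < 1) \<and>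
    mean_porosity_eq k (natural_measure e k p \<omega>) x 0 1 \<and>
    mean_porosity_eq k (natural_measure e k p \<omega>) x 1 0"
proof -
  obtain c where c: "c \<in> letters" "e c = (\<chi> l. 0)" using letter_of_digits[of "\<chi> l. 0"] base by auto
  define porous where "porous \<omega> \<eta> \<longleftrightarrow> (p < 1 \<longrightarrow> (\<forall>n. \<exists>\<gamma>>0. density_ge \<gamma>
    (\<lambda>b. \<forall>\<tau>\<in>level_words m k n - {replicate n c}. sub (seq_prefix \<eta> (b * n)) \<omega> \<tau> = Neglected)))" for \<omega> \<eta>
  define balanced where "balanced \<omega> \<eta> \<longleftrightarrow> (\<forall>n>0. \<exists>\<gamma>>0. \<exists>\<delta>>0. \<exists>M>0. density_ge \<gamma> (\<lambda>b. balanced_block n \<delta> M \<omega> \<eta> b))" for \<omega> \<eta>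
  define heavy where "heavy \<omega> \<eta> \<longleftrightarrow> (\<forall>j. 0 < limit_size (sub (seq_prefix \<eta> j) \<omega>))" for \<omega> \<eta>
  have "AE_spine mass_scale porous"
  proof (cases "p < 1")
    case True
    then show ?thesis unfolding porous_def using AE_spine_porous_blocks[OF True c(1)] by simp
  qed (simp add: porous_def AE_spine_def)
  moreover have "AE_spine mass_scale balanced" unfolding balanced_def by (rule AE_spine_balanced_blocks)
  moreover have "AE_spine mass_scale heavy" unfolding heavy_def by (rule AE_spine_limit_size_pos)
  ultimately have R: "AE_spine mass_scale (\<lambda>\<omega> \<eta>. porous \<omega> \<eta> \<and> balanced \<omega> \<eta> \<and> heavy \<omega> \<eta>)"
    by (intro AE_spine_conj)
  from R AE_spine_generic[of mass_scale] AE_regular show ?thesis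
    unfolding AE_spine_def
  proof eventually_elim
    case (elim \<omega>)
    let ?\<mu> = "branching_measure e k p \<omega>" and ?\<nu> = "natural_measure e k p \<omega>"
    have br: "is_branching mass_scale \<omega> ?\<mu>" by (rule branching_measure_is_branching[OF elim(3)])
    have gen: "AE \<eta> in ?\<mu>. generic \<eta>" and AE\<eta>: "AE \<eta> in ?\<mu>. porous \<omega> \<eta> \<and> balanced \<omega> \<eta> \<and> heavy \<omega> \<eta>"
      using elim br by blast+
    have nu: "?\<nu> = distr ?\<mu> borel (code_point e k)" by (simp add: natural_measure_def)
    note facts = elim(3) br gen nu
    from AE_\<nu>_address[OF facts AE\<eta>] show ?case
    proof eventually_elim
      case (elim x)
      define \<eta> where "\<eta> = address x"
      have good: "porous \<omega> \<eta>" "balanced \<omega> \<eta>" "heavy \<omega> \<eta>" using elim by (simp_all add: \<eta>_def)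
      have let': "\<eta> i \<in> letters" for i unfolding \<eta>_def by (rule address_digit(1))
      have x: "x \<in> half_open_cube (seq_prefix \<eta> n)" for n
        unfolding \<eta>_def using elim by (intro in_half_open_cube_address) simp
      note facts' = facts let' x
      have "0 < lower_mean_porosity k ?\<nu> x \<alpha>" if "p < 1" "0 < \<alpha>" "\<alpha> < 1" for \<alpha>
        using good(1) that unfolding porous_def by (intro lower_mean_porosity_pos[OF facts' c that(2,3)]) blast
      moreover have "upper_mean_porosity k ?\<nu> x \<alpha> < 1" if "0 < \<alpha>" for \<alpha>
        using good(2) unfolding balanced_def by (intro upper_mean_porosity_less_1[OF facts' that]) blast
      moreover have "mean_porosity_eq k ?\<nu> x 1 0"
        using good(3) unfolding heavy_def by (intro mean_porosity_eq_0I[of "1/2"] no_full_hole[OF facts']) auto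
      moreover have "mean_porosity_eq k ?\<nu> x 0 1" using base by (intro mean_porosity_zero) simp
      ultimately show ?case using lower_le_upper_mean_porosity[of k ?\<nu> x] by blast
    qed
  qed
qed

end

theorem corollary4p13:
  fixes k :: nat and p :: real
    and e :: "nat \<Rightarrow> nat ^ 'm"
    and P :: "(nat list \<Rightarrow> status) measure"
  assumes "k \<ge> 2"
    and "1 / real k ^ CARD('m) < p" and "p \<le> 1"
    and "enumeration e k"
    and "percolation_law CARD('m) k p P"
  shows "AE \<omega> in P. AE x in natural_measure e k p \<omega>. x \<in> limit_set e k \<omega> \<longrightarrow>
    (\<forall>\<alpha>. 0 < \<alpha> \<and> \<alpha> < 1 \<longrightarrow>
       (p < 1 \<longrightarrow> 0 < lower_mean_porosity k (natural_measure e k p \<omega>) x \<alpha>) \<and>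
       lower_mean_porosity k (natural_measure e k p \<omega>) x \<alpha>
         \<le> upper_mean_porosity k (natural_measure e k p \<omega>) x \<alpha> \<and>
       upper_mean_porosity k (natural_measure e k p \<omega>) x \<alpha> < 1) \<and>
    mean_porosity_eq k (natural_measure e k p \<omega>) x 0 1 \<and>
    mean_porosity_eq k (natural_measure e k p \<omega>) x 1 0"
proof -
  interpret mandelbrot_percolation "CARD('m)" k p P e
    by unfold_locales (use assms in simp_all)
  from AE_porosity show ?thesis
  proof eventually_elim
    case (elim \<omega>)
    then show ?case by eventually_elim blast
  qed
qed

end
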